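(* Let $n\ge 3$ and $\ell\ge 1$ be integers and put $\mu=\frac{1}{2(n-1)\ell}$. There exist positive real numbers $X_0=X_0(n,\ell)$ and $c=c(n,\ell)$ such that for every $X>X_0$ there are at least $cX^{\mu}$ pairwise non-isomorphic number fields of degree $n$ whose discriminant does not exceed $X$ in absolute value and whose class number is divisible by $\ell$. Moreover, these fields can be chosen so that the class group of each of them contains an element of exact order $\ell$. *)

theory Defs
  imports Complex_Main "HOL-Computational_Algebra.Polynomial" "HOL-Combinatorics.Permutations"
begin

text \<open>Number fields are realised as subfields of the complex numbers (every number
field embeds into the complex numbers, and isomorphism classes are what is counted).\<close>

definition subfield_C :: "complex set \<Rightarrow> bool" where
  "subfield_C K \<longleftrightarrow> 0 \<in> K \<and> 1 \<in> K \<and>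
     (\<forall>x\<in>K. \<forall>y\<in>K. x + y \<in> K \<and> x * y \<in> K) \<and>
     (\<forall>x\<in>K. - x \<in> K) \<and> (\<forall>x\<in>K. x \<noteq> 0 \<longrightarrow> inverse x \<in> K)"

definition Q_basis :: "complex set \<Rightarrow> nat \<Rightarrow> (nat \<Rightarrow> complex) \<Rightarrow> bool" where
  "Q_basis K n b \<longleftrightarrow> (\<forall>i<n. b i \<in> K) \<and>
     (\<forall>c :: nat \<Rightarrow> rat. (\<Sum>i<n. of_rat (c i) * b i) = 0 \<longrightarrow> (\<forall>i<n. c i = 0)) \<and>
     (\<forall>x\<in>K. \<exists>c :: nat \<Rightarrow> rat. x = (\<Sum>i<n. of_rat (c i) * b i))"

definition number_field :: "nat \<Rightarrow> complex set \<Rightarrow> bool" where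
  "number_field n K \<longleftrightarrow> subfield_C K \<and> (\<exists>b. Q_basis K n b)"

definition algebraic_integer :: "complex \<Rightarrow> bool" where
  "algebraic_integer x \<longleftrightarrow> (\<exists>p :: int poly. lead_coeff p = 1 \<and> poly (map_poly of_int p) x = 0)"

definition ring_of_integers :: "complex set \<Rightarrow> complex set" where
  "ring_of_integers K = {x \<in> K. algebraic_integer x}"

definition integral_basis :: "complex set \<Rightarrow> nat \<Rightarrow> (nat \<Rightarrow> complex) \<Rightarrow> bool" where
  "integral_basis K n b \<longleftrightarrow> Q_basis K n b \<and> (\<forall>i<n. b i \<in> ring_of_integers K) \<and>
     (\<forall>x\<in>ring_of_integers K. \<exists>c :: nat \<Rightarrow> int. x = (\<Sum>i<n. of_int (c i) * b i))"

definition embeddings :: "complex set \<Rightarrow> (complex \<Rightarrow> complex) set" where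
  "embeddings K = {\<sigma>. \<sigma> 1 = 1 \<and> (\<forall>x\<in>K. \<forall>y\<in>K. \<sigma> (x + y) = \<sigma> x + \<sigma> y \<and> \<sigma> (x * y) = \<sigma> x * \<sigma> y)
                      \<and> (\<forall>x. x \<notin> K \<longrightarrow> \<sigma> x = 0)}"

definition det_n :: "nat \<Rightarrow> (nat \<Rightarrow> nat \<Rightarrow> complex) \<Rightarrow> complex" where
  "det_n n M = (\<Sum>p\<in>{p. p permutes {..<n}}. of_int (sign p) * (\<Prod>i<n. M i (p i)))"

definition number_field_disc :: "nat \<Rightarrow> complex set \<Rightarrow> complex" where
  "number_field_disc n K = (THE d. \<exists>b e. integral_basis K n b \<and> bij_betw e {..<n} (embeddings K) \<and>
       d = (det_n n (\<lambda>i j. e i (b j)))^2)"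

definition nz_ideal :: "complex set \<Rightarrow> complex set \<Rightarrow> bool" where
  "nz_ideal K I \<longleftrightarrow> I \<subseteq> ring_of_integers K \<and> 0 \<in> I \<and> I \<noteq> {0} \<and>
     (\<forall>x\<in>I. \<forall>y\<in>I. x + y \<in> I) \<and> (\<forall>r\<in>ring_of_integers K. \<forall>x\<in>I. r * x \<in> I)"

definition ideal_mult :: "complex set \<Rightarrow> complex set \<Rightarrow> complex set" where
  "ideal_mult I J = {s. \<exists>(m::nat) a b. (\<forall>i<m. a i \<in> I \<and> b i \<in> J) \<and> s = (\<Sum>i<m. a i * b i)}"

fun ideal_pow :: "complex set \<Rightarrow> complex set \<Rightarrow> nat \<Rightarrow> complex set" where
  "ideal_pow K I 0 = ring_of_integers K"
| "ideal_pow K I (Suc k) = ideal_mult I (ideal_pow K I k)"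

definition principal_ideal :: "complex set \<Rightarrow> complex set \<Rightarrow> bool" where
  "principal_ideal K I \<longleftrightarrow> (\<exists>a\<in>ring_of_integers K. I = (\<lambda>x. a * x) ` ring_of_integers K)"

definition ideal_equiv :: "complex set \<Rightarrow> (complex set \<times> complex set) set" where
  "ideal_equiv K = {(I, J). nz_ideal K I \<and> nz_ideal K J \<and>
     (\<exists>a\<in>ring_of_integers K. \<exists>b\<in>ring_of_integers K. a \<noteq> 0 \<and> b \<noteq> 0 \<and>
        (\<lambda>x. a * x) ` I = (\<lambda>x. b * x) ` J)}"

definition class_number :: "complex set \<Rightarrow> nat" where
  "class_number K = card ({I. nz_ideal K I} // ideal_equiv K)"

definition has_class_of_order :: "complex set \<Rightarrow> nat \<Rightarrow> bool" where
  "has_class_of_order K l \<longleftrightarrow> (\<exists>I. nz_ideal K I \<and> principal_ideal K (ideal_pow K I l) \<and>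
      (\<forall>k. 0 < k \<and> k < l \<longrightarrow> \<not> principal_ideal K (ideal_pow K I k)))"

definition fields_isomorphic :: "complex set \<Rightarrow> complex set \<Rightarrow> bool" where
  "fields_isomorphic K L \<longleftrightarrow> (\<exists>f. bij_betw f K L \<and>
      (\<forall>x\<in>K. \<forall>y\<in>K. f (x + y) = f x + f y \<and> f (x * y) = f x * f y))"

end

theory Submission
  imports Defs "Jordan_Normal_Form.Char_Poly" "HOL-Computational_Algebra.Field_as_Ring"
    "HOL-Number_Theory.Number_Theory"
begin

hide_const (open) module.smult up_ring.coeff up_ring.monom

text \<open>
  For \<open>l \<ge> 2\<close> the fields are \<open>\<rat>(\<theta>)\<close> with \<open>\<theta>\<close> a real root, larger than all \<open>a\<^sub>j\<close>, of
  \<open>f = \<Prod>(X - a\<^sub>j) - b\<^sup>l\<close>, where \<open>b\<close> is a large power of a fixed prime \<open>q\<close>, the \<open>a\<^sub>j\<close> lie in fixed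
  residue classes, have sum \<open>0\<close> and are small compared with \<open>B = b\<^sup>l\<^sup>/\<^sup>n\<close>.
  All roots of \<open>f\<close> are close to the points \<open>B\<omega>\<close> with \<open>\<omega>\<^sup>n = 1\<close>. Since \<open>b\<close> is a prime power, a monic factor
  of \<open>f\<close> takes powers of \<open>q\<close>, up to sign, of almost the same size at all the \<open>a\<^sub>j\<close>, so it is constant: \<open>f\<close> is
  irreducible. If two of the fields are isomorphic and the roots in corresponding embeddings are close
  to the same points, then the difference of the two generators has all conjugates smaller than \<open>1\<close>
  and vanishes; so an isomorphism class contains at most \<open>n\<^sup>n\<close> of the fields.

  As the differences \<open>a\<^sub>i - a\<^sub>j\<close> are prime to \<open>q\<close>, the numbers \<open>\<theta> - a\<^sub>i\<close> with \<open>i < n - 1\<close> generate \<open>l\<close>-th powers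
  of ideals \<open>I\<^sub>i\<close>. They are independent modulo \<open>p\<close>-th powers for every prime \<open>p\<close> dividing \<open>l\<close>, by
  power residue conditions at auxiliary primes, which are built into the residue classes of the \<open>a\<^sub>j\<close>. As \<open>f\<close> has a
  nonreal root, the unit rank is at most \<open>n - 2\<close>; hence not all the ideals \<open>I\<^sub>i\<close> to the power \<open>l / p\<close> are
  principal, and a product of powers of the \<open>I\<^sub>i\<close> has a class of order exactly \<open>l\<close>. Multiplication by this
  class partitions the ideal classes into orbits of length \<open>l\<close>; no inverses of ideals are needed for
  this, and an infinite set of classes would have \<open>card\<close> equal to \<open>0\<close>.
\<close>

section \<open>Algebraic integers\<close>

text \<open>The exponent comes from this balance. With \<open>w = g^m\<close> the entries
  \<open>a j\<close> have size about \<open>w\<close>; making their sum vanish costs one parameter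
  and leaves about \<open>w^(n - 1)\<close> tuples. Taking \<open>b = w^(2(n - 1))\<close> gives
  \<open>B^n = w^(2(n - 1)l)\<close>, and the discriminants are O(\<open>B^(n(n - 1))\<close>) =
  O(\<open>w^(2(n - 1)^2 l)\<close>), so the ratio of the two exponents is
  \<open>1 / (2(n - 1)l)\<close>. The lost parameter pays for telling the fields apart. Roots must
  lie within 1/2 of fixed points, and in general they move by the order of the \<open>a j\<close>;
  the vanishing sum kills this first-order term, and an error of order \<open>A^2 / B\<close>
  remains, where \<open>A\<close> bounds the \<open>a j\<close>. So \<open>w^2\<close> must not
  exceed \<open>B\<close>, which amounts to \<open>n \<le> (n - 1)l\<close>. This holds for
  \<open>l \<ge> 2\<close> and fails for \<open>l = 1\<close>; hence the separate family for
  \<open>l = 1\<close>, where every class group has an element of the required order and only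
  irreducibility, size and non-isomorphism matter.\<close>

definition zspan :: "'i set \<Rightarrow> ('i \<Rightarrow> complex) \<Rightarrow> complex set" where
  "zspan I v = {x. \<exists>c :: 'i \<Rightarrow> int. x = (\<Sum>i\<in>I. of_int (c i) * v i)}"

lemma zspan_0: "0 \<in> zspan I v"
  unfolding zspan_def by (auto intro!: exI[of _ "\<lambda>_. 0"])

lemma zspan_add: "x \<in> zspan I v \<Longrightarrow> y \<in> zspan I v \<Longrightarrow> x + y \<in> zspan I v"
proof -
  assume "x \<in> zspan I v" "y \<in> zspan I v"
  then obtain c d :: "'a \<Rightarrow> int" where "x = (\<Sum>i\<in>I. of_int (c i) * v i)" "y = (\<Sum>i\<in>I. of_int (d i) * v i)"
    unfolding zspan_def by auto
  hence "x + y = (\<Sum>i\<in>I. of_int (c i + d i) * v i)"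
    by (simp add: sum.distrib algebra_simps)
  thus ?thesis unfolding zspan_def by (auto intro!: exI[of _ "\<lambda>i. c i + d i"])
qed

lemma zspan_int_mult: "x \<in> zspan I v \<Longrightarrow> of_int k * x \<in> zspan I v"
proof -
  assume "x \<in> zspan I v"
  then obtain c :: "'a \<Rightarrow> int" where "x = (\<Sum>i\<in>I. of_int (c i) * v i)"
    unfolding zspan_def by auto
  hence "of_int k * x = (\<Sum>i\<in>I. of_int (k * c i) * v i)"
    by (simp add: sum_distrib_left algebra_simps)
  thus ?thesis unfolding zspan_def by (auto intro!: exI[of _ "\<lambda>i. k * c i"])
qed

lemma zspan_sum: "(\<And>j. j \<in> J \<Longrightarrow> f j \<in> zspan I v) \<Longrightarrow> (\<Sum>j\<in>J. f j) \<in> zspan I v"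
  by (induction J rule: infinite_finite_induct) (auto intro: zspan_0 zspan_add)

lemma zspan_base: "finite I \<Longrightarrow> i \<in> I \<Longrightarrow> v i \<in> zspan I v"
proof -
  assume I: "finite I" "i \<in> I"
  have "(\<Sum>j\<in>I. of_int (if j = i then 1 else 0) * v j) = (\<Sum>j\<in>I. if j = i then v j else 0)"
    by (intro sum.cong) auto
  also have "\<dots> = v i" using I by simp
  finally show ?thesis unfolding zspan_def by (auto intro!: exI[of _ "\<lambda>j. if j = i then 1 else 0"])
qed

lemma zspan_mult_stable:
  assumes "\<And>i. i \<in> I \<Longrightarrow> x * v i \<in> zspan I v" and "y \<in> zspan I v"
  shows "x * y \<in> zspan I v"
proof -
  from assms(2) obtain c :: "'a \<Rightarrow> int" where y: "y = (\<Sum>i\<in>I. of_int (c i) * v i)"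
    unfolding zspan_def by auto
  have "x * y = (\<Sum>i\<in>I. of_int (c i) * (x * v i))"
    unfolding y by (simp add: sum_distrib_left algebra_simps)
  thus ?thesis using assms(1) by (auto intro!: zspan_sum zspan_int_mult)
qed

lemma algebraic_integer_iff: "algebraic_integer x \<longleftrightarrow> algebraic_int x"
  unfolding algebraic_integer_def algebraic_int_altdef_ipoly by auto

text \<open>The relations make \<open>v\<close> an eigenvector of the integer matrix
  \<open>A\<close> with eigenvalue \<open>x\<close>, so \<open>x\<close> is a root of a
  characteristic polynomial, which is monic with integer coefficients.\<close>

lemma algebraic_integer_eigenvalue:
  fixes A :: "nat \<Rightarrow> nat \<Rightarrow> int" and v :: "nat \<Rightarrow> complex"
  assumes "k < N" "v k \<noteq> 0"
    and eq: "\<And>i. i < N \<Longrightarrow> x * v i = (\<Sum>j<N. of_int (A i j) * v j)"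
  shows "algebraic_integer x"
proof -
  define M where "M = mat N N (\<lambda>(i,j). A i j)"
  define C where "C = (map_mat of_int M :: complex mat)"
  have M: "M \<in> carrier_mat N N" and C: "C \<in> carrier_mat N N"
    by (auto simp: M_def C_def)
  have "eigenvector C (vec N v) x"
    unfolding eigenvector_def
  proof (intro conjI)
    show "vec N v \<in> carrier_vec (dim_row C)" using C by simp
    show "vec N v \<noteq> 0\<^sub>v (dim_row C)"
    proof
      assume "vec N v = 0\<^sub>v (dim_row C)"
      hence "vec N v $ k = 0\<^sub>v (dim_row C) $ k" by simp
      thus False using assms(1,2) C by simp
    qed
    show "C *\<^sub>v vec N v = x \<cdot>\<^sub>v vec N v"
      by (rule eq_vecI) (auto simp: C_def M_def scalar_prod_def eq atLeast0LessThan)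
  qed
  hence "eigenvalue C x" unfolding eigenvalue_def by auto
  hence "poly (char_poly C) x = 0" using eigenvalue_root_char_poly[OF C] by simp
  moreover have "char_poly C = map_poly of_int (char_poly M)"
    unfolding C_def by (rule of_int_hom.char_poly_hom[OF M])
  moreover have "lead_coeff (char_poly M) = 1"
    using degree_monic_char_poly[OF M] by auto
  ultimately show ?thesis unfolding algebraic_integer_def by auto
qed

lemma algebraic_integer_zspan:
  assumes fin: "finite I" and k: "k \<in> I" "v k \<noteq> 0"
    and st: "\<And>i. i \<in> I \<Longrightarrow> x * v i \<in> zspan I v"
  shows "algebraic_integer x"
proof -
  obtain f where f: "bij_betw f {..<card I} I"
    using fin by (metis atLeast0LessThan ex_bij_betw_nat_finite)
  from st have "\<forall>i\<in>I. \<exists>c :: 'a \<Rightarrow> int. x * v i = (\<Sum>j\<in>I. of_int (c j) * v j)"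
    unfolding zspan_def by auto
  then obtain c :: "'a \<Rightarrow> 'a \<Rightarrow> int" where c: "\<And>i. i \<in> I \<Longrightarrow> x * v i = (\<Sum>j\<in>I. of_int (c i j) * v j)"
    by metis
  obtain m where m: "m < card I" "f m = k" using f k(1) unfolding bij_betw_def by (metis imageE lessThan_iff)
  show ?thesis
  proof (rule algebraic_integer_eigenvalue[of m "card I" "v \<circ> f" x "\<lambda>i j. c (f i) (f j)"])
    show "x * (v \<circ> f) i = (\<Sum>j<card I. of_int (c (f i) (f j)) * (v \<circ> f) j)" if "i < card I" for i
    proof -
      have "f i \<in> I" using f that unfolding bij_betw_def by auto
      from c[OF this] show ?thesis
        using sum.reindex_bij_betw[OF f, of "\<lambda>j. of_int (c (f i) j) * v j"] by simp
    qed
  qed (use m k in auto)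
qed

text \<open>The products \<open>x^i * y^j\<close> below the degrees of \<open>p\<close> and
  \<open>q\<close> span a module that multiplication by \<open>x\<close> and by \<open>y\<close>
  preserves, since monic equations rewrite the top powers. One module serves for sum and product
  alike; its nonzero vector is 1.\<close>

lemma algebraic_integer_common_span:
  assumes "algebraic_integer x" "algebraic_integer y"
  obtains I :: "(nat \<times> nat) set" and v k where "finite I" "k \<in> I" "v k \<noteq> 0"
    "\<And>z. z \<in> zspan I v \<Longrightarrow> x * z \<in> zspan I v" "\<And>z. z \<in> zspan I v \<Longrightarrow> y * z \<in> zspan I v"
proof -
  obtain p where p: "lead_coeff p = 1" "poly (map_poly of_int p) x = 0"
    using assms(1) unfolding algebraic_integer_def by auto
  obtain q where q: "lead_coeff q = 1" "poly (map_poly of_int q) y = 0"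
    using assms(2) unfolding algebraic_integer_def by auto
  define I where "I = {..<degree p} \<times> {..<degree q}"
  define v where "v = (\<lambda>(i,j). x ^ i * y ^ j)"
  have pos: "degree r > 0" if "lead_coeff r = 1" "poly (map_poly of_int r) z = 0" for r :: "int poly" and z :: complex
  proof (rule ccontr)
    assume "\<not> degree r > 0"
    hence "r = [:1:]" using that by (metis degree_eq_zeroE gr0I lead_coeff_pCons(2) pCons_0_0)
    thus False using that by simp
  qed
  have top: "z ^ degree r = (\<Sum>i<degree r. of_int (- coeff r i) * z ^ i)"
    if "lead_coeff r = 1" "poly (map_poly of_int r) z = 0" for r :: "int poly" and z :: complex
  proof -
    have "0 = (\<Sum>i\<le>degree r. of_int (coeff r i) * z ^ i)"
      using that(2) by (simp add: poly_altdef)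
    also have "\<dots> = (\<Sum>i<degree r. of_int (coeff r i) * z ^ i) + z ^ degree r"
      using that(1) by (simp add: lessThan_Suc_atMost[symmetric])
    finally show ?thesis by (simp add: sum_negf eq_neg_iff_add_eq_0 add.commute)
  qed
  have fin: "finite I" by (auto simp: I_def)
  have b: "x ^ i * y ^ j \<in> zspan I v" if "i < degree p" "j < degree q" for i j
    using zspan_base[OF fin, of "(i,j)" v] that by (auto simp: I_def v_def)
  have x: "x * v ij \<in> zspan I v" if ijI: "ij \<in> I" for ij
  proof -
    obtain i j where ij: "ij = (i,j)" "i < degree p" "j < degree q" using ijI by (auto simp: I_def)
    show ?thesis
    proof (cases "Suc i < degree p")
      case True
      thus ?thesis using b[of "Suc i" j] ij by (simp add: v_def mult.assoc)
    next
      case False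
      hence "degree p = Suc i" using ij by simp
      hence "x * v ij = (\<Sum>i<degree p. of_int (- coeff p i) * x ^ i) * y ^ j"
        using top[OF p] ij by (simp add: v_def mult.assoc)
      also have "\<dots> = (\<Sum>i<degree p. of_int (- coeff p i) * (x ^ i * y ^ j))"
        by (simp add: sum_distrib_right mult.assoc)
      also have "\<dots> \<in> zspan I v" using ij b by (intro zspan_sum zspan_int_mult) auto
      finally show ?thesis .
    qed
  qed
  have y: "y * v ij \<in> zspan I v" if ijI: "ij \<in> I" for ij
  proof -
    obtain i j where ij: "ij = (i,j)" "i < degree p" "j < degree q" using ijI by (auto simp: I_def)
    show ?thesis
    proof (cases "Suc j < degree q")
      case True
      thus ?thesis using b[of i "Suc j"] ij by (simp add: v_def mult_ac)
    next
      case False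
      hence "degree q = Suc j" using ij by simp
      hence "y * v ij = x ^ i * (\<Sum>i<degree q. of_int (- coeff q i) * y ^ i)"
        using top[OF q] ij by (simp add: v_def mult_ac)
      also have "\<dots> = (\<Sum>k<degree q. of_int (- coeff q k) * (x ^ i * y ^ k))"
        by (simp add: sum_distrib_left mult_ac)
      also have "\<dots> \<in> zspan I v" using ij b by (intro zspan_sum zspan_int_mult) auto
      finally show ?thesis .
    qed
  qed
  show ?thesis
    using that[of I "(0,0)" v] fin zspan_mult_stable[of I x v, OF x] zspan_mult_stable[of I y v, OF y]
      pos[OF p] pos[OF q] by (auto simp: I_def v_def)
qed

lemma algebraic_integer_add:
  assumes "algebraic_integer x" "algebraic_integer y" shows "algebraic_integer (x + y)"
proof -
  obtain I :: "(nat \<times> nat) set" and v k where I: "finite I" "k \<in> I" "v k \<noteq> 0"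
    and st: "\<And>z. z \<in> zspan I v \<Longrightarrow> x * z \<in> zspan I v" "\<And>z. z \<in> zspan I v \<Longrightarrow> y * z \<in> zspan I v"
    using algebraic_integer_common_span[OF assms] by metis
  show ?thesis
    by (rule algebraic_integer_zspan[where v = v and I = I, OF I]) (auto simp: ring_distribs intro!: zspan_add st zspan_base I)
qed

lemma algebraic_integer_mult:
  assumes "algebraic_integer x" "algebraic_integer y" shows "algebraic_integer (x * y)"
proof -
  obtain I :: "(nat \<times> nat) set" and v k where I: "finite I" "k \<in> I" "v k \<noteq> 0"
    and st: "\<And>z. z \<in> zspan I v \<Longrightarrow> x * z \<in> zspan I v" "\<And>z. z \<in> zspan I v \<Longrightarrow> y * z \<in> zspan I v"
    using algebraic_integer_common_span[OF assms] by metis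
  show ?thesis
    by (rule algebraic_integer_zspan[where v = v and I = I, OF I]) (auto simp: mult.assoc intro!: st zspan_base I)
qed

lemma algebraic_integer_of_int [simp, intro]: "algebraic_integer (of_int k)"
  unfolding algebraic_integer_iff by (rule int_imp_algebraic_int) simp

lemma algebraic_integer_0 [simp, intro]: "algebraic_integer 0"
  and algebraic_integer_1 [simp, intro]: "algebraic_integer 1"
  and algebraic_integer_of_nat [simp, intro]: "algebraic_integer (of_nat m)"
  unfolding algebraic_integer_iff by (rule int_imp_algebraic_int, simp)+

lemma algebraic_integer_uminus: "algebraic_integer x \<Longrightarrow> algebraic_integer (- x)"
  unfolding algebraic_integer_iff by auto

lemma algebraic_integer_diff:
  "algebraic_integer x \<Longrightarrow> algebraic_integer y \<Longrightarrow> algebraic_integer (x - y)"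
  using algebraic_integer_add[of x "- y"] algebraic_integer_uminus[of y] by simp

lemma algebraic_integer_sum:
  "(\<And>i. i \<in> I \<Longrightarrow> algebraic_integer (f i)) \<Longrightarrow> algebraic_integer (sum f I)"
  by (induction I rule: infinite_finite_induct) (auto intro: algebraic_integer_add)

lemma algebraic_integer_prod:
  "(\<And>i. i \<in> I \<Longrightarrow> algebraic_integer (f i)) \<Longrightarrow> algebraic_integer (prod f I)"
  by (induction I rule: infinite_finite_induct) (auto intro: algebraic_integer_mult)

lemma algebraic_integer_power: "algebraic_integer x \<Longrightarrow> algebraic_integer (x ^ k)"
  by (induction k) (auto intro: algebraic_integer_mult)

lemma algebraic_integer_ipoly:
  "algebraic_integer x \<Longrightarrow> algebraic_integer (poly (map_poly of_int p) x)"
  by (simp add: poly_altdef, intro algebraic_integer_sum algebraic_integer_mult algebraic_integer_power) auto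

lemma algebraic_integer_root:
  assumes "algebraic_integer (x ^ p)" "p > 0" shows "algebraic_integer x"
  using algebraic_int_root[of "x ^ p" "monom 1 p" x] assms unfolding algebraic_integer_iff
  by (simp add: poly_monom degree_monom_eq)

lemma algebraic_integer_rational:
  "algebraic_integer x \<Longrightarrow> x \<in> \<rat> \<Longrightarrow> \<exists>k :: int. x = of_int k"
  using rational_algebraic_int_is_int[of x] unfolding algebraic_integer_iff by (auto elim: Ints_cases)

section \<open>Number fields given by a polynomial\<close>

abbreviation ip :: "int poly \<Rightarrow> complex \<Rightarrow> complex" where
  "ip p x \<equiv> poly (map_poly of_int p) x"

interpretation of_rat_poly_hom: map_poly_idom_hom of_rat ..

definition rp :: "rat poly \<Rightarrow> complex \<Rightarrow> complex" where
  "rp h x = poly (map_poly of_rat h) x"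

lemma rp_simps [simp]:
  "rp (p + q) x = rp p x + rp q x" "rp (p - q) x = rp p x - rp q x" "rp (- p) x = - rp p x"
  "rp (p * q) x = rp p x * rp q x" "rp 0 x = 0" "rp 1 x = 1" "rp [:c:] x = of_rat c"
  "rp (pCons c p) x = of_rat c + x * rp p x" "rp (smult c p) x = of_rat c * rp p x"
  "rp (p ^ m) x = rp p x ^ m" "rp (monom c m) x = of_rat c * x ^ m"
  by (simp_all add: rp_def hom_distribs poly_monom)

lemma rp_of_int_poly: "rp (map_poly of_int p) x = ip p x"
  unfolding rp_def by (simp add: map_poly_map_poly o_def)

lemma clear_denominators:
  fixes h :: "rat poly"
  obtains d :: int and w :: "int poly" where "d > 0" "smult (of_int d) h = map_poly of_int w"
proof -
  have "\<exists>(d::int) w. d > 0 \<and> smult (of_int d) h = map_poly of_int w"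
  proof (induction h)
    case 0
    show ?case by (rule exI[of _ 1], rule exI[of _ 0]) simp
  next
    case (pCons c h)
    then obtain d w where dw: "d > 0" "smult (of_int d) h = map_poly of_int w" by blast
    obtain a b where ab: "c = of_int a / of_int b" "b > 0"
      by (metis Rat_cases Fract_of_int_quotient)
    have "smult (of_int (d * b)) (pCons c h) = map_poly of_int (pCons (d * a) (smult b w))"
    proof -
      have "smult (of_int (d * b)) (pCons c h) =
          pCons (of_int (d * a)) (smult (of_int b) (smult (of_int d) h))"
      proof -
        have "of_int b * of_int d * c = of_int d * of_int a" using ab by simp
        thus ?thesis by (simp add: mult_ac)
      qed
      also have "\<dots> = map_poly of_int (pCons (d * a) (smult b w))"
        unfolding dw(2) by (simp add: hom_distribs)
      finally show ?thesis .
    qed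
    thus ?case using dw ab by (intro exI[of _ "d * b"] exI[of _ "pCons (d * a) (smult b w)"]) auto
  qed
  thus ?thesis using that by blast
qed

lemma coeff_algebraic_integer_mult:
  fixes p q :: "complex poly"
  assumes "\<And>i. algebraic_integer (coeff p i)" "\<And>i. algebraic_integer (coeff q i)"
  shows "algebraic_integer (coeff (p * q) i)"
  using assms by (auto simp: coeff_mult intro!: algebraic_integer_sum algebraic_integer_mult)

lemma coeff_algebraic_integer_prod:
  fixes p :: "'a \<Rightarrow> complex poly"
  assumes "\<And>j i. j \<in> J \<Longrightarrow> algebraic_integer (coeff (p j) i)"
  shows "algebraic_integer (coeff (prod p J) i)"
  using assms
proof (induction J arbitrary: i rule: infinite_finite_induct)
  case (insert x F)
  thus ?case by (auto intro!: coeff_algebraic_integer_mult)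
qed (auto simp: coeff_1)

lemma finite_bounded_int_polys:
  "finite {p :: int poly. degree p < m \<and> (\<forall>i. \<bar>coeff p i\<bar> \<le> C)}"
proof -
  have "finite {xs. set xs \<subseteq> {-C..C} \<and> length xs \<le> m}" by (rule finite_lists_length_le) simp
  moreover have "coeffs ` {p :: int poly. degree p < m \<and> (\<forall>i. \<bar>coeff p i\<bar> \<le> C)}
      \<subseteq> {xs. set xs \<subseteq> {-C..C} \<and> length xs \<le> m}"
    by (auto simp: coeffs_def abs_le_iff split: if_splits; smt (verit))
  moreover have "inj_on coeffs A" for A :: "int poly set" by (auto intro!: inj_onI simp: coeffs_eq_iff)
  ultimately show ?thesis by (meson finite_imageD finite_subset)
qed

text \<open>An index of a root also names an embedding; index \<open>0\<close> is the generator and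
  hence the identity embedding. That the roots are distinct is a consequence of irreducibility
  (\<open>inj_roots\<close>).\<close>

locale number_field_poly =
  fixes f :: "int poly" and n :: nat and \<rho> :: "nat \<Rightarrow> complex"
  assumes npos: "n > 0"
    and roots: "map_poly of_int f = (\<Prod>i<n. [:- \<rho> i, 1:])"
    and irr: "irreducible (map_poly rat_of_int f)"
begin

definition \<theta> :: complex where "\<theta> = \<rho> 0"

definition K :: "complex set" where "K = range (\<lambda>h. rp h \<theta>)"

abbreviation fq :: "rat poly" where "fq \<equiv> map_poly of_int f"

lemma degree_fC: "degree (map_poly of_int f :: complex poly) = n"
  unfolding roots by (subst degree_prod_sum_eq) auto

lemma degree_f: "degree f = n"
  using degree_fC by simp

lemma degree_fq: "degree fq = n"
  using degree_f by simp

lemma monic_f: "lead_coeff f = 1"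
proof -
  have "lead_coeff (map_poly of_int f :: complex poly) = 1"
    unfolding roots by (simp add: lead_coeff_prod)
  thus ?thesis by simp
qed

lemma ip_f: "ip f x = (\<Prod>i<n. x - \<rho> i)"
  unfolding roots by (simp add: poly_prod)

lemma ip_f_root: "i < n \<Longrightarrow> ip f (\<rho> i) = 0"
  unfolding ip_f by (rule prod_zero) auto

lemma root_cases: "ip f x = 0 \<Longrightarrow> \<exists>i<n. x = \<rho> i"
  unfolding ip_f by auto

text \<open>If \<open>fq\<close> does not divide \<open>h\<close>, a Bezout identity
  \<open>u fq + v h = 1\<close> is contradicted at a common zero. Divisibility does not mention
  \<open>i\<close>, so a rational relation at one root holds at every root; this makes the
  embeddings well defined.\<close>

lemma rp_root_iff: assumes "i < n" shows "rp h (\<rho> i) = 0 \<longleftrightarrow> fq dvd h"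
proof
  assume "fq dvd h"
  then obtain k where "h = fq * k" by auto
  thus "rp h (\<rho> i) = 0" using ip_f_root[OF assms] by (simp add: rp_of_int_poly)
next
  assume 0: "rp h (\<rho> i) = 0"
  show "fq dvd h"
  proof (rule ccontr)
    assume "\<not> fq dvd h"
    hence "Rings.coprime fq h"
      using irr prime_elem_imp_coprime[of fq h] irreducible_imp_prime_elem_gcd[of fq] by blast
    then obtain u v where "u * fq + v * h = 1"
      by (metis bezout_coefficients_fst_snd coprime_imp_gcd_eq_1)
    hence "rp (u * fq + v * h) (\<rho> i) = 1" by simp
    thus False using 0 ip_f_root[OF assms] by (simp add: rp_of_int_poly)
  qed
qed

lemma rp_eq_iff:
  assumes "i < n" "j < n"
  shows "rp h (\<rho> i) = rp k (\<rho> i) \<longleftrightarrow> rp h (\<rho> j) = rp k (\<rho> j)"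
  using rp_root_iff[OF assms(1), of "h - k"] rp_root_iff[OF assms(2), of "h - k"] by simp

lemma degree_lt_dvd: "fq dvd h \<Longrightarrow> degree h < n \<Longrightarrow> h = 0"
  using dvd_imp_degree_le[of fq h] degree_fq by force

text \<open>This is \<open>f / (X - \<rho> i)\<close>, the numerator in Lagrange's formula; its
  value at \<open>\<rho> i\<close> is the derivative of \<open>f\<close> there.\<close>

definition P :: "nat \<Rightarrow> complex poly" where "P i = (\<Prod>j\<in>{..<n} - {i}. [:- \<rho> j, 1:])"

lemma pderiv_at_root:
  assumes "i < n" shows "ip (pderiv f) (\<rho> i) = poly (P i) (\<rho> i)"
proof -
  have "map_poly of_int (pderiv f) = pderiv (\<Prod>i<n. [:- \<rho> i, 1:])"
    unfolding roots[symmetric] by (simp add: of_int_hom.map_poly_pderiv)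
  also have "\<dots> = (\<Sum>a<n. P a)"
    unfolding P_def by (simp add: pderiv_prod pderiv_pCons)
  finally have "ip (pderiv f) (\<rho> i) = (\<Sum>a<n. poly (P a) (\<rho> i))" by (simp add: poly_sum)
  also have "\<dots> = (\<Sum>a<n. if a = i then poly (P i) (\<rho> i) else 0)"
    using assms by (intro sum.cong) (auto simp: P_def poly_prod)
  finally show ?thesis using assms by simp
qed

lemma pderiv_root_nonzero: assumes "i < n" shows "ip (pderiv f) (\<rho> i) \<noteq> 0"
proof
  assume "ip (pderiv f) (\<rho> i) = 0"
  hence "rp (map_poly of_int (pderiv f)) (\<rho> i) = 0" by (simp add: rp_of_int_poly)
  hence "fq dvd map_poly of_int (pderiv f)" using rp_root_iff[OF assms] by simp
  moreover have "degree (map_poly rat_of_int (pderiv f)) < n"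
    using degree_f npos by (simp add: degree_pderiv)
  ultimately have "map_poly rat_of_int (pderiv f) = 0" using degree_lt_dvd by blast
  hence "pderiv f = 0" by simp
  thus False using degree_f npos by (simp add: pderiv_eq_0_iff)
qed

lemma inj_roots: "inj_on \<rho> {..<n}"
proof (rule inj_onI, rule ccontr)
  fix i j assume ij: "i \<in> {..<n}" "j \<in> {..<n}" "\<rho> i = \<rho> j" "i \<noteq> j"
  hence "poly (P i) (\<rho> i) = 0" unfolding P_def poly_prod by (intro prod_zero) auto
  thus False using pderiv_at_root[of i] pderiv_root_nonzero[of i] ij by auto
qed

text \<open>By \<open>rp_eq_iff\<close> the choice of \<open>h\<close> does not affect the value.
  The value \<open>0\<close> outside \<open>K\<close> is the convention of
  \<open>embeddings\<close>, which makes two embeddings equal as functions once they agree on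
  \<open>K\<close>.\<close>

definition emb :: "nat \<Rightarrow> complex \<Rightarrow> complex" where
  "emb i x = (if x \<in> K then rp (SOME h. rp h \<theta> = x) (\<rho> i) else 0)"

lemma emb_rp: assumes "i < n" shows "emb i (rp h \<theta>) = rp h (\<rho> i)"
proof -
  let ?h = "SOME k. rp k \<theta> = rp h \<theta>"
  have "rp ?h \<theta> = rp h \<theta>" by (rule someI) simp
  hence "rp ?h (\<rho> i) = rp h (\<rho> i)" using rp_eq_iff[OF assms npos] \<theta>_def by simp
  thus ?thesis unfolding emb_def K_def by auto
qed

lemma K_cases: assumes "x \<in> K" obtains h where "x = rp h \<theta>" "degree h < n"
proof -
  obtain h where h: "x = rp h \<theta>" using assms unfolding K_def by auto
  have "fq dvd h - h mod fq" by (simp add: minus_mod_eq_mult_div)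
  hence "rp (h - h mod fq) \<theta> = 0" using rp_root_iff[OF npos, of "h - h mod fq"] \<theta>_def by metis
  hence "x = rp (h mod fq) \<theta>" using h by simp
  moreover have "degree (h mod fq) < n"
    using degree_mod_less'[of fq h] degree_fq npos irr by (cases "h mod fq = 0") auto
  ultimately show ?thesis using that by blast
qed

lemma rp_in_K [simp, intro]: "rp h \<theta> \<in> K" unfolding K_def by auto

lemma ip_in_K [simp, intro]: "ip h \<theta> \<in> K" using rp_in_K[of "map_poly of_int h"] by (simp only: rp_of_int_poly)

lemma K_rat [simp, intro]: "of_rat q \<in> K" using rp_in_K[of "[:q:]"] by simp

lemma K_int [simp, intro]: "of_int q \<in> K" using K_rat[of "of_int q"] by simp

lemma K_0 [simp, intro]: "0 \<in> K" and K_1 [simp, intro]: "1 \<in> K"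
  using K_int[of 0] K_int[of 1] by simp_all

lemma theta_in_K [simp, intro]: "\<theta> \<in> K" using rp_in_K[of "[:0,1:]"] by simp

lemma K_add [intro]: "x \<in> K \<Longrightarrow> y \<in> K \<Longrightarrow> x + y \<in> K"
  by (elim K_cases) (metis rp_in_K rp_simps(1))

lemma K_diff [intro]: "x \<in> K \<Longrightarrow> y \<in> K \<Longrightarrow> x - y \<in> K"
  by (elim K_cases) (metis rp_in_K rp_simps(2))

lemma K_uminus [intro]: "x \<in> K \<Longrightarrow> - x \<in> K"
  by (elim K_cases) (metis rp_in_K rp_simps(3))

lemma K_mult [intro]: "x \<in> K \<Longrightarrow> y \<in> K \<Longrightarrow> x * y \<in> K"
  by (elim K_cases) (metis rp_in_K rp_simps(4))

lemma K_power [intro]: "x \<in> K \<Longrightarrow> x ^ k \<in> K"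
  by (induction k) auto

lemma K_prod [intro]: "(\<And>i. i \<in> I \<Longrightarrow> g i \<in> K) \<Longrightarrow> prod g I \<in> K"
  by (induction I rule: infinite_finite_induct) auto

lemma K_sum [intro]: "(\<And>i. i \<in> I \<Longrightarrow> g i \<in> K) \<Longrightarrow> sum g I \<in> K"
  by (induction I rule: infinite_finite_induct) auto

lemma K_inverse [intro]: assumes "x \<in> K" shows "inverse x \<in> K"
proof (cases "x = 0")
  case False
  obtain h where h: "x = rp h \<theta>" using assms by (elim K_cases)
  hence "\<not> fq dvd h" using False rp_root_iff[OF npos, of h] \<theta>_def by simp
  hence "Rings.coprime fq h"
    using irr prime_elem_imp_coprime[of fq h] irreducible_imp_prime_elem_gcd[of fq] by blast
  then obtain u v where "u * fq + v * h = 1"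
    by (metis bezout_coefficients_fst_snd coprime_imp_gcd_eq_1)
  hence "rp (u * fq + v * h) \<theta> = 1" by simp
  hence "rp v \<theta> * x = 1" using h ip_f_root[OF npos] by (simp add: rp_of_int_poly \<theta>_def)
  hence "inverse x = rp v \<theta>" by (metis inverse_unique mult.commute)
  thus ?thesis by simp
qed auto

lemma K_divide [intro]: "x \<in> K \<Longrightarrow> y \<in> K \<Longrightarrow> x / y \<in> K"
  unfolding divide_inverse by auto

lemma subfield: "subfield_C K"
  unfolding subfield_C_def by auto

lemma emb_simps [simp]:
  assumes "i < n"
  shows "x \<in> K \<Longrightarrow> y \<in> K \<Longrightarrow> emb i (x + y) = emb i x + emb i y"
    "x \<in> K \<Longrightarrow> y \<in> K \<Longrightarrow> emb i (x - y) = emb i x - emb i y"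
    "x \<in> K \<Longrightarrow> y \<in> K \<Longrightarrow> emb i (x * y) = emb i x * emb i y"
    "x \<in> K \<Longrightarrow> emb i (- x) = - emb i x"
    "emb i (of_rat q) = of_rat q" "emb i (of_int m) = of_int m" "emb i 0 = 0" "emb i 1 = 1"
    "emb i (rp h \<theta>) = rp h (\<rho> i)" "emb i (ip p \<theta>) = ip p (\<rho> i)" "emb i \<theta> = \<rho> i"
proof -
  note e = emb_rp[OF assms]
  show "x \<in> K \<Longrightarrow> y \<in> K \<Longrightarrow> emb i (x + y) = emb i x + emb i y"
    by (elim K_cases) (metis e rp_simps(1))
  show "x \<in> K \<Longrightarrow> y \<in> K \<Longrightarrow> emb i (x - y) = emb i x - emb i y"
    by (elim K_cases) (metis e rp_simps(2))
  show "x \<in> K \<Longrightarrow> y \<in> K \<Longrightarrow> emb i (x * y) = emb i x * emb i y"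
    by (elim K_cases) (metis e rp_simps(4))
  show "x \<in> K \<Longrightarrow> emb i (- x) = - emb i x"
    by (elim K_cases) (metis e rp_simps(3))
  show q: "emb i (of_rat q) = of_rat q" for q using e[of "[:q:]"] by simp
  show "emb i (of_int m) = of_int m" using q[of "of_int m"] by simp
  show "emb i 0 = 0" "emb i 1 = 1" using q[of 0] q[of 1] by simp_all
  show "emb i (rp h \<theta>) = rp h (\<rho> i)" by (rule e)
  show "emb i (ip p \<theta>) = ip p (\<rho> i)" using e[of "map_poly of_int p"] by (simp add: rp_of_int_poly)
  show "emb i \<theta> = \<rho> i" using e[of "[:0,1:]"] by simp
qed

lemma emb_power [simp]: "i < n \<Longrightarrow> x \<in> K \<Longrightarrow> emb i (x ^ m) = emb i x ^ m"
  by (induction m) (auto simp: K_power)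

lemma emb_sum: "i < n \<Longrightarrow> (\<And>j. j \<in> J \<Longrightarrow> g j \<in> K) \<Longrightarrow> emb i (sum g J) = (\<Sum>j\<in>J. emb i (g j))"
  by (induction J rule: infinite_finite_induct) (auto simp: K_sum)

lemma emb_prod: "i < n \<Longrightarrow> (\<And>j. j \<in> J \<Longrightarrow> g j \<in> K) \<Longrightarrow> emb i (prod g J) = (\<Prod>j\<in>J. emb i (g j))"
  by (induction J rule: infinite_finite_induct) (auto simp: K_prod)

lemma emb_0: "x \<in> K \<Longrightarrow> emb 0 x = x"
  using npos by (elim K_cases) (simp add: \<theta>_def[symmetric])

lemma emb_eq_iff: "i < n \<Longrightarrow> x \<in> K \<Longrightarrow> y \<in> K \<Longrightarrow> emb i x = emb i y \<longleftrightarrow> x = y"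
  by (elim K_cases) (metis emb_rp rp_eq_iff npos \<theta>_def)

lemma emb_eq_0_iff: "i < n \<Longrightarrow> x \<in> K \<Longrightarrow> emb i x = 0 \<longleftrightarrow> x = 0"
  using emb_eq_iff[of i x 0] by simp

lemma rp_as_sum: "degree h < n \<Longrightarrow> rp h x = (\<Sum>i<n. of_rat (coeff h i) * x ^ i)"
proof -
  assume "degree h < n"
  have "rp h x = (\<Sum>i\<le>degree h. of_rat (coeff h i) * x ^ i)"
    unfolding rp_def by (simp add: poly_altdef)
  also have "\<dots> = (\<Sum>i<n. of_rat (coeff h i) * x ^ i)"
    using \<open>degree h < n\<close> by (intro sum.mono_neutral_left) (auto simp: coeff_eq_0)
  finally show ?thesis .
qed

lemma power_basis_independent:
  assumes "i < n" "(\<Sum>j<n. of_rat (c j) * \<rho> i ^ j) = 0" "j < n" shows "c j = 0"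
proof -
  define h where "h = (\<Sum>j<n. monom (c j) j)"
  have ch: "coeff h k = (if k < n then c k else 0)" for k
    unfolding h_def by (simp add: coeff_sum)
  have d: "degree h < n"
    by (rule degree_lessI) (use npos in \<open>auto simp: ch\<close>)
  have "rp h (\<rho> i) = (\<Sum>j<n. of_rat (c j) * \<rho> i ^ j)"
    unfolding rp_as_sum[OF d] by (intro sum.cong) (auto simp: ch)
  hence "rp h (\<rho> i) = 0" using assms(2) by simp
  hence "h = 0" using rp_root_iff[OF assms(1)] degree_lt_dvd d by auto
  thus ?thesis using ch[of j] assms(3) by simp
qed

lemma Q_basis_powers: "Q_basis K n (\<lambda>i. \<theta> ^ i)"
  unfolding Q_basis_def
proof (intro conjI allI impI ballI)
  show "\<theta> ^ i \<in> K" for i by auto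
  show "c i = 0" if "(\<Sum>i<n. of_rat (c i) * \<theta> ^ i) = 0" "i < n" for c :: "nat \<Rightarrow> rat" and i
    using power_basis_independent[OF npos] that unfolding \<theta>_def by auto
  show "\<exists>c :: nat \<Rightarrow> rat. x = (\<Sum>i<n. of_rat (c i) * \<theta> ^ i)" if "x \<in> K" for x
    using that by (elim K_cases) (auto simp: rp_as_sum)
qed

lemma number_field: "number_field n K"
  unfolding number_field_def using subfield Q_basis_powers by auto

lemma emb_embedding: "i < n \<Longrightarrow> emb i \<in> embeddings K"
  using emb_simps[of i] K_add K_mult unfolding embeddings_def by (auto simp: emb_def[where x = x for x])

text \<open>A ring homomorphism is the identity on the rationals, so it is fixed by the image of
  \<open>\<theta>\<close>, which has to be a root of \<open>f\<close>.\<close>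

lemma embedding_emb: assumes "\<sigma> \<in> embeddings K" shows "\<exists>i<n. \<sigma> = emb i"
proof -
  have s: "\<sigma> 1 = 1" "\<And>x y. x \<in> K \<Longrightarrow> y \<in> K \<Longrightarrow> \<sigma> (x + y) = \<sigma> x + \<sigma> y"
     "\<And>x y. x \<in> K \<Longrightarrow> y \<in> K \<Longrightarrow> \<sigma> (x * y) = \<sigma> x * \<sigma> y" "\<And>x. x \<notin> K \<Longrightarrow> \<sigma> x = 0"
    using assms unfolding embeddings_def by auto
  have s0: "\<sigma> 0 = 0" using s(2)[of 0 0] by simp
  have snat: "\<sigma> (of_nat m) = of_nat m" for m
  proof (induction m)
    case (Suc m)
    have "of_nat m \<in> K" using K_int[of "int m"] by simp
    thus ?case using s(2)[of 1 "of_nat m"] s(1) Suc by simp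
  qed (use s0 in simp)
  have sneg: "\<sigma> (- x) = - \<sigma> x" if "x \<in> K" for x
    using s(2)[of x "- x"] s0 that by (simp add: K_uminus eq_neg_iff_add_eq_0 add.commute)
  have sint: "\<sigma> (of_int m) = of_int m" for m
  proof (cases "m \<ge> 0")
    case True
    thus ?thesis using snat[of "nat m"] by simp
  next
    case False
    have "of_nat (nat (- m)) \<in> K" using K_int[of "- m"] False by simp
    thus ?thesis using snat[of "nat (-m)"] sneg[of "of_nat (nat (-m))"] False by simp
  qed
  have srat: "\<sigma> (of_rat q) = of_rat q" for q
  proof -
    obtain a b where ab: "q = of_int a / of_int b" "b > 0" by (metis Rat_cases Fract_of_int_quotient)
    have "of_rat q * of_int b = (of_int a :: complex)" using ab by (simp add: of_rat_divide)
    hence "\<sigma> (of_rat q) * of_int b = of_int a" using s(3)[of "of_rat q" "of_int b"] sint by simp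
    hence "\<sigma> (of_rat q) = of_int a / of_int b" using ab(2) by (simp add: eq_divide_eq)
    thus ?thesis using ab by (simp add: of_rat_divide)
  qed
  have srp: "\<sigma> (rp h \<theta>) = rp h (\<sigma> \<theta>)" for h
    by (induction h) (auto simp: s0 s(2,3) srat K_mult)
  have "ip f (\<sigma> \<theta>) = \<sigma> (rp fq \<theta>)" unfolding srp by (simp only: rp_of_int_poly)
  also have "\<dots> = 0" using ip_f_root[OF npos] by (simp add: rp_of_int_poly \<theta>_def s0)
  finally obtain i where i: "i < n" "\<sigma> \<theta> = \<rho> i" using root_cases by auto
  have "\<sigma> x = emb i x" for x
    by (cases "x \<in> K") (use srp i s(4) in \<open>auto simp: emb_def elim!: K_cases\<close>, metis emb_def emb_rp rp_in_K)
  thus ?thesis using i by auto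
qed

lemma bij_emb: "bij_betw emb {..<n} (embeddings K)"
  unfolding bij_betw_def
proof
  show "inj_on emb {..<n}"
    using inj_roots by (auto intro!: inj_onI dest!: fun_cong[of _ _ \<theta>] dest: inj_onD)
  show "emb ` {..<n} = embeddings K" using emb_embedding embedding_emb by auto
qed

end

section \<open>Integral bases and the discriminant\<close>

lemma det_n_eq_det: "det_n n M = det (mat n n (\<lambda>(i,j). M i j))"
proof -
  have "det (mat n n (\<lambda>(i,j). M i j)) =
    (\<Sum>p\<in>{p. p permutes {0..<n}}. signof p * (\<Prod>i=0..<n. mat n n (\<lambda>(i,j). M i j) $$ (i, p i)))"
    by (rule det_def') simp
  also have "\<dots> = (\<Sum>p\<in>{p. p permutes {..<n}}. of_int (sign p) * (\<Prod>i<n. M i (p i)))"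
    unfolding atLeast0LessThan
  proof (rule sum.cong[OF refl])
    fix p assume "p \<in> {p. p permutes {..<n}}"
    hence "p i < n" if "i < n" for i using permutes_in_image[of p "{..<n}" i] that by simp
    hence "(\<Prod>i<n. mat n n (\<lambda>(i,j). M i j) $$ (i, p i)) = (\<Prod>i<n. M i (p i))"
      by (intro prod.cong) auto
    thus "signof p * (\<Prod>i<n. mat n n (\<lambda>(i,j). M i j) $$ (i, p i)) = of_int (sign p) * (\<Prod>i<n. M i (p i))"
      by simp
  qed
  finally show ?thesis unfolding det_n_def by simp
qed

lemma det_n_mult: "det_n n (\<lambda>i j. \<Sum>k<n. M i k * N k j) = det_n n M * det_n n N"
proof -
  have "mat n n (\<lambda>(i,j). \<Sum>k<n. M i k * N k j) = mat n n (\<lambda>(i,j). M i j) * mat n n (\<lambda>(i,j). N i j)"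
    by (rule eq_matI) (auto simp: scalar_prod_def atLeast0LessThan)
  thus ?thesis unfolding det_n_eq_det by (simp add: det_mult[where n = n])
qed

lemma det_n_cong: "(\<And>i j. i < n \<Longrightarrow> j < n \<Longrightarrow> M i j = N i j) \<Longrightarrow> det_n n M = det_n n N"
  unfolding det_n_eq_det by (intro arg_cong[where f = det] eq_matI) auto

lemma det_n_permute_rows:
  assumes "p permutes {..<n}"
  shows "det_n n (\<lambda>i j. M (p i) j) = of_int (sign p) * det_n n M"
proof -
  have "mat n n (\<lambda>(i,j). M (p i) j) = mat n n (\<lambda>(i,j). mat n n (\<lambda>(i,j). M i j) $$ (p i, j))"
    using permutes_in_image[OF assms] by (intro eq_matI) auto
  thus ?thesis unfolding det_n_eq_det
    using det_permute_rows[of "mat n n (\<lambda>(i,j). M i j)" n p] assms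
    by (simp add: atLeast0LessThan)
qed

lemma det_n_triangular:
  assumes "\<And>i j. j < i \<Longrightarrow> i < n \<Longrightarrow> M i j = 0"
  shows "det_n n M = (\<Prod>i<n. M i i)"
proof -
  have "det_n n M = prod_list (diag_mat (mat n n (\<lambda>(i,j). M i j)))"
    unfolding det_n_eq_det by (rule det_upper_triangular[where n = n]) (auto simp: assms upper_triangular_def)
  also have "\<dots> = (\<Prod>i<n. M i i)"
    by (simp add: diag_mat_def prod.list_conv_set_nth atLeast0LessThan)
  finally show ?thesis .
qed

lemma det_n_Rats: "(\<And>i j. M i j \<in> \<rat>) \<Longrightarrow> det_n n M \<in> \<rat>"
  unfolding det_n_def by (intro Rats_sum Rats_mult Rats_prod) auto

lemma det_n_of_int: "det_n n (\<lambda>i j. of_int (M i j)) \<in> \<int>"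
  unfolding det_n_def by (intro Ints_sum Ints_mult Ints_prod) auto

lemma det_n_zero_kernel:
  assumes "det_n n M = 0"
  obtains v k where "k < n" "v k \<noteq> 0" "\<And>i. i < n \<Longrightarrow> (\<Sum>j<n. M i j * v j) = 0"
proof -
  let ?A = "mat n n (\<lambda>(i,j). M i j)"
  obtain v where v: "v \<in> carrier_vec n" "v \<noteq> 0\<^sub>v n" "?A *\<^sub>v v = 0\<^sub>v n"
    using det_0_iff_vec_prod_zero_field[of ?A n] assms unfolding det_n_eq_det by auto
  obtain k where k: "k < n" "v $ k \<noteq> 0" using v(1,2) by (metis carrier_vecD dim_vec eq_vecI index_zero_vec)
  have "(\<Sum>j<n. M i j * v $ j) = 0" if i: "i < n" for i
  proof -
    have "(?A *\<^sub>v v) $ i = 0" using v(3) i by simp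
    thus ?thesis using v(1) i by (simp add: scalar_prod_def atLeast0LessThan)
  qed
  thus ?thesis using that k by blast
qed

text \<open>\<open>g i\<close> has the least positive leading entry at position \<open>i\<close>, or entry \<open>0\<close> there if no
  element of the subgroup has its last nonzero entry at \<open>i\<close>.\<close>

lemma int_subgroup_triangular:
  fixes G :: "(nat \<Rightarrow> int) set"
  assumes G0: "(\<lambda>_. 0) \<in> G" and Gd: "\<And>x y. x \<in> G \<Longrightarrow> y \<in> G \<Longrightarrow> (\<lambda>i. x i - y i) \<in> G"
    and supp: "\<And>x i. x \<in> G \<Longrightarrow> i \<ge> n \<Longrightarrow> x i = 0"
  obtains g :: "nat \<Rightarrow> nat \<Rightarrow> int" where "\<And>i. g i \<in> G" "\<And>i j. j > i \<Longrightarrow> g i j = 0"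
    "\<And>x k. x \<in> G \<Longrightarrow> (\<And>j. j > k \<Longrightarrow> x j = 0) \<Longrightarrow> g k k dvd x k"
    "\<And>x. x \<in> G \<Longrightarrow> \<exists>c. x = (\<lambda>j. \<Sum>i<n. c i * g i j)"
proof -
  have Gneg: "(\<lambda>i. - x i) \<in> G" if "x \<in> G" for x using Gd[OF G0 that] by simp
  have Gadd: "(\<lambda>i. x i + y i) \<in> G" if "x \<in> G" "y \<in> G" for x y
    using Gd[OF that(1) Gneg[OF that(2)]] by simp
  have Gnat: "(\<lambda>i. int m * x i) \<in> G" if "x \<in> G" for x m
    by (induction m) (use G0 Gadd[OF that] in \<open>auto simp: distrib_right\<close>)
  have Gint: "(\<lambda>i. m * x i) \<in> G" if "x \<in> G" for x m
  proof (cases "m \<ge> 0")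
    case True
    thus ?thesis using Gnat[OF that, of "nat m"] by simp
  next
    case False
    thus ?thesis using Gneg[OF Gnat[OF that, of "nat (-m)"]] by simp
  qed
  define T where "T k = {x \<in> G. \<forall>j>k. x j = 0}" for k
  have "\<exists>g. g \<in> T k \<and> (\<forall>x\<in>T k. g k dvd x k)" for k
  proof (cases "\<exists>x\<in>T k. x k \<noteq> 0")
    case False
    thus ?thesis using G0 by (intro exI[of _ "\<lambda>_. 0"]) (auto simp: T_def)
  next
    case True
    then obtain x where x: "x \<in> T k" "x k \<noteq> 0" by auto
    define Q where "Q m \<longleftrightarrow> m > 0 \<and> (\<exists>x\<in>T k. nat (x k) = m)" for m
    have "Q (nat \<bar>x k\<bar>)"
    proof (cases "x k > 0")
      case True
      thus ?thesis using x unfolding Q_def by auto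
    next
      case False
      moreover have "(\<lambda>i. - x i) \<in> T k" using x Gneg unfolding T_def by auto
      ultimately show ?thesis using x unfolding Q_def by (auto intro!: bexI[of _ "\<lambda>i. - x i"])
    qed
    hence Q: "Q (LEAST m. Q m)" by (rule LeastI)
    then obtain g where g: "g \<in> T k" "nat (g k) = (LEAST m. Q m)" "g k > 0" unfolding Q_def by auto
    have "g k dvd y k" if y: "y \<in> T k" for y
    proof -
      \<comment> \<open>Division with remainder by the leading entry of \<open>g\<close>: a nonzero
        remainder would be a smaller positive leading entry in \<open>T k\<close>.\<close>
      define z where "z = (\<lambda>i. y i - (y k div g k) * g i)"
      have z: "z \<in> T k"
        using y g(1) Gd[OF _ Gint[of g "y k div g k"], of y] unfolding T_def z_def by auto
      have zk: "z k = y k mod g k" unfolding z_def by (simp add: minus_div_mult_eq_mod)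
      have "z k = 0"
      proof (rule ccontr)
        assume "z k \<noteq> 0"
        hence "z k > 0" using zk g(3) by (simp add: order_less_le)
        hence "Q (nat (z k))" using z unfolding Q_def by auto
        hence "nat (g k) \<le> nat (z k)" unfolding g(2) by (rule Least_le)
        thus False using zk g(3) \<open>z k > 0\<close> pos_mod_bound[of "g k" "y k"] by linarith
      qed
      thus ?thesis using zk by auto
    qed
    thus ?thesis using g(1) by auto
  qed
  then obtain g where g: "\<And>k. g k \<in> T k" "\<And>k x. x \<in> T k \<Longrightarrow> g k k dvd x k" by metis
  have gen: "\<exists>c. x = (\<lambda>j. \<Sum>i<m. c i * g i j)" if "x \<in> G" "\<And>j. j \<ge> m \<Longrightarrow> x j = 0" for x m
    using that
  proof (induction m arbitrary: x)
    case 0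
    thus ?case by auto
  next
    case (Suc m)
    have "x \<in> T m" using Suc.prems unfolding T_def by auto
    then obtain q where q: "x m = g m m * q" using g(2) by blast
    define y where "y = (\<lambda>j. x j - q * g m j)"
    have "y \<in> G" unfolding y_def using Suc.prems(1) Gint[of "g m" q] g(1)[of m] by (intro Gd) (auto simp: T_def)
    moreover have "y j = 0" if "j \<ge> m" for j
      using that g(1)[of m] Suc.prems(2)[of j] q unfolding y_def T_def by (cases "j = m") auto
    ultimately obtain c where c: "y = (\<lambda>j. \<Sum>i<m. c i * g i j)" using Suc.IH[of y] by blast
    have "x j = (\<Sum>i<Suc m. (c(m := q)) i * g i j)" for j
    proof -
      have "x j = y j + q * g m j" unfolding y_def by simp
      also have "y j = (\<Sum>i<m. (c(m := q)) i * g i j)" unfolding c by (intro sum.cong) auto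
      finally show ?thesis by simp
    qed
    thus ?case by blast
  qed
  show ?thesis
  proof (rule that[of g])
    show "g i \<in> G" "\<And>j. j > i \<Longrightarrow> g i j = 0" for i using g(1)[of i] unfolding T_def by auto
    show "g k k dvd x k" if "x \<in> G" "\<And>j. j > k \<Longrightarrow> x j = 0" for x k
      using that by (intro g(2)) (auto simp: T_def)
    show "\<exists>c. x = (\<lambda>j. \<Sum>i<n. c i * g i j)" if "x \<in> G" for x
      using gen[OF that] supp[OF that] by blast
  qed
qed

section \<open>Integers of \<open>K\<close>: finiteness of bounded sets, and norms\<close>

context number_field_poly
begin

abbreviation OK :: "complex set" where "OK \<equiv> ring_of_integers K"

lemma OK_iff: "x \<in> OK \<longleftrightarrow> x \<in> K \<and> algebraic_integer x"
  unfolding ring_of_integers_def by simp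

lemma OK_K: "x \<in> OK \<Longrightarrow> x \<in> K" and OK_int: "x \<in> OK \<Longrightarrow> algebraic_integer x"
  unfolding OK_iff by auto

lemma algebraic_integer_root_f: "i < n \<Longrightarrow> algebraic_integer (\<rho> i)"
  unfolding algebraic_integer_def using monic_f ip_f_root by blast

lemma OK_closed [simp, intro]:
  "x \<in> OK \<Longrightarrow> y \<in> OK \<Longrightarrow> x + y \<in> OK" "x \<in> OK \<Longrightarrow> y \<in> OK \<Longrightarrow> x * y \<in> OK"
  "x \<in> OK \<Longrightarrow> y \<in> OK \<Longrightarrow> x - y \<in> OK" "x \<in> OK \<Longrightarrow> - x \<in> OK" "of_int m \<in> OK" "0 \<in> OK" "1 \<in> OK"
  "x \<in> OK \<Longrightarrow> x ^ k \<in> OK" "\<theta> \<in> OK" "ip p \<theta> \<in> OK"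
  unfolding OK_iff
  using algebraic_integer_root_f[OF npos] unfolding \<theta>_def[symmetric]
  by (auto intro: algebraic_integer_add algebraic_integer_mult algebraic_integer_diff
      algebraic_integer_uminus algebraic_integer_power algebraic_integer_ipoly)

lemma OK_prod: "(\<And>i. i \<in> I \<Longrightarrow> g i \<in> OK) \<Longrightarrow> prod g I \<in> OK"
  by (induction I rule: infinite_finite_induct) auto

lemma emb_ip: "i < n \<Longrightarrow> x \<in> K \<Longrightarrow> emb i (ip p x) = ip p (emb i x) \<and> ip p x \<in> K"
  by (induction p) (auto simp: hom_distribs K_mult K_add)

lemma emb_integer: assumes "i < n" "x \<in> OK" shows "algebraic_integer (emb i x)"
proof -
  obtain p where p: "lead_coeff p = 1" "ip p x = 0"
    using OK_int[OF assms(2)] unfolding algebraic_integer_def by auto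
  thus ?thesis
    using emb_ip[OF assms(1) OK_K[OF assms(2)], of p] assms(1) unfolding algebraic_integer_def by auto
qed

text \<open>Lagrange interpolation at the roots of \<open>f\<close> of the values \<open>emb k x * f'(\<rho> k)\<close>: the
  interpolating polynomial is \<open>h * f' mod f\<close> for \<open>x = h(\<theta>)\<close>, hence rational, and its
  coefficients are algebraic integers by Lagrange's formula.\<close>

lemma different_multiple:
  assumes "x \<in> OK"
  obtains g :: "int poly" where "degree g < n"
    "map_poly of_int g = (\<Sum>k<n. smult (emb k x) (P k))"
    "\<And>i. i < n \<Longrightarrow> emb i x * ip (pderiv f) (\<rho> i) = ip g (\<rho> i)"
proof -
  define G where "G = (\<Sum>k<n. smult (emb k x) (P k))"
  obtain h where h: "x = rp h \<theta>" using OK_K[OF assms] by (elim K_cases)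
  define gq where "gq = (h * map_poly of_int (pderiv f)) mod fq"
  have dgq: "degree gq < n"
    using degree_mod_less'[of fq "h * map_poly of_int (pderiv f)"] degree_fq npos irr
    unfolding gq_def by (cases "(h * map_poly of_int (pderiv f)) mod fq = 0") auto
  have dP: "degree (P k) < n" if "k < n" for k
  proof -
    have "degree (P k) = card ({..<n} - {k})" unfolding P_def by (subst degree_prod_sum_eq) auto
    thus ?thesis using that by simp
  qed
  have dG: "degree G < n"
    unfolding G_def using dP by (intro degree_sum_less npos) (auto intro: le_less_trans[OF degree_smult_le])
  have vG: "poly G (\<rho> i) = emb i x * ip (pderiv f) (\<rho> i)" if "i < n" for i
  proof -
    have "poly G (\<rho> i) = (\<Sum>k<n. emb k x * poly (P k) (\<rho> i))" unfolding G_def by (simp add: poly_sum)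
    also have "\<dots> = (\<Sum>k<n. if k = i then emb i x * poly (P i) (\<rho> i) else 0)"
      using that by (intro sum.cong) (auto simp: P_def poly_prod)
    finally show ?thesis using that pderiv_at_root by simp
  qed
  have vgq: "rp gq (\<rho> i) = emb i x * ip (pderiv f) (\<rho> i)" if "i < n" for i
  proof -
    have "fq dvd h * map_poly of_int (pderiv f) - gq" unfolding gq_def by (simp add: minus_mod_eq_mult_div)
    hence "rp (h * map_poly of_int (pderiv f) - gq) (\<rho> i) = 0" using rp_root_iff[OF that] by blast
    thus ?thesis using emb_rp[OF that, of h] h by (simp add: rp_of_int_poly)
  qed
  have eq: "map_poly of_rat gq = G"
  proof (rule poly_eqI_degree[of "\<rho> ` {..<n}"])
    show "poly (map_poly of_rat gq) z = poly G z" if "z \<in> \<rho> ` {..<n}" for z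
      using that vG vgq unfolding rp_def by auto
    show "degree (map_poly complex_of_rat gq) < card (\<rho> ` {..<n})" "degree G < card (\<rho> ` {..<n})"
      using dgq dG card_image[OF inj_roots] by auto
  qed
  have "\<exists>c :: int. coeff gq i = of_int c" for i
  proof -
    have "algebraic_integer (coeff (P k) j)" for k j
      unfolding P_def
    proof (rule coeff_algebraic_integer_prod)
      fix m i assume "m \<in> {..<n} - {k}"
      hence "algebraic_integer (\<rho> m)" using algebraic_integer_root_f by auto
      thus "algebraic_integer (coeff [:- \<rho> m, 1:] i)"
        by (auto simp: coeff_pCons split: nat.splits intro: algebraic_integer_uminus)
    qed
    hence "algebraic_integer (coeff G i)" unfolding G_def using emb_integer[OF _ assms]
      by (auto simp: coeff_sum intro!: algebraic_integer_sum algebraic_integer_mult)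
    moreover have c: "coeff G i = of_rat (coeff gq i)" unfolding eq[symmetric] by simp
    ultimately obtain c :: int where "coeff G i = of_int c"
      using algebraic_integer_rational[of "coeff G i"] by (metis Rats_of_rat)
    hence "(of_rat (coeff gq i) :: complex) = of_rat (of_int c)" using c by simp
    thus ?thesis by (metis of_rat_eq_iff)
  qed
  then obtain c :: "nat \<Rightarrow> int" where c: "\<And>i. coeff gq i = of_int (c i)" by metis
  define g where "g = Abs_poly c"
  have "\<forall>\<^sub>\<infinity> i. c i = 0" using MOST_coeff_eq_0[of gq] unfolding c by simp
  hence "coeff g = c" unfolding g_def by (simp add: Abs_poly_inverse)
  hence g: "map_poly of_int g = gq" using c by (intro poly_eqI) simp
  have gG: "map_poly of_int g = G"
    using eq unfolding g[symmetric] by (simp add: map_poly_map_poly o_def)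
  show ?thesis
  proof (rule that[of g])
    show "degree g < n" using dgq unfolding g[symmetric] by simp
    show "map_poly of_int g = (\<Sum>k<n. smult (emb k x) (P k))" using gG unfolding G_def .
    show "emb i x * ip (pderiv f) (\<rho> i) = ip g (\<rho> i)" if "i < n" for i
      using vG[OF that] gG by simp
  qed
qed

text \<open>By \<open>different_multiple\<close>, \<open>x\<close> is the quotient of
  \<open>g(\<theta>)\<close> by the derivative of \<open>f\<close> at \<open>\<theta>\<close>, and
  the integer coefficients of \<open>g\<close> are linear in the conjugates of \<open>x\<close>.
  Bounded conjugates thus leave finitely many \<open>g\<close>. The constant \<open>C\<close> sums
  over all coefficient positions so as to serve for each of them.\<close>

lemma finite_bounded_integers:
  "finite {x \<in> OK. \<forall>i<n. cmod (emb i x) \<le> R}"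
proof -
  define C where "C = (\<Sum>k<n. \<Sum>i\<le>n. \<bar>R\<bar> * cmod (coeff (P k) i))"
  have "x \<in> (\<lambda>g. ip g \<theta> / ip (pderiv f) \<theta>) ` {p :: int poly. degree p < n \<and> (\<forall>i. \<bar>coeff p i\<bar> \<le> \<lfloor>C\<rfloor>)}"
    if x: "x \<in> OK" "\<forall>i<n. cmod (emb i x) \<le> R" for x
  proof -
    obtain g where g: "degree g < n" "map_poly of_int g = (\<Sum>k<n. smult (emb k x) (P k))"
      "\<And>i. i < n \<Longrightarrow> emb i x * ip (pderiv f) (\<rho> i) = ip g (\<rho> i)"
      using different_multiple[OF x(1)] by metis
    have "x * ip (pderiv f) \<theta> = ip g \<theta>"
      using g(3)[OF npos] emb_0[OF OK_K[OF x(1)]] unfolding \<theta>_def by simp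
    hence xg: "x = ip g \<theta> / ip (pderiv f) \<theta>"
      using pderiv_root_nonzero[OF npos] unfolding \<theta>_def by (simp add: field_simps)
    have "\<bar>coeff g i\<bar> \<le> \<lfloor>C\<rfloor>" for i
    proof (cases "i \<le> n")
      case False
      have "C \<ge> 0" unfolding C_def by (intro sum_nonneg) auto
      thus ?thesis using False g(1) by (simp add: coeff_eq_0)
    next
      case True
      have "(of_int (coeff g i) :: complex) = coeff (map_poly of_int g) i" by simp
      also have "\<dots> = (\<Sum>k<n. emb k x * coeff (P k) i)" unfolding g(2) by (simp add: coeff_sum)
      finally have "real_of_int \<bar>coeff g i\<bar> = cmod (\<Sum>k<n. emb k x * coeff (P k) i)"
        by (metis norm_of_int of_int_abs)
      also have "\<dots> \<le> (\<Sum>k<n. \<bar>R\<bar> * cmod (coeff (P k) i))"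
        using x(2) by (intro sum_norm_le) (auto simp: norm_mult intro!: mult_right_mono order_trans[OF _ abs_ge_self])
      also have "\<dots> \<le> C" unfolding C_def
        using True by (intro sum_mono member_le_sum[of i "{..n}"]) auto
      finally show ?thesis by (simp add: le_floor_iff)
    qed
    thus ?thesis using xg g(1) by blast
  qed
  hence "{x \<in> OK. \<forall>i<n. cmod (emb i x) \<le> R} \<subseteq>
    (\<lambda>g. ip g \<theta> / ip (pderiv f) \<theta>) ` {p :: int poly. degree p < n \<and> (\<forall>i. \<bar>coeff p i\<bar> \<le> \<lfloor>C\<rfloor>)}" by auto
  thus ?thesis by (rule finite_subset) (intro finite_imageI finite_bounded_int_polys)
qed

text \<open>All powers of \<open>x\<close> lie in one finite set, so two of them agree; but the
  absolute values of the powers of a nonzero \<open>x\<close> strictly decrease.\<close>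

lemma small_integer_zero:
  assumes x: "x \<in> OK" and small: "\<And>i. i < n \<Longrightarrow> cmod (emb i x) < 1"
  shows "x = 0"
proof -
  have "x ^ m \<in> {y \<in> OK. \<forall>i<n. cmod (emb i y) \<le> 1}" for m
    using x small by (auto simp: norm_power OK_K less_imp_le intro!: power_le_one)
  hence "finite (range (\<lambda>m. x ^ m))" 
    by (intro finite_subset[OF _ finite_bounded_integers[of 1]]) auto
  hence "\<not> inj (\<lambda>m. x ^ m)" using range_inj_infinite by blast
  then obtain a b :: nat where ab: "x ^ a = x ^ b" "a < b" unfolding inj_def by (metis nat_neq_iff)
  show ?thesis
  proof (rule ccontr)
    assume "x \<noteq> 0"
    have "cmod x < 1" using small[OF npos] emb_0[OF OK_K[OF x]] by simp
    hence "cmod x ^ b < cmod x ^ a" using ab(2) \<open>x \<noteq> 0\<close> by (intro power_strict_decreasing) auto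
    thus False using ab(1) by (metis norm_power less_irrefl)
  qed
qed

text \<open>Let \<open>A\<close> be the rational matrix of multiplication by \<open>x\<close> in the
  power basis. The Vandermonde matrix \<open>V\<close> diagonalises it, \<open>A V = V D\<close>
  with the conjugates of \<open>x\<close> on the diagonal of \<open>D\<close>, so the norm is the
  determinant of \<open>A\<close>. If \<open>V\<close> were singular, a kernel vector of its
  transpose would be a nonzero polynomial of degree below \<open>n\<close> with \<open>n\<close>
  roots.\<close>

lemma norm_rational: assumes "x \<in> K" shows "(\<Prod>i<n. emb i x) \<in> \<rat>"
proof -
  have "\<forall>j. \<exists>c :: nat \<Rightarrow> rat. x * \<theta> ^ j = (\<Sum>k<n. of_rat (c k) * \<theta> ^ k)"
    using Q_basis_powers K_mult[OF assms K_power[OF theta_in_K]] unfolding Q_basis_def by blast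
  then obtain A :: "nat \<Rightarrow> nat \<Rightarrow> rat" where A: "\<And>j. x * \<theta> ^ j = (\<Sum>k<n. of_rat (A j k) * \<theta> ^ k)" by metis
  have eA: "emb i x * \<rho> i ^ j = (\<Sum>k<n. of_rat (A j k) * \<rho> i ^ k)" if "i < n" for i j
  proof -
    have "emb i (x * \<theta> ^ j) = emb i (\<Sum>k<n. of_rat (A j k) * \<theta> ^ k)" using A by simp
    thus ?thesis using that assms by (simp add: emb_sum K_mult K_power)
  qed
  define V where "V = (\<lambda>k i. \<rho> i ^ k)"
  have V0: "det_n n V \<noteq> 0"
  proof
    assume "det_n n V = 0"
    moreover have "det_n n V = det_n n (\<lambda>i k. V k i)"
      unfolding det_n_eq_det by (subst det_transpose[where n = n, symmetric]) (auto intro!: arg_cong[where f = det])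
    ultimately obtain v k where v: "k < n" "v k \<noteq> 0" "\<And>i. i < n \<Longrightarrow> (\<Sum>j<n. V j i * v j) = 0"
      using det_n_zero_kernel[of n "\<lambda>i k. V k i"] by metis
    define h where "h = (\<Sum>j<n. monom (v j) j)"
    have "poly h (\<rho> i) = 0" if "i < n" for i
      using v(3)[OF that] unfolding h_def V_def by (simp add: poly_sum poly_monom mult.commute)
    moreover have "degree h < n" unfolding h_def
      by (intro degree_sum_less npos) (auto intro: le_less_trans[OF degree_monom_le])
    ultimately have "h = 0"
      using card_image[OF inj_roots] by (intro poly_eqI_degree[of "\<rho> ` {..<n}"]) (auto simp: npos)
    moreover have "coeff h k = v k" unfolding h_def using v(1) by (simp add: coeff_sum)
    ultimately show False using v(2) by simp
  qed
  define D where "D = (\<lambda>i j. if i = j then emb i x else 0)"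
  have "det_n n (\<lambda>i j. \<Sum>k<n. of_rat (A i k) * V k j) = det_n n (\<lambda>i j. \<Sum>k<n. V i k * D k j)"
  proof (rule det_n_cong)
    fix i j assume "i < n" "j < n"
    have "(\<Sum>k<n. V i k * D k j) = (\<Sum>k<n. if k = j then emb j x * \<rho> j ^ i else 0)"
      by (intro sum.cong) (auto simp: V_def D_def)
    thus "(\<Sum>k<n. of_rat (A i k) * V k j) = (\<Sum>k<n. V i k * D k j)"
      using \<open>j < n\<close> eA[of j i] by (simp add: V_def)
  qed
  hence "det_n n (\<lambda>i k. of_rat (A i k)) * det_n n V = det_n n V * det_n n D"
    unfolding det_n_mult .
  hence "det_n n D = det_n n (\<lambda>i k. of_rat (A i k))" using V0 by simp
  moreover have "det_n n D = (\<Prod>i<n. emb i x)"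
    by (subst det_n_triangular) (auto simp: D_def)
  ultimately show ?thesis using det_n_Rats[of "\<lambda>i k. of_rat (A i k)"] by auto
qed

lemma norm_integer: assumes "x \<in> OK" shows "\<exists>k :: int. (\<Prod>i<n. emb i x) = of_int k"
  using norm_rational[OF OK_K[OF assms]] emb_integer[OF _ assms]
  by (intro algebraic_integer_rational algebraic_integer_prod) auto

lemma unit_norm:
  assumes "x \<in> OK" "y \<in> OK" "x * y = 1"
  shows "(\<Prod>i<n. cmod (emb i x)) = 1"
proof -
  obtain a b :: int where ab: "(\<Prod>i<n. emb i x) = of_int a" "(\<Prod>i<n. emb i y) = of_int b"
    using norm_integer assms by metis
  have "(\<Prod>i<n. emb i x) * (\<Prod>i<n. emb i y) = (\<Prod>i<n. emb i (x * y))"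
    using assms(1,2) by (simp add: prod.distrib OK_K)
  also have "\<dots> = 1" using assms(3) by simp
  finally have "of_int (a * b) = (1 :: complex)" using ab by simp
  hence "a * b = 1" by (simp only: of_int_eq_1_iff)
  hence "\<bar>a\<bar> = 1" by (metis abs_zmult_eq_1 abs_one)
  moreover have "(\<Prod>i<n. cmod (emb i x)) = \<bar>of_int a\<bar>" using ab(1) by (simp add: prod_norm)
  ultimately show ?thesis by (metis of_int_abs of_int_1)
qed


section \<open>Common denominators, integral bases and the discriminant\<close>

lemma K_scaled_integral:
  assumes "x \<in> K" obtains d :: int and w :: "int poly" where "d > 0" "of_int d * x = ip w \<theta>"
proof -
  obtain h where h: "x = rp h \<theta>" using assms by (elim K_cases)
  obtain d w where "d > 0" "smult (of_int d) h = map_poly of_int w" using clear_denominators by blast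
  moreover from this(2) have "rp (smult (of_int d) h) \<theta> = ip w \<theta>" by (simp only: rp_of_int_poly)
  hence "of_int d * x = ip w \<theta>" using h by simp
  ultimately show ?thesis using that by blast
qed

lemma ip_reduce: obtains c :: "nat \<Rightarrow> int" where "ip p \<theta> = (\<Sum>i<n. of_int (c i) * \<theta> ^ i)"
proof -
  obtain q r where qr: "pseudo_divmod p f = (q, r)" by force
  have "f \<noteq> 0" using monic_f by auto
  from pseudo_divmod[OF this qr] have "p = f * q + r" "r = 0 \<or> degree r < n"
    using monic_f degree_f by auto
  hence p: "ip p \<theta> = ip r \<theta>" "r = 0 \<or> degree r < n"
    using ip_f_root[OF npos] by (auto simp: hom_distribs \<theta>_def)
  have d: "degree (map_poly rat_of_int r) < n" using p(2) npos by auto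
  have "ip r \<theta> = (\<Sum>i<n. of_int (coeff r i) * \<theta> ^ i)"
    using rp_as_sum[OF d, of \<theta>] by (simp add: rp_of_int_poly)
  thus ?thesis using that p(1) by metis
qed

text \<open>Multiplication by the derivative of \<open>f\<close> at \<open>\<theta>\<close> carries
  every integer of \<open>K\<close> into the ring generated by \<open>\<theta>\<close> over the
  integers; so does any integer multiple of the inverse of that derivative's inverse expressed in
  \<open>\<theta>\<close>, namely \<open>D\<close>.\<close>

lemma OK_common_denominator:
  obtains D :: int where "D > 0"
    "\<And>x. x \<in> OK \<Longrightarrow> \<exists>c :: nat \<Rightarrow> int. of_int D * x = (\<Sum>i<n. of_int (c i) * \<theta> ^ i)"
proof -
  have f0: "ip (pderiv f) \<theta> \<noteq> 0" using pderiv_root_nonzero[OF npos] \<theta>_def by simp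
  obtain D w where D: "D > 0" "of_int D * inverse (ip (pderiv f) \<theta>) = ip w \<theta>"
    using K_scaled_integral[of "inverse (ip (pderiv f) \<theta>)"] K_inverse ip_in_K by metis
  have "\<exists>c :: nat \<Rightarrow> int. of_int D * x = (\<Sum>i<n. of_int (c i) * \<theta> ^ i)" if x: "x \<in> OK" for x
  proof -
    obtain g where g: "emb 0 x * ip (pderiv f) (\<rho> 0) = ip g (\<rho> 0)"
      using different_multiple[OF x] npos by metis
    hence g: "x * ip (pderiv f) \<theta> = ip g \<theta>" using emb_0[OF OK_K[OF x]] \<theta>_def by simp
    have "of_int D * x = (of_int D * inverse (ip (pderiv f) \<theta>)) * (x * ip (pderiv f) \<theta>)"
      using f0 by (simp add: field_simps)
    also have "\<dots> = ip (w * g) \<theta>" unfolding D(2) g by (simp add: hom_distribs)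
    finally show ?thesis using ip_reduce[of "w * g"] by metis
  qed
  thus ?thesis using that D(1) by blast
qed

text \<open>After scaling by \<open>D\<close> the elements of \<open>H\<close> become integer
  vectors in the power basis, and \<open>int_subgroup_triangular\<close> applies. A power
  \<open>\<theta>^k\<close> in \<open>H\<close> has the single entry \<open>D\<close> at position
  \<open>k\<close>, which is why the leading entry there divides \<open>D\<close>. The lemma serves
  the whole ring, for the discriminant, and ideals, for \<open>stabilizer_integral\<close>.\<close>

lemma OK_subgroup_triangular:
  assumes H: "H \<subseteq> OK" "0 \<in> H" "\<And>x y. x \<in> H \<Longrightarrow> y \<in> H \<Longrightarrow> x - y \<in> H"
  obtains D :: int and b :: "nat \<Rightarrow> complex" and g :: "nat \<Rightarrow> nat \<Rightarrow> int"
  where "D > 0" "\<And>i. b i \<in> H" "H \<subseteq> zspan {..<n} b"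
    "\<And>i. of_int D * b i = (\<Sum>j<n. of_int (g i j) * \<theta> ^ j)" "\<And>i j. j > i \<Longrightarrow> g i j = 0"
    "\<And>k. k < n \<Longrightarrow> \<theta> ^ k \<in> H \<Longrightarrow> g k k dvd D"
proof -
  obtain D :: int where D: "D > 0"
    "\<And>x. x \<in> OK \<Longrightarrow> \<exists>c :: nat \<Rightarrow> int. of_int D * x = (\<Sum>i<n. of_int (c i) * \<theta> ^ i)"
    using OK_common_denominator by blast
  define v where "v c = (\<Sum>i<n. of_int (c i) * \<theta> ^ i) / of_int D" for c :: "nat \<Rightarrow> int"
  define G where "G = {c :: nat \<Rightarrow> int. (\<forall>i\<ge>n. c i = 0) \<and> v c \<in> H}"
  have vdiff: "v (\<lambda>i. c i - d i) = v c - v d" for c d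
    unfolding v_def by (simp add: diff_divide_distrib sum_subtractf algebra_simps)
  have coord: "\<exists>c\<in>G. x = v c" if xH: "x \<in> H" for x
  proof -
    obtain c :: "nat \<Rightarrow> int" where c: "of_int D * x = (\<Sum>i<n. of_int (c i) * \<theta> ^ i)"
      using D(2)[of x] xH H(1) by auto
    define c' where "c' i = (if i < n then c i else 0)" for i
    have "(\<Sum>i<n. of_int (c' i) * \<theta> ^ i) = (\<Sum>i<n. of_int (c i) * \<theta> ^ i)"
      by (intro sum.cong) (auto simp: c'_def)
    hence "v c' = x" unfolding v_def using D(1) by (simp add: c[symmetric])
    thus ?thesis using xH by (intro bexI[of _ c']) (auto simp: G_def c'_def)
  qed
  obtain g where g: "\<And>i. g i \<in> G" "\<And>i j. j > i \<Longrightarrow> g i j = 0"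
    "\<And>x k. x \<in> G \<Longrightarrow> (\<And>j. j > k \<Longrightarrow> x j = 0) \<Longrightarrow> g k k dvd x k"
    "\<And>x. x \<in> G \<Longrightarrow> \<exists>c. x = (\<lambda>j. \<Sum>i<n. c i * g i j)"
  proof (rule int_subgroup_triangular[of G n])
    show "(\<lambda>_. 0) \<in> G" unfolding G_def v_def using H(2) by simp
    show "(\<lambda>i. x i - y i) \<in> G" if "x \<in> G" "y \<in> G" for x y
      using that H(3) vdiff unfolding G_def by auto
    show "x i = 0" if "x \<in> G" "n \<le> i" for x i using that unfolding G_def by auto
  qed blast
  show ?thesis
  proof (rule that[of D "\<lambda>i. v (g i)" g])
    show "v (g i) \<in> H" for i using g(1) unfolding G_def by auto
    show "H \<subseteq> zspan {..<n} (\<lambda>i. v (g i))"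
    proof
      fix x assume "x \<in> H"
      then obtain y where y: "y \<in> G" "x = v y" using coord by blast
      obtain c where c: "y = (\<lambda>j. \<Sum>i<n. c i * g i j)" using g(4)[OF y(1)] by blast
      have "x = (\<Sum>j<n. \<Sum>i<n. of_int (c i) * (of_int (g i j) * \<theta> ^ j)) / of_int D"
        unfolding y(2) v_def c by (simp add: sum_distrib_right mult.assoc)
      also have "\<dots> = (\<Sum>i<n. of_int (c i) * v (g i))"
        by (subst sum.swap) (simp add: v_def sum_distrib_left sum_divide_distrib)
      finally show "x \<in> zspan {..<n} (\<lambda>i. v (g i))" unfolding zspan_def by blast
    qed
    show "of_int D * v (g i) = (\<Sum>j<n. of_int (g i j) * \<theta> ^ j)" for i
      unfolding v_def using D(1) by simp
    show "g k k dvd D" if k: "k < n" "\<theta> ^ k \<in> H" for k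
    proof -
      define c where "c j = (if j = k then D else 0)" for j
      have "(\<Sum>i<n. of_int (c i) * \<theta> ^ i) = (\<Sum>i<n. if i = k then of_int D * \<theta> ^ k else 0)"
        by (intro sum.cong) (auto simp: c_def)
      hence "v c = \<theta> ^ k" unfolding v_def using D(1) k(1) by simp
      hence "c \<in> G" using k unfolding G_def c_def by auto
      from g(3)[OF this, of k] show ?thesis by (simp add: c_def)
    qed
  qed (use D g in auto)
qed

lemma OK_subgroup_generators:
  assumes "H \<subseteq> OK" "0 \<in> H" "\<And>x y. x \<in> H \<Longrightarrow> y \<in> H \<Longrightarrow> x - y \<in> H"
  obtains b :: "nat \<Rightarrow> complex" where "\<And>i. b i \<in> H" "H \<subseteq> zspan {..<n} b"
  using OK_subgroup_triangular[OF assms] by metis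

text \<open>The diagonal entries are \<open>g i i / D\<close> with \<open>g i i\<close> dividing
  \<open>D\<close>. That they are at most 1 in absolute value is the inequality between the
  discriminants of \<open>K\<close> and \<open>f\<close>, obtained without mentioning an
  index.\<close>

lemma triangular_integral_basis:
  obtains b and C :: "nat \<Rightarrow> nat \<Rightarrow> rat" where "integral_basis K n b"
    "\<And>i. b i = (\<Sum>j<n. of_rat (C i j) * \<theta> ^ j)" "\<And>i j. j > i \<Longrightarrow> C i j = 0"
    "\<And>i. i < n \<Longrightarrow> \<bar>C i i\<bar> \<le> 1"
proof -
  obtain D :: int and b :: "nat \<Rightarrow> complex" and g :: "nat \<Rightarrow> nat \<Rightarrow> int"
    where D: "D > 0" and b: "\<And>i. b i \<in> OK" "OK \<subseteq> zspan {..<n} b"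
    and bg: "\<And>i. of_int D * b i = (\<Sum>j<n. of_int (g i j) * \<theta> ^ j)" and g: "\<And>i j. j > i \<Longrightarrow> g i j = 0"
    "\<And>k. k < n \<Longrightarrow> \<theta> ^ k \<in> OK \<Longrightarrow> g k k dvd D"
    using OK_subgroup_triangular[of OK] by blast
  define C where "C i j = rat_of_int (g i j) / of_int D" for i j
  have gk: "g k k dvd D" "g k k \<noteq> 0" if "k < n" for k
    using g(2)[OF that] D by auto
  have bC: "b i = (\<Sum>j<n. of_rat (C i j) * \<theta> ^ j)" for i
  proof -
    have "b i = (\<Sum>j<n. of_int (g i j) * \<theta> ^ j) / of_int D" using bg[of i] D by (simp add: field_simps)
    thus ?thesis unfolding C_def by (simp add: of_rat_divide sum_divide_distrib)
  qed
  have "Q_basis K n b" unfolding Q_basis_def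
  proof (intro conjI allI impI ballI)
    show "b i \<in> K" for i using b(1) OK_K by blast
    show "c i = 0" if c: "(\<Sum>i<n. of_rat (c i) * b i) = 0" and i: "i < n" for c :: "nat \<Rightarrow> rat" and i
    proof (rule ccontr)
      assume "c i \<noteq> 0"
      \<comment> \<open>At the largest index \<open>m\<close> with \<open>c m\<close> nonzero, only
        \<open>b m\<close> contributes to the coefficient of \<open>\<theta>^m\<close>.\<close>
      define m where "m = Max {i. i < n \<and> c i \<noteq> 0}"
      have fin: "finite {i. i < n \<and> c i \<noteq> 0}" by simp
      have "m \<in> {i. i < n \<and> c i \<noteq> 0}" unfolding m_def using i \<open>c i \<noteq> 0\<close> by (intro Max_in[OF fin]) auto
      hence m: "m < n" "c m \<noteq> 0" by auto
      have m2: "c k = 0" if "k < n" "k > m" for k using Max_ge[OF fin, of k] that unfolding m_def by fastforce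
      have "(\<Sum>i<n. of_rat (c i) * b i) = (\<Sum>i<n. \<Sum>j<n. of_rat (c i * C i j) * \<theta> ^ j)"
        unfolding bC by (simp add: sum_distrib_left of_rat_mult mult.assoc)
      also have "\<dots> = (\<Sum>j<n. of_rat (\<Sum>i<n. c i * C i j) * \<theta> ^ j)"
        by (subst sum.swap) (simp add: of_rat_sum sum_distrib_right)
      finally have "(\<Sum>j<n. of_rat (\<Sum>i<n. c i * C i j) * \<rho> 0 ^ j) = 0" using c by (simp add: \<theta>_def)
      hence "(\<Sum>i<n. c i * C i m) = 0" by (rule power_basis_independent[OF npos _ m(1)])
      also have "(\<Sum>i<n. c i * C i m) = (\<Sum>i<n. if i = m then c m * C m m else 0)"
      proof (intro sum.cong refl)
        fix i assume "i \<in> {..<n}"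
        thus "c i * C i m = (if i = m then c m * C m m else 0)"
          using m2[of i] g(1)[of i m] by (cases i m rule: linorder_cases) (auto simp: C_def)
      qed
      finally have "c m * C m m = 0" using m(1) by simp
      thus False using m gk[of m] D unfolding C_def by simp
    qed
    show "\<exists>c :: nat \<Rightarrow> rat. x = (\<Sum>i<n. of_rat (c i) * b i)" if x: "x \<in> K" for x
    proof -
      obtain d w where d: "d > 0" "of_int d * x = ip w \<theta>" using K_scaled_integral[OF x] by blast
      then obtain c :: "nat \<Rightarrow> int" where c: "of_int d * x = (\<Sum>i<n. of_int (c i) * b i)"
        using b(2) OK_closed(10)[of w] unfolding zspan_def by auto
      hence "x = (\<Sum>i<n. of_int (c i) * b i) / of_int d" using d by (simp add: field_simps)
      also have "\<dots> = (\<Sum>i<n. of_rat (of_int (c i) / of_int d) * b i)"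
        by (simp add: sum_divide_distrib of_rat_divide)
      finally show ?thesis by (intro exI[of _ "\<lambda>i. of_int (c i) / of_int d"])
    qed
  qed
  moreover have "\<forall>x\<in>OK. \<exists>c :: nat \<Rightarrow> int. x = (\<Sum>i<n. of_int (c i) * b i)"
    using b(2) unfolding zspan_def by auto
  ultimately have "integral_basis K n b" unfolding integral_basis_def using b(1) by auto
  moreover have "\<bar>C i i\<bar> \<le> 1" if "i < n" for i
  proof -
    have "\<bar>g i i\<bar> \<le> \<bar>D\<bar>" using gk[OF that] D by (intro dvd_imp_le_int) auto
    thus ?thesis unfolding C_def using D by (simp add: abs_divide divide_le_eq)
  qed
  ultimately show ?thesis using that[of b C] bC g(1) by (auto simp: C_def)
qed

text \<open>Another numbering of the embeddings permutes rows, which the square does not see, and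
  another basis multiplies by an integer matrix. Integrality of \<open>u\<close> is enough: used in
  both directions it forces \<open>u^2 = 1\<close>, so the definite description in
  \<open>number_field_disc\<close> is unambiguous.\<close>

lemma disc_change:
  assumes b: "integral_basis K n b" and e: "bij_betw e {..<n} (embeddings K)"
    and b': "integral_basis K n b'" and e': "bij_betw e' {..<n} (embeddings K)"
  shows "\<exists>u :: int. (det_n n (\<lambda>i j. e' i (b' j)))^2 = of_int u ^ 2 * (det_n n (\<lambda>i j. e i (b j)))^2"
proof -
  have "\<forall>j\<in>{..<n}. \<exists>c :: nat \<Rightarrow> int. b' j = (\<Sum>i<n. of_int (c i) * b i)"
    using b b' unfolding integral_basis_def by auto
  then obtain U' :: "nat \<Rightarrow> nat \<Rightarrow> int" where "\<forall>j\<in>{..<n}. b' j = (\<Sum>k<n. of_int (U' j k) * b k)"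
    unfolding bchoice_iff by blast
  then obtain U :: "nat \<Rightarrow> nat \<Rightarrow> int" where U: "\<And>j. j < n \<Longrightarrow> b' j = (\<Sum>k<n. of_int (U k j) * b k)"
    using that[of "\<lambda>k j. U' j k"] by simp
  have bK: "b k \<in> K" if "k < n" for k using b that unfolding integral_basis_def Q_basis_def by auto
  define \<pi> where "\<pi> i = (if i < n then inv_into {..<n} e (e' i) else i)" for i
  have bij: "bij_betw (inv_into {..<n} e \<circ> e') {..<n} {..<n}"
    using e e' by (metis bij_betw_inv_into bij_betw_trans)
  have p: "\<pi> permutes {..<n}"
  proof (rule bij_imp_permutes)
    show "bij_betw \<pi> {..<n} {..<n}"
      using bij by (rule bij_betw_cong[THEN iffD1, rotated]) (auto simp: \<pi>_def)
  qed (auto simp: \<pi>_def)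
  have e'e: "e' i = e (\<pi> i)" if "i < n" for i
  proof -
    have "e' i \<in> e ` {..<n}" using that e e' unfolding bij_betw_def by auto
    thus ?thesis using that by (simp add: \<pi>_def f_inv_into_f)
  qed
  have lin: "e i (b' j) = (\<Sum>k<n. e i (b k) * of_int (U k j))" if ij: "i < n" "j < n" for i j
  proof -
    have "e i \<in> embeddings K" using e ij(1) unfolding bij_betw_def by auto
    then obtain i' where i': "i' < n" "e i = emb i'" using embedding_emb by blast
    show ?thesis unfolding U[OF ij(2)] i'(2)
      using i'(1) bK by (subst emb_sum) (auto simp: mult.commute intro!: sum.cong)
  qed
  have "det_n n (\<lambda>i j. e' i (b' j)) = det_n n (\<lambda>i j. e (\<pi> i) (b' j))"
    by (rule det_n_cong) (simp add: e'e)
  also have "\<dots> = of_int (sign \<pi>) * det_n n (\<lambda>i j. e i (b' j))"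
    by (rule det_n_permute_rows[OF p])
  also have "det_n n (\<lambda>i j. e i (b' j)) = det_n n (\<lambda>i j. \<Sum>k<n. e i (b k) * of_int (U k j))"
    by (rule det_n_cong) (rule lin)
  also have "\<dots> = det_n n (\<lambda>i j. e i (b j)) * det_n n (\<lambda>i j. of_int (U i j))" by (rule det_n_mult)
  finally have eq: "det_n n (\<lambda>i j. e' i (b' j)) =
    of_int (sign \<pi>) * (det_n n (\<lambda>i j. e i (b j)) * det_n n (\<lambda>i j. of_int (U i j)))" .
  obtain u :: int where u: "det_n n (\<lambda>i j. of_int (U i j)) = of_int u" using det_n_of_int by (metis Ints_cases)
  have "(of_int (sign \<pi>) :: complex)^2 = 1" by (auto simp: sign_def)
  thus ?thesis unfolding eq u by (auto simp: power_mult_distrib mult_ac)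
qed

lemma number_field_disc_eq:
  assumes "integral_basis K n b" "bij_betw e {..<n} (embeddings K)"
  shows "number_field_disc n K = (det_n n (\<lambda>i j. e i (b j)))^2"
  unfolding number_field_disc_def
proof (rule the_equality)
  show "\<exists>b' e'. integral_basis K n b' \<and> bij_betw e' {..<n} (embeddings K) \<and>
      (det_n n (\<lambda>i j. e i (b j)))^2 = (det_n n (\<lambda>i j. e' i (b' j)))^2" using assms by blast
next
  fix d assume "\<exists>b' e'. integral_basis K n b' \<and> bij_betw e' {..<n} (embeddings K) \<and>
      d = (det_n n (\<lambda>i j. e' i (b' j)))^2"
  then obtain b' e' where b': "integral_basis K n b'" "bij_betw e' {..<n} (embeddings K)"
    and d: "d = (det_n n (\<lambda>i j. e' i (b' j)))^2" by blast
  obtain u v :: int where uv: "d = of_int u ^ 2 * (det_n n (\<lambda>i j. e i (b j)))^2"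
    "(det_n n (\<lambda>i j. e i (b j)))^2 = of_int v ^ 2 * d"
    using disc_change[OF assms b'] disc_change[OF b' assms] d by blast
  show "d = (det_n n (\<lambda>i j. e i (b j)))^2"
  proof (cases "d = 0")
    case False
    have "d * (of_int u ^ 2 * of_int v ^ 2) = d" using uv by (metis mult.assoc mult.commute)
    hence "of_int (u^2 * v^2) = (1 :: complex)" using False by simp
    hence "u^2 * v^2 = 1" by (simp only: of_int_eq_1_iff)
    hence "u^2 = 1 \<or> u^2 = -1" using zmult_eq_1_iff[of "u^2" "v^2"] by auto
    moreover have "u^2 \<ge> 0" by simp
    ultimately have "u^2 = 1" by linarith
    hence "(of_int u :: complex)^2 = 1" by (metis of_int_1 of_int_power)
    thus ?thesis using uv(1) by simp
  next
    case True
    thus ?thesis using uv(2) by (simp only: mult_zero_right)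
  qed
qed

text \<open>The determinant factors as a Vandermonde determinant times the product of the
  \<open>C i i\<close>, which is at most 1 in absolute value. In the Leibniz formula each of the
  \<open>n!\<close> terms contains \<open>R\<close> to the power 0 + 1 + ... + (n - 1).\<close>

lemma disc_bound:
  assumes R: "R \<ge> 0" "\<And>i. i < n \<Longrightarrow> cmod (\<rho> i) \<le> R"
  shows "cmod (number_field_disc n K) \<le> (fact n * R ^ (n * (n - 1) div 2))^2"
proof -
  obtain b and C :: "nat \<Rightarrow> nat \<Rightarrow> rat" where b: "integral_basis K n b"
    "\<And>i. b i = (\<Sum>j<n. of_rat (C i j) * \<theta> ^ j)" "\<And>i j. j > i \<Longrightarrow> C i j = 0"
    "\<And>i. i < n \<Longrightarrow> \<bar>C i i\<bar> \<le> 1"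
    using triangular_integral_basis by blast
  have "number_field_disc n K = (det_n n (\<lambda>i j. emb i (b j)))^2"
    using number_field_disc_eq[OF b(1) bij_emb] .
  also have "det_n n (\<lambda>i j. emb i (b j)) = det_n n (\<lambda>i j. \<Sum>k<n. \<rho> i ^ k * of_rat (C j k))"
  proof (rule det_n_cong)
    fix i j assume "i < n" "j < n"
    thus "emb i (b j) = (\<Sum>k<n. \<rho> i ^ k * of_rat (C j k))"
      unfolding b(2) by (simp add: emb_sum K_mult K_power mult.commute)
  qed
  also have "\<dots> = det_n n (\<lambda>i k. \<rho> i ^ k) * det_n n (\<lambda>k j. of_rat (C j k))" by (rule det_n_mult)
  also have "det_n n (\<lambda>k j. of_rat (C j k)) = (\<Prod>i<n. of_rat (C i i) :: complex)"
    by (rule det_n_triangular) (simp add: b(3))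
  finally have eq: "cmod (number_field_disc n K) =
    (cmod (det_n n (\<lambda>i k. \<rho> i ^ k)) * cmod (\<Prod>i<n. of_rat (C i i)))^2"
    by (simp add: norm_power norm_mult)
  have "cmod (\<Prod>i<n. of_rat (C i i)) \<le> 1"
    unfolding prod_norm[symmetric]
  proof (intro prod_le_1 conjI)
    fix i assume "i \<in> {..<n}"
    hence "\<bar>C i i\<bar> \<le> 1" using b(4) by simp
    hence "real_of_rat (C i i) \<le> real_of_rat 1" "real_of_rat (-1) \<le> real_of_rat (C i i)"
      unfolding of_rat_less_eq by auto
    hence "\<bar>real_of_rat (C i i)\<bar> \<le> 1" unfolding of_rat_minus of_rat_1 by linarith
    moreover have "(of_rat (C i i) :: complex) = of_real (real_of_rat (C i i))"
      by (cases "C i i") (simp add: Fract_of_int_quotient of_rat_divide)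
    ultimately show "cmod (of_rat (C i i)) \<le> 1" by (simp only: norm_of_real)
  qed auto
  moreover have "cmod (det_n n (\<lambda>i k. \<rho> i ^ k)) \<le> fact n * R ^ (n * (n - 1) div 2)"
  proof -
    have "cmod (det_n n (\<lambda>i k. \<rho> i ^ k)) \<le>
        (\<Sum>p\<in>{p. p permutes {..<n}}. R ^ (n * (n - 1) div 2))"
      unfolding det_n_def
    proof (rule sum_norm_le)
      fix p assume p: "p \<in> {p. p permutes {..<n}}"
      have "cmod (of_int (sign p) * (\<Prod>i<n. \<rho> i ^ p i)) = (\<Prod>i<n. cmod (\<rho> i) ^ p i)"
        by (simp add: norm_mult prod_norm[symmetric] norm_power sign_def)
      also have "\<dots> \<le> (\<Prod>i<n. R ^ p i)" using R by (intro prod_mono) (auto intro!: power_mono)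
      also have "\<dots> = R ^ (\<Sum>i<n. p i)" by (simp add: power_sum)
      also have "(\<Sum>i<n. p i) = (\<Sum>i<n. i)" using p sum.permute[of p "{..<n}" "\<lambda>i. i"] by (simp add: o_def)
      also have "\<dots> = n * (n - 1) div 2" using Sum_Ico_nat[of 0 n] by (simp add: atLeast0LessThan)
      finally show "cmod (of_int (sign p) * (\<Prod>i<n. \<rho> i ^ p i)) \<le> R ^ (n * (n - 1) div 2)" .
    qed
    also have "\<dots> = fact n * R ^ (n * (n - 1) div 2)"
      by (simp add: card_permutations[of "{..<n}" n])
    finally show ?thesis .
  qed
  ultimately have "cmod (det_n n (\<lambda>i k. \<rho> i ^ k)) * cmod (\<Prod>i<n. of_rat (C i i)) \<le>
      (fact n * R ^ (n * (n - 1) div 2)) * 1"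
    using R(1) by (intro mult_mono) auto
  thus ?thesis unfolding eq by (intro power_mono) auto
qed

text \<open>The determinant trick for the lattice \<open>J\<close>.\<close>

lemma stabilizer_integral:
  assumes J: "nz_ideal K J" and a: "a \<in> K" "\<And>x. x \<in> J \<Longrightarrow> a * x \<in> J"
  shows "a \<in> OK"
proof -
  have J': "J \<subseteq> OK" "0 \<in> J" "J \<noteq> {0}" "\<And>x y. x \<in> J \<Longrightarrow> y \<in> J \<Longrightarrow> x + y \<in> J"
    "\<And>r x. r \<in> OK \<Longrightarrow> x \<in> J \<Longrightarrow> r * x \<in> J" using J unfolding nz_ideal_def by auto
  have "x - y \<in> J" if "x \<in> J" "y \<in> J" for x y
    using J'(4)[OF that(1) J'(5)[of "-1" y]] that by simp
  then obtain b where b: "\<And>i. b i \<in> J" "J \<subseteq> zspan {..<n} b"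
    using OK_subgroup_generators[OF J'(1,2)] by blast
  obtain i where i: "i < n" "b i \<noteq> 0"
  proof (rule ccontr)
    assume "\<not> thesis"
    hence "\<forall>i<n. b i = 0" using that by blast
    hence "zspan {..<n} b \<subseteq> {0}" unfolding zspan_def by auto
    thus False using b(2) J'(2,3) by auto
  qed
  have "algebraic_integer a"
    by (rule algebraic_integer_zspan[where I = "{..<n}" and v = b and k = i]) (use i a b in auto)
  thus ?thesis using a(1) unfolding OK_iff by simp
qed

end

section \<open>Ideal classes\<close>

lemma gcd_mult_right_coprime:
  fixes a b d :: nat
  assumes "Rings.coprime a b" shows "gcd (a * d) (b * d) = d"
proof -
  have "gcd a b = 1" using assms coprime_iff_gcd_eq_1 by blast
  moreover have "gcd (a * d) (b * d) = d * gcd a b"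
    unfolding mult.commute[of a d] mult.commute[of b d] by (rule gcd_mult_distrib_nat[symmetric])
  ultimately show ?thesis by simp
qed

lemma ideal_mult_memI: "a \<in> I \<Longrightarrow> b \<in> J \<Longrightarrow> a * b \<in> ideal_mult I J"
  unfolding ideal_mult_def mem_Collect_eq
  by (rule exI[of _ "Suc 0"], rule exI[of _ "\<lambda>_. a"], rule exI[of _ "\<lambda>_. b"]) simp

lemma ideal_mult_0: "0 \<in> ideal_mult I J"
  unfolding ideal_mult_def by (auto intro!: exI[of _ 0])

lemma ideal_multE:
  assumes "x \<in> ideal_mult I J"
  obtains m :: nat and a b where "\<forall>i<m. a i \<in> I \<and> b i \<in> J" "x = (\<Sum>i<m. a i * b i)"
proof -
  from assms have "\<exists>m :: nat. \<exists>a b. (\<forall>i<m. a i \<in> I \<and> b i \<in> J) \<and> x = (\<Sum>i<m. a i * b i)"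
    unfolding ideal_mult_def by simp
  then obtain m :: nat where "\<exists>a b. (\<forall>i<m. a i \<in> I \<and> b i \<in> J) \<and> x = (\<Sum>i<m. a i * b i)" ..
  then obtain a where "\<exists>b. (\<forall>i<m. a i \<in> I \<and> b i \<in> J) \<and> x = (\<Sum>i<m. a i * b i)" ..
  then obtain b where "(\<forall>i<m. a i \<in> I \<and> b i \<in> J) \<and> x = (\<Sum>i<m. a i * b i)" ..
  thus ?thesis using that[of m a b] by simp
qed

lemma ideal_mult_add:
  assumes "x \<in> ideal_mult I J" "y \<in> ideal_mult I J" shows "x + y \<in> ideal_mult I J"
proof -
  obtain m :: nat and a b where x: "\<forall>i<m. a i \<in> I \<and> b i \<in> J" "x = (\<Sum>i<m. a i * b i)"
    using ideal_multE[OF assms(1)] .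
  obtain k :: nat and c d where y: "\<forall>i<k. c i \<in> I \<and> d i \<in> J" "y = (\<Sum>i<k. c i * d i)"
    using ideal_multE[OF assms(2)] .
  define a' where "a' i = (if i < m then a i else c (i - m))" for i :: nat
  define b' where "b' i = (if i < m then b i else d (i - m))" for i :: nat
  have "(\<Sum>i<m + k. a' i * b' i) = (\<Sum>i<m. a' i * b' i) + (\<Sum>i\<in>{m..<m+k}. a' i * b' i)"
    by (subst sum.union_disjoint[symmetric]) (auto intro!: sum.cong)
  also have "(\<Sum>i<m. a' i * b' i) = x" unfolding x(2) by (intro sum.cong) (auto simp: a'_def b'_def)
  also have "(\<Sum>i\<in>{m..<m+k}. a' i * b' i) = (\<Sum>i<k. a' (i + m) * b' (i + m))"
    using sum.shift_bounds_nat_ivl[of "\<lambda>i. a' i * b' i" 0 m k] by (simp add: atLeast0LessThan add.commute)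
  also have "\<dots> = y" unfolding y(2) by (intro sum.cong) (auto simp: a'_def b'_def)
  finally have "x + y = (\<Sum>i<m + k. a' i * b' i)" by simp
  moreover have "\<forall>i<m + k. a' i \<in> I \<and> b' i \<in> J" using x(1) y(1) by (auto simp: a'_def b'_def)
  ultimately show ?thesis unfolding ideal_mult_def by blast
qed

text \<open>Serves as the induction principle for ideal products: with \<open>S\<close> the set of
  elements having a property, only products of two factors need to be examined.\<close>

lemma ideal_mult_least:
  assumes "\<And>a b. a \<in> I \<Longrightarrow> b \<in> J \<Longrightarrow> a * b \<in> S" "0 \<in> S" "\<And>x y. x \<in> S \<Longrightarrow> y \<in> S \<Longrightarrow> x + y \<in> S"
  shows "ideal_mult I J \<subseteq> S"
proof
  fix x assume "x \<in> ideal_mult I J"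
  then obtain m :: nat and a b where x: "\<forall>i<m. a i \<in> I \<and> b i \<in> J" "x = (\<Sum>i<m. a i * b i)"
    by (rule ideal_multE)
  have "k \<le> m \<Longrightarrow> (\<Sum>i<k. a i * b i) \<in> S" for k
    by (induction k) (use assms x(1) in auto)
  thus "x \<in> S" using x(2) by blast
qed

lemma ideal_mult_commute: "ideal_mult I J = ideal_mult J I"
proof -
  have "ideal_mult I J \<subseteq> ideal_mult J I" for I J
    by (rule ideal_mult_least) (auto simp: ideal_mult_0 ideal_mult_add, metis ideal_mult_memI mult.commute)
  thus ?thesis by blast
qed

lemma ideal_mult_assoc: "ideal_mult (ideal_mult I J) L = ideal_mult I (ideal_mult J L)"
proof -
  have *: "ideal_mult (ideal_mult I J) L \<subseteq> ideal_mult I (ideal_mult J L)" for I J L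
  proof (rule ideal_mult_least)
    fix a b assume "a \<in> ideal_mult I J" "b \<in> L"
    have "ideal_mult I J \<subseteq> {x. x * b \<in> ideal_mult I (ideal_mult J L)}"
    proof (rule ideal_mult_least)
      fix c d assume "c \<in> I" "d \<in> J"
      hence "c * (d * b) \<in> ideal_mult I (ideal_mult J L)" using \<open>b \<in> L\<close> by (intro ideal_mult_memI)
      thus "c * d \<in> {x. x * b \<in> ideal_mult I (ideal_mult J L)}" by (simp add: mult.assoc)
    qed (auto simp: ideal_mult_0 distrib_right ideal_mult_add)
    thus "a * b \<in> ideal_mult I (ideal_mult J L)" using \<open>a \<in> ideal_mult I J\<close> by blast
  qed (auto simp: ideal_mult_0 ideal_mult_add)
  have "ideal_mult I (ideal_mult J L) \<subseteq> ideal_mult (ideal_mult I J) L"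
    using *[of L J I] by (simp add: ideal_mult_commute)
  thus ?thesis using * by blast
qed

lemma ideal_mult_left_commute: "ideal_mult I (ideal_mult J L) = ideal_mult J (ideal_mult I L)"
  by (metis ideal_mult_assoc ideal_mult_commute)

lemmas ideal_mult_ac = ideal_mult_assoc ideal_mult_commute ideal_mult_left_commute

context number_field_poly
begin

lemma nz_idealD:
  assumes "nz_ideal K I"
  shows "x \<in> I \<Longrightarrow> x \<in> OK" "0 \<in> I" "\<exists>x\<in>I. x \<noteq> 0" "x \<in> I \<Longrightarrow> y \<in> I \<Longrightarrow> x + y \<in> I"
    "r \<in> OK \<Longrightarrow> x \<in> I \<Longrightarrow> r * x \<in> I"
  using assms unfolding nz_ideal_def by auto

lemma nz_ideal_OK: "nz_ideal K OK"
proof -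
  have "1 \<in> OK" by simp
  hence "OK \<noteq> {0}" by force
  thus ?thesis unfolding nz_ideal_def by auto
qed

lemma nz_ideal_mult: assumes "nz_ideal K I" "nz_ideal K J" shows "nz_ideal K (ideal_mult I J)"
proof -
  note I = nz_idealD[OF assms(1)] and J = nz_idealD[OF assms(2)]
  obtain x y where xy: "x \<in> I" "x \<noteq> 0" "y \<in> J" "y \<noteq> 0" using I(3) J(3) by blast
  have "x * y \<in> ideal_mult I J" "x * y \<noteq> 0" using ideal_mult_memI[OF xy(1,3)] xy(2,4) by simp_all
  hence 1: "ideal_mult I J \<noteq> {0}" by blast
  have 2: "ideal_mult I J \<subseteq> OK"
    using I(1) J(1) by (intro ideal_mult_least) (blast intro: OK_closed)+
  have 3: "r * z \<in> ideal_mult I J" if "r \<in> OK" "z \<in> ideal_mult I J" for r z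
  proof -
    have "ideal_mult I J \<subseteq> {x. r * x \<in> ideal_mult I J}"
    proof (rule ideal_mult_least)
      fix a b assume "a \<in> I" "b \<in> J"
      hence "(r * a) * b \<in> ideal_mult I J" using I(5) that(1) by (intro ideal_mult_memI) auto
      thus "a * b \<in> {x. r * x \<in> ideal_mult I J}" by (simp add: mult.assoc)
    qed (auto simp: ideal_mult_0 distrib_left ideal_mult_add)
    thus ?thesis using that(2) by blast
  qed
  show ?thesis unfolding nz_ideal_def
    by (intro conjI ballI 1 2 3 ideal_mult_0 ideal_mult_add)
qed

lemma ideal_mult_principal:
  assumes "nz_ideal K J"
  shows "ideal_mult ((\<lambda>x. a * x) ` OK) J = (\<lambda>x. a * x) ` J"
proof
  note J = nz_idealD[OF assms]
  show "ideal_mult ((\<lambda>x. a * x) ` OK) J \<subseteq> (\<lambda>x. a * x) ` J"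
  proof (rule ideal_mult_least)
    fix c b assume "c \<in> (\<lambda>x. a * x) ` OK" "b \<in> J"
    then obtain r where "c = a * r" "r \<in> OK" by blast
    hence "c * b = a * (r * b)" "r * b \<in> J" using J(5)[OF _ \<open>b \<in> J\<close>] by (simp_all add: mult.assoc)
    thus "c * b \<in> (\<lambda>x. a * x) ` J" by blast
  next
    fix x y assume "x \<in> (\<lambda>x. a * x) ` J" "y \<in> (\<lambda>x. a * x) ` J"
    thus "x + y \<in> (\<lambda>x. a * x) ` J" using J(4) by (auto simp: distrib_left[symmetric])
  qed (use J(2) in \<open>auto intro: image_eqI[of _ _ 0]\<close>)
  have "a \<in> (\<lambda>x. a * x) ` OK" by (rule image_eqI[of _ _ 1]) auto
  thus "(\<lambda>x. a * x) ` J \<subseteq> ideal_mult ((\<lambda>x. a * x) ` OK) J" by (auto intro: ideal_mult_memI)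
qed

lemma ideal_mult_OK: "nz_ideal K J \<Longrightarrow> ideal_mult OK J = J"
  using ideal_mult_principal[of J 1] by simp

lemma nz_ideal_pow: "nz_ideal K I \<Longrightarrow> nz_ideal K (ideal_pow K I k)"
  by (induction k) (auto intro: nz_ideal_OK nz_ideal_mult)

lemma ideal_pow_add: "nz_ideal K I \<Longrightarrow> ideal_pow K I (a + b) = ideal_mult (ideal_pow K I a) (ideal_pow K I b)"
  by (induction a) (auto simp: ideal_mult_OK nz_ideal_pow ideal_mult_assoc)

lemma ideal_pow_OK: "ideal_pow K OK k = OK"
  by (induction k) (auto simp: ideal_mult_OK nz_ideal_OK)

lemma ideal_pow_distrib:
  "nz_ideal K I \<Longrightarrow> nz_ideal K J \<Longrightarrow>
    ideal_pow K (ideal_mult I J) k = ideal_mult (ideal_pow K I k) (ideal_pow K J k)"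
  by (induction k) (simp_all add: ideal_mult_OK nz_ideal_OK ideal_mult_ac)

lemma ideal_pow_mult: "nz_ideal K I \<Longrightarrow> ideal_pow K (ideal_pow K I a) b = ideal_pow K I (a * b)"
  by (induction b) (auto simp: ideal_pow_add)

lemma power_mem_ideal_pow: "x \<in> I \<Longrightarrow> x ^ k \<in> ideal_pow K I k"
  by (induction k) (auto intro: ideal_mult_memI)

section \<open>Principal ideals and exact orders of classes\<close>

lemma principalE:
  assumes "principal_ideal K I" "nz_ideal K I"
  obtains a where "a \<in> OK" "a \<noteq> 0" "I = (\<lambda>x. a * x) ` OK"
proof -
  obtain a where a: "a \<in> OK" "I = (\<lambda>x. a * x) ` OK" using assms(1) unfolding principal_ideal_def by auto
  have "a \<noteq> 0" using nz_idealD(3)[OF assms(2)] a(2) by auto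
  thus ?thesis using that a by blast
qed

lemma principal_OK: "principal_ideal K OK"
  unfolding principal_ideal_def by (intro bexI[of _ 1]) auto

lemma principal_mult:
  assumes "principal_ideal K I" "principal_ideal K J" "nz_ideal K I" "nz_ideal K J"
  shows "principal_ideal K (ideal_mult I J)"
proof -
  obtain a b where ab: "a \<in> OK" "I = (\<lambda>x. a * x) ` OK" "b \<in> OK" "J = (\<lambda>x. b * x) ` OK"
    using assms unfolding principal_ideal_def by auto
  have "ideal_mult I J = (\<lambda>x. a * x) ` J" unfolding ab(2) by (rule ideal_mult_principal[OF assms(4)])
  also have "\<dots> = (\<lambda>x. (a * b) * x) ` OK" unfolding ab(4) by (auto simp: image_image mult.assoc)
  finally show ?thesis unfolding principal_ideal_def using ab by (intro bexI[of _ "a * b"]) auto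
qed

text \<open>If \<open>B\<close> is generated by \<open>b\<close>, then \<open>A B = b A\<close>; a
  generator of this has the form \<open>b * a\<close> with \<open>a\<close> in \<open>A\<close>, and
  the number \<open>b\<close> cancels. Cancelling a principal factor takes the place of inverting a
  class.\<close>

lemma principal_cancel:
  assumes "principal_ideal K (ideal_mult A B)" "principal_ideal K B" "nz_ideal K A" "nz_ideal K B"
  shows "principal_ideal K A"
proof -
  obtain b where b: "b \<in> OK" "b \<noteq> 0" "B = (\<lambda>x. b * x) ` OK" using principalE[OF assms(2,4)] by blast
  have eq: "ideal_mult A B = (\<lambda>x. b * x) ` A"
    unfolding b(3) ideal_mult_commute[of A] by (rule ideal_mult_principal[OF assms(3)])
  obtain c where c: "c \<in> OK" "(\<lambda>x. b * x) ` A = (\<lambda>x. c * x) ` OK"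
    using assms(1) unfolding eq principal_ideal_def by blast
  have "c \<in> (\<lambda>x. c * x) ` OK" by (rule image_eqI[of _ _ 1]) auto
  then obtain a where a: "a \<in> A" "c = b * a" unfolding c(2)[symmetric] by blast
  have "(\<lambda>x. b * x) ` A = (\<lambda>x. b * x) ` ((\<lambda>x. a * x) ` OK)"
    unfolding c(2) a(2) by (simp add: image_image mult.assoc)
  hence "A = (\<lambda>x. a * x) ` OK" using b(2) by (subst (asm) inj_image_eq_iff) (auto intro!: injI)
  thus ?thesis unfolding principal_ideal_def using a(1) nz_idealD(1)[OF assms(3)] by blast
qed

lemma principal_pow: "principal_ideal K I \<Longrightarrow> nz_ideal K I \<Longrightarrow> principal_ideal K (ideal_pow K I k)"
  by (induction k) (auto intro: principal_OK principal_mult nz_ideal_pow)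

lemma principal_pow_dvd:
  assumes "nz_ideal K I" "principal_ideal K (ideal_pow K I a)" "a dvd b"
  shows "principal_ideal K (ideal_pow K I b)"
proof -
  obtain c where "b = a * c" using assms(3) by auto
  thus ?thesis using principal_pow[OF assms(2) nz_ideal_pow[OF assms(1)], of c] ideal_pow_mult[OF assms(1)] by simp
qed

text \<open>From \<open>a x = b y + gcd a b\<close> the power with exponent \<open>a x\<close> is
  the product of those with exponents \<open>gcd a b\<close> and \<open>b y\<close>; the last factor
  is principal and cancels.\<close>

lemma principal_pow_gcd:
  assumes "nz_ideal K I" "principal_ideal K (ideal_pow K I a)" "principal_ideal K (ideal_pow K I b)"
  shows "principal_ideal K (ideal_pow K I (gcd a b))"
proof (cases "a = 0")
  case False
  then obtain x y where xy: "a * x = b * y + gcd a b" using bezout_nat by blast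
  have "principal_ideal K (ideal_pow K I (a * x))" "principal_ideal K (ideal_pow K I (b * y))"
    using principal_pow_dvd[OF assms(1)] assms by auto
  moreover have "ideal_pow K I (a * x) = ideal_mult (ideal_pow K I (gcd a b)) (ideal_pow K I (b * y))"
    unfolding xy add.commute[of "b * y"] by (rule ideal_pow_add[OF assms(1)])
  ultimately show ?thesis
    using principal_cancel[OF _ _ nz_ideal_pow[OF assms(1)] nz_ideal_pow[OF assms(1)]] by metis
qed (use assms in auto)

lemma principal_pow_below_order:
  assumes J: "nz_ideal K J" "principal_ideal K (ideal_pow K J l)" and k: "0 < k" "k < l"
    and prin: "principal_ideal K (ideal_pow K J k)"
  obtains p where "prime p" "p dvd l" "principal_ideal K (ideal_pow K J (l div p))"
proof -
  define g where "g = gcd k l"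
  have g: "principal_ideal K (ideal_pow K J g)" unfolding g_def by (rule principal_pow_gcd[OF J(1) prin J(2)])
  obtain m where m: "l = g * m" unfolding g_def by (metis dvd_def gcd_dvd2)
  have "g \<le> k" unfolding g_def using k by (intro gcd_le1_nat) auto
  hence "m \<noteq> 1" using m k by auto
  then obtain p where p: "prime p" "p dvd m" using prime_factor_nat by blast
  then obtain c where "m = p * c" by auto
  hence "g dvd l div p" using m p(1) prime_gt_0_nat[OF p(1)] by auto
  thus ?thesis using that[of p] p m principal_pow_dvd[OF J(1) g] by auto
qed

text \<open>If \<open>J\<close> works for the primes in \<open>S\<close> and \<open>I\<close> for \<open>p\<close>, then \<open>J\<^sup>p I\<^sup>m\<close> with \<open>m = \<Prod>S\<close>
  works for all of them.\<close>

lemma ideal_class_exact_order: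
  assumes l: "l \<ge> 1"
    and ex: "\<And>p. prime p \<Longrightarrow> p dvd l \<Longrightarrow> \<exists>I. nz_ideal K I \<and> principal_ideal K (ideal_pow K I l) \<and>
      \<not> principal_ideal K (ideal_pow K I (l div p))"
  shows "has_class_of_order K l"
proof -
  have "\<exists>J. nz_ideal K J \<and> principal_ideal K (ideal_pow K J l) \<and>
      (\<forall>p\<in>S. \<not> principal_ideal K (ideal_pow K J (l div p)))"
    if "finite S" "\<And>p. p \<in> S \<Longrightarrow> prime p \<and> p dvd l" for S :: "nat set"
    using that
  proof (induction S)
    case empty
    show ?case using nz_ideal_OK principal_OK by (intro exI[of _ OK]) (simp add: ideal_pow_OK)
  next
    case (insert p S)
    then obtain J where J: "nz_ideal K J" "principal_ideal K (ideal_pow K J l)"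
      "\<And>p. p \<in> S \<Longrightarrow> \<not> principal_ideal K (ideal_pow K J (l div p))" by auto
    have p: "prime p" "p dvd l" using insert.prems by auto
    obtain I where I: "nz_ideal K I" "principal_ideal K (ideal_pow K I l)"
      "\<not> principal_ideal K (ideal_pow K I (l div p))" using ex[OF p] by blast
    define m where "m = \<Prod>S"
    have mp: "Rings.coprime m p" unfolding m_def
      using insert.prems insert.hyps p by (intro prod_coprime_left) (auto intro: primes_coprime)
    define N where "N = ideal_mult (ideal_pow K J p) (ideal_pow K I m)"
    have N: "ideal_pow K N k = ideal_mult (ideal_pow K J (p * k)) (ideal_pow K I (m * k))" for k
      unfolding N_def by (simp add: ideal_pow_distrib ideal_pow_mult nz_ideal_pow J(1) I(1))
    note nz = nz_ideal_pow[OF J(1)] nz_ideal_pow[OF I(1)]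
    have "\<not> principal_ideal K (ideal_pow K N (l div s))" if s: "s \<in> insert p S" for s
    proof
      assume *: "principal_ideal K (ideal_pow K N (l div s))"
      have sl: "prime s" "s dvd l" using insert.prems s by auto
      show False
      proof (cases "s = p")
        case True
        \<comment> \<open>Here the factor from \<open>J\<close> is its \<open>l\<close>-th power and
          cancels. What remains gives exponent \<open>m * (l div p)\<close> for \<open>I\<close>;
          together with exponent \<open>l\<close> and the coprimality of \<open>m\<close> and
          \<open>p\<close> this yields \<open>l div p\<close>.\<close>
        have "principal_ideal K (ideal_pow K J (p * (l div p)))" using J(2) p by simp
        hence "principal_ideal K (ideal_pow K I (m * (l div p)))"
          using * nz unfolding True N ideal_mult_commute[of "ideal_pow K J _"]
          by (blast intro: principal_cancel)
        moreover have "principal_ideal K (ideal_pow K I (p * (l div p)))" using I(2) p by simp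
        ultimately have "principal_ideal K (ideal_pow K I (gcd (m * (l div p)) (p * (l div p))))"
          by (rule principal_pow_gcd[OF I(1)])
        also have "gcd (m * (l div p)) (p * (l div p)) = l div p"
          by (rule gcd_mult_right_coprime[OF mp])
        finally show False using I(3) by simp
      next
        case False
        \<comment> \<open>Now the roles are exchanged: \<open>s\<close> divides \<open>m\<close>, so
          the factor from \<open>I\<close> is principal, and \<open>p\<close> is coprime to
          \<open>s\<close>.\<close>
        hence sS: "s \<in> S" using s by auto
        hence "s dvd m" unfolding m_def using insert.hyps(1) by (intro dvd_prodI)
        hence "l dvd m * (l div s)" using sl(2) by (metis dvd_mult_div_cancel mult_dvd_mono dvd_refl)
        hence "principal_ideal K (ideal_pow K I (m * (l div s)))" by (rule principal_pow_dvd[OF I(1,2)])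
        hence "principal_ideal K (ideal_pow K J (p * (l div s)))"
          using * nz unfolding N by (blast intro: principal_cancel)
        moreover have "principal_ideal K (ideal_pow K J (s * (l div s)))" using J(2) sl by simp
        ultimately have "principal_ideal K (ideal_pow K J (gcd (p * (l div s)) (s * (l div s))))"
          by (rule principal_pow_gcd[OF J(1)])
        also have "gcd (p * (l div s)) (s * (l div s)) = l div s"
          using primes_coprime[OF p(1) sl(1)] False by (intro gcd_mult_right_coprime) simp
        finally show False using J(3) sS by simp
      qed
    qed
    moreover have "principal_ideal K (ideal_pow K N l)" unfolding N
      using nz principal_pow_dvd[OF J(1,2)] principal_pow_dvd[OF I(1,2)] by (intro principal_mult) auto
    moreover have "nz_ideal K N" unfolding N_def using nz by (intro nz_ideal_mult)
    ultimately show ?case by blast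
  qed
  from this[of "prime_factors l"] obtain J where J: "nz_ideal K J" "principal_ideal K (ideal_pow K J l)"
    and Jp: "\<forall>p\<in>prime_factors l. \<not> principal_ideal K (ideal_pow K J (l div p))" by auto
  have "\<not> principal_ideal K (ideal_pow K J (l div p))" if "prime p" "p dvd l" for p
  proof -
    have "p \<in> prime_factors l" using that l by (simp add: in_prime_factors_iff)
    thus ?thesis using Jp by blast
  qed
  hence "\<not> principal_ideal K (ideal_pow K J k)" if "0 < k" "k < l" for k
    using principal_pow_below_order[OF J that] by metis
  thus ?thesis unfolding has_class_of_order_def using J by metis
qed

section \<open>Multiplication of ideal classes by a fixed class\<close>

lemma ideal_equivI:
  "nz_ideal K I \<Longrightarrow> nz_ideal K J \<Longrightarrow> a \<in> OK \<Longrightarrow> b \<in> OK \<Longrightarrow> a \<noteq> 0 \<Longrightarrow> b \<noteq> 0 \<Longrightarrow>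
    (\<lambda>x. a * x) ` I = (\<lambda>x. b * x) ` J \<Longrightarrow> (I, J) \<in> ideal_equiv K"
  unfolding ideal_equiv_def by blast

lemma equiv_ideal_equiv: "equiv {I. nz_ideal K I} (ideal_equiv K)"
proof (rule equivI)
  show "ideal_equiv K \<subseteq> {I. nz_ideal K I} \<times> {I. nz_ideal K I}" unfolding ideal_equiv_def by auto
  show "refl_on {I. nz_ideal K I} (ideal_equiv K)"
    unfolding refl_on_def by (auto intro!: ideal_equivI[of _ _ 1 1])
  show "sym (ideal_equiv K)" unfolding sym_def ideal_equiv_def by (auto; metis)
  show "trans (ideal_equiv K)"
  proof (rule transI)
    fix A B C assume "(A, B) \<in> ideal_equiv K" "(B, C) \<in> ideal_equiv K"
    then obtain a b c d where h: "nz_ideal K A" "nz_ideal K C" "a \<in> OK" "b \<in> OK" "c \<in> OK" "d \<in> OK"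
      "a \<noteq> 0" "b \<noteq> 0" "c \<noteq> 0" "d \<noteq> 0" "(\<lambda>x. a * x) ` A = (\<lambda>x. b * x) ` B" "(\<lambda>x. c * x) ` B = (\<lambda>x. d * x) ` C"
      unfolding ideal_equiv_def by auto
    have "(\<lambda>x. (c * a) * x) ` A = (\<lambda>x. c * x) ` ((\<lambda>x. a * x) ` A)" by (simp add: image_image mult.assoc)
    also have "\<dots> = (\<lambda>x. b * x) ` ((\<lambda>x. c * x) ` B)" unfolding h(11) by (simp add: image_image mult_ac)
    also have "\<dots> = (\<lambda>x. (b * d) * x) ` C" unfolding h(12) by (simp add: image_image mult.assoc)
    finally show "(A, C) \<in> ideal_equiv K" using h by (intro ideal_equivI[of _ _ "c * a" "b * d"]) auto
  qed
qed

lemma ideal_equiv_mult: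
  assumes "(A, B) \<in> ideal_equiv K" "nz_ideal K L"
  shows "(ideal_mult L A, ideal_mult L B) \<in> ideal_equiv K"
proof -
  obtain a b where h: "nz_ideal K A" "nz_ideal K B" "a \<in> OK" "b \<in> OK" "a \<noteq> 0" "b \<noteq> 0"
    "(\<lambda>x. a * x) ` A = (\<lambda>x. b * x) ` B"
    using assms(1) unfolding ideal_equiv_def by auto
  have *: "(\<lambda>x. c * x) ` ideal_mult L I = ideal_mult L ((\<lambda>x. c * x) ` I)" if "nz_ideal K I" for c I
    using ideal_mult_principal[OF nz_ideal_mult[OF assms(2) that], of c] ideal_mult_principal[OF that, of c]
    by (metis ideal_mult_left_commute)
  show ?thesis using h assms(2) nz_ideal_mult *[of A a] *[of B b] by (intro ideal_equivI[of _ _ a b]) auto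
qed

lemma ideal_equiv_principal:
  assumes "principal_ideal K A" "nz_ideal K A" "nz_ideal K I"
  shows "(ideal_mult A I, I) \<in> ideal_equiv K"
proof -
  obtain a where a: "a \<in> OK" "a \<noteq> 0" "A = (\<lambda>x. a * x) ` OK" using principalE[OF assms(1,2)] by blast
  have "(\<lambda>x. 1 * x) ` ideal_mult A I = (\<lambda>x. a * x) ` I"
    unfolding a(3) using ideal_mult_principal[OF assms(3), of a] by simp
  moreover have "1 \<in> OK" "(1 :: complex) \<noteq> 0" by simp_all
  ultimately show ?thesis using ideal_equivI[OF nz_ideal_mult[OF assms(2,3)] assms(3)] a(1,2) by blast
qed

text \<open>From \<open>a A I = b I\<close> the elements of \<open>(a / b) A\<close> map
  \<open>I\<close> into itself, so they are integral by \<open>stabilizer_integral\<close>; in the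
  same way so are those of \<open>(b / (a d)) B\<close>, where \<open>d\<close> generates
  \<open>A B\<close>. Hence \<open>B\<close> lies in the multiples of \<open>a d / b\<close>, and
  this number itself belongs to \<open>B\<close>: so \<open>B\<close> is principal, and
  \<open>A\<close> follows by cancellation. Only \<open>A\<close> has to be invertible up to a
  principal ideal, not \<open>I\<close>.\<close>

lemma ideal_class_action_free:
  assumes nz: "nz_ideal K A" "nz_ideal K B" "nz_ideal K I"
    and AB: "principal_ideal K (ideal_mult A B)" and sim: "(ideal_mult A I, I) \<in> ideal_equiv K"
  shows "principal_ideal K A"
proof -
  obtain a b where ab: "a \<in> OK" "b \<in> OK" "a \<noteq> 0" "b \<noteq> 0"
    "(\<lambda>x. a * x) ` ideal_mult A I = (\<lambda>x. b * x) ` I"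
    using sim unfolding ideal_equiv_def by auto
  obtain d where d: "d \<in> OK" "d \<noteq> 0" "ideal_mult A B = (\<lambda>x. d * x) ` OK"
    using principalE[OF AB nz_ideal_mult[OF nz(1,2)]] by blast
  have AinOK: "a * \<alpha> / b \<in> OK" if "\<alpha> \<in> A" for \<alpha>
  proof (rule stabilizer_integral[OF nz(3)])
    show "a * \<alpha> / b \<in> K" using ab that nz_idealD(1)[OF nz(1)] by (intro K_divide K_mult OK_K) auto
    fix x assume "x \<in> I"
    hence "a * (\<alpha> * x) \<in> (\<lambda>x. a * x) ` ideal_mult A I" using that ideal_mult_memI by blast
    then obtain y where "y \<in> I" "a * (\<alpha> * x) = b * y" unfolding ab(5) by blast
    thus "a * \<alpha> / b * x \<in> I" using ab by (simp add: field_simps)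
  qed
  have BinOK: "b * \<beta> / (a * d) \<in> OK" if "\<beta> \<in> B" for \<beta>
  proof (rule stabilizer_integral[OF nz(3)])
    show "b * \<beta> / (a * d) \<in> K" using ab d that nz_idealD(1)[OF nz(2)] by (intro K_divide K_mult OK_K) auto
    fix x assume "x \<in> I"
    hence "b * x \<in> (\<lambda>x. a * x) ` ideal_mult A I" unfolding ab(5) by blast
    then obtain y where y: "y \<in> ideal_mult A I" "b * x = a * y" by blast
    have "y * \<beta> \<in> ideal_mult (ideal_mult A I) B" using y(1) that by (rule ideal_mult_memI)
    also have "ideal_mult (ideal_mult A I) B = ideal_mult (ideal_mult A B) I" by (simp add: ideal_mult_ac)
    also have "\<dots> = (\<lambda>x. d * x) ` I" unfolding d(3) by (rule ideal_mult_principal[OF nz(3)])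
    finally obtain z where z: "z \<in> I" "y * \<beta> = d * z" by blast
    have "b * \<beta> / (a * d) * x = (b * x) * \<beta> / (a * d)" by simp
    also have "\<dots> = z" unfolding y(2) using z(2) ab d by (simp add: mult.assoc)
    finally show "b * \<beta> / (a * d) * x \<in> I" using z(1) by simp
  qed
  define \<beta> where "\<beta> = a * d / b"
  have b0: "\<beta> \<noteq> 0" using ab d by (simp add: \<beta>_def)
  \<comment> \<open>As \<open>(a / b) A\<close> consists of integers, \<open>(a / b) A B\<close> is
    contained in \<open>B\<close>; applied to \<open>d\<close> this puts \<open>a d / b\<close> into
    \<open>B\<close>.\<close>
  have sub: "ideal_mult A B \<subseteq> {x. a * x / b \<in> B}"
  proof (rule ideal_mult_least)
    fix \<alpha> \<gamma> assume "\<alpha> \<in> A" "\<gamma> \<in> B"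
    thus "\<alpha> * \<gamma> \<in> {x. a * x / b \<in> B}"
      using nz_idealD(5)[OF nz(2) AinOK] by (auto simp: field_simps)
  next
    fix x y assume "x \<in> {x. a * x / b \<in> B}" "y \<in> {x. a * x / b \<in> B}"
    thus "x + y \<in> {x. a * x / b \<in> B}"
      using nz_idealD(4)[OF nz(2)] by (simp add: distrib_left add_divide_distrib)
  qed (use nz_idealD(2)[OF nz(2)] in auto)
  have "d \<in> ideal_mult A B" unfolding d(3) by (rule image_eqI[of _ _ 1]) auto
  hence bB: "\<beta> \<in> B" using sub unfolding \<beta>_def by auto
  have "B = (\<lambda>x. \<beta> * x) ` OK"
  proof
    show "(\<lambda>x. \<beta> * x) ` OK \<subseteq> B" using nz_idealD(5)[OF nz(2) _ bB] by (auto simp: mult.commute)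
    show "B \<subseteq> (\<lambda>x. \<beta> * x) ` OK"
    proof
      fix x assume "x \<in> B"
      from BinOK[OF this] show "x \<in> (\<lambda>x. \<beta> * x) ` OK"
        using ab d by (intro image_eqI[of _ _ "b * x / (a * d)"]) (auto simp: \<beta>_def)
    qed
  qed
  hence "principal_ideal K B" unfolding principal_ideal_def using bB nz_idealD(1)[OF nz(2)] by blast
  thus ?thesis using principal_cancel[OF AB _ nz(1,2)] by blast
qed

lemma order_dvd_class_number:
  assumes l: "l \<ge> 1" and has: "has_class_of_order K l"
  shows "l dvd class_number K"
proof -
  obtain J where J: "nz_ideal K J" "principal_ideal K (ideal_pow K J l)"
    "\<And>k. 0 < k \<Longrightarrow> k < l \<Longrightarrow> \<not> principal_ideal K (ideal_pow K J k)"
    using has unfolding has_class_of_order_def by blast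
  define R where "R = ideal_equiv K"
  define C where "C = {I. nz_ideal K I} // R"
  note eqv = equiv_ideal_equiv[folded R_def]
  define act where "act k I = R `` {ideal_mult (ideal_pow K J k) I}" for k I
  define orb where "orb I = (\<lambda>k. act k I) ` {..<l}" for I
  note nzJ = nz_ideal_pow[OF J(1)]
  have sim_refl: "(I, I) \<in> R" if "nz_ideal K I" for I
    using eqv that by (auto dest: equivE simp: refl_on_def equiv_def)
  have act_eq: "act j I = act k I' \<longleftrightarrow> (ideal_mult (ideal_pow K J j) I, ideal_mult (ideal_pow K J k) I') \<in> R"
    if "nz_ideal K I" "nz_ideal K I'" for j k I I'
    unfolding act_def using eq_equiv_class_iff[OF eqv] nz_ideal_mult[OF nzJ] that by auto
  have act_add: "act (m + j) I = act (m + k) I'"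
    if "act j I = act k I'" "nz_ideal K I" "nz_ideal K I'" for j k m I I'
    using that ideal_equiv_mult[of _ _ "ideal_pow K J m"] nzJ
    by (simp add: act_eq ideal_pow_add[OF J(1)] ideal_mult_assoc R_def)
  have act_l: "act (l * m + k) I = act k I" if "nz_ideal K I" for m k I
    using that ideal_equiv_principal[OF principal_pow_dvd[OF J(1,2), of "l * m"] nzJ nz_ideal_mult[OF nzJ[of k] that]]
    by (simp add: act_eq ideal_pow_add[OF J(1)] ideal_mult_assoc R_def)
  have act_orb: "act k I \<in> orb I" if "nz_ideal K I" for k I
    using act_l[OF that, of "k div l" "k mod l"] l unfolding orb_def
    by (intro image_eqI[of _ _ "k mod l"]) auto
  have inj: "inj_on (\<lambda>k. act k I) {..<l}" if I: "nz_ideal K I" for I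
  proof -
    have "False" if jk: "act j I = act k I" "j < k" "k < l" for j k
    proof -
      define A where "A = ideal_pow K J (k - j)"
      define L where "L = ideal_mult (ideal_pow K J j) I"
      have nz: "nz_ideal K A" "nz_ideal K L" unfolding A_def L_def using nzJ I nz_ideal_mult by auto
      have "(L, ideal_mult (ideal_pow K J k) I) \<in> R" using jk(1) I unfolding L_def by (simp add: act_eq)
      also have "ideal_mult (ideal_pow K J k) I = ideal_mult A L" unfolding A_def L_def
        using ideal_pow_add[OF J(1), of "k - j" j] jk(2) by (simp add: ideal_mult_assoc)
      finally have "(ideal_mult A L, L) \<in> R" using eqv unfolding equiv_def sym_def by blast
      moreover have "principal_ideal K (ideal_mult A (ideal_pow K J (l - (k - j))))"
        unfolding A_def using ideal_pow_add[OF J(1), of "k - j" "l - (k - j)"] jk J(2) by simp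
      ultimately have "principal_ideal K A"
        using ideal_class_action_free[OF nz(1) nzJ nz(2)] unfolding R_def by blast
      thus False using J(3)[of "k - j"] jk unfolding A_def by auto
    qed
    thus ?thesis by (intro inj_onI) (metis lessThan_iff nat_neq_iff)
  qed
  have orb_sub: "orb I' \<subseteq> orb I" if eq: "act j I = act k I'" "k < l" and nz: "nz_ideal K I" "nz_ideal K I'"
    for I I' j k
  proof
    fix x assume "x \<in> orb I'"
    then obtain m where m: "x = act m I'" unfolding orb_def by auto
    \<comment> \<open>Multiplying by \<open>l - k\<close> further factors \<open>J\<close> undoes
      the \<open>k\<close> factors on the right, because the \<open>l\<close>-th power acts
      trivially.\<close>
    have "act (m + (l - k) + j) I = act (m + (l - k) + k) I'" by (rule act_add[OF eq(1) nz])
    also have "m + (l - k) + k = l * 1 + m" using eq(2) by simp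
    also have "act (l * 1 + m) I' = x" unfolding m by (rule act_l[OF nz(2)])
    finally show "x \<in> orb I" using act_orb[OF nz(1)] by metis
  qed
  have un: "\<Union> (orb ` {I. nz_ideal K I}) = C"
  proof
    show "\<Union> (orb ` {I. nz_ideal K I}) \<subseteq> C"
      unfolding orb_def act_def C_def using nz_ideal_mult[OF nzJ] by (auto intro!: quotientI)
    show "C \<subseteq> \<Union> (orb ` {I. nz_ideal K I})"
    proof
      fix x assume "x \<in> C"
      then obtain I where I: "nz_ideal K I" "x = R `` {I}" unfolding C_def by (auto elim: quotientE)
      hence "x = act 0 I" unfolding act_def by (simp add: ideal_mult_OK)
      thus "x \<in> \<Union> (orb ` {I. nz_ideal K I})" using act_orb[OF I(1), of 0] I(1) by auto
    qed
  qed
  have "l dvd card C"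
  proof (cases "finite C")
    case True
    have "l dvd card (\<Union> (orb ` {I. nz_ideal K I}))"
    proof (rule dvd_partition)
      show "finite (\<Union> (orb ` {I. nz_ideal K I}))" using True un by simp
      show "\<forall>c\<in>orb ` {I. nz_ideal K I}. l dvd card c"
        using inj by (auto simp: orb_def card_image)
      show "\<forall>c1\<in>orb ` {I. nz_ideal K I}. \<forall>c2\<in>orb ` {I. nz_ideal K I}. c1 \<noteq> c2 \<longrightarrow> c1 \<inter> c2 = {}"
      proof (intro ballI impI, rule ccontr)
        fix c1 c2 assume "c1 \<in> orb ` {I. nz_ideal K I}" "c2 \<in> orb ` {I. nz_ideal K I}" "c1 \<noteq> c2" "c1 \<inter> c2 \<noteq> {}"
        then obtain I I' j k where "c1 = orb I" "c2 = orb I'" "nz_ideal K I" "nz_ideal K I'"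
          "act j I = act k I'" "j < l" "k < l" unfolding orb_def by auto
        thus False using orb_sub[of j I k I'] orb_sub[of k I' j I] \<open>c1 \<noteq> c2\<close> by auto
      qed
    qed
    thus ?thesis unfolding un .
  qed simp
  thus ?thesis unfolding class_number_def C_def R_def .
qed

lemma has_class_of_order_1: "has_class_of_order K 1"
  unfolding has_class_of_order_def
  by (intro exI[of _ OK]) (auto simp: ideal_mult_OK nz_ideal_OK principal_OK)

text \<open>Take \<open>I\<close> generated by \<open>\<alpha>\<close> and \<open>b\<close>. Its
  \<open>l\<close>-th power lies in the ideal generated by \<open>\<alpha>\<close> and
  \<open>b^l\<close>, and \<open>b^l\<close> is a multiple of \<open>\<alpha>\<close>. For the
  converse, comaximality of \<open>\<alpha>\<close> and \<open>\<gamma>\<close> writes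
  \<open>\<alpha>\<close> as a combination of \<open>\<alpha>^l\<close> and \<open>b^l\<close>, both
  of which are in that power.\<close>

lemma power_ideal:
  assumes "\<alpha> \<in> OK" "\<alpha> \<noteq> 0" "b \<in> OK" "\<gamma> \<in> OK" "\<alpha> * \<gamma> = b ^ l" "l \<ge> 1"
    and comax: "u \<in> OK" "v \<in> OK" "u * \<alpha> + v * \<gamma> = 1"
  shows "\<exists>I. nz_ideal K I \<and> ideal_pow K I l = (\<lambda>x. \<alpha> * x) ` OK"
proof -
  define sp where "sp c = {\<alpha> * x + c * y | x y. x \<in> OK \<and> y \<in> OK}" for c
  have sp0: "0 \<in> sp c" for c unfolding sp_def by (auto intro!: exI[of _ 0])
  have spa: "x + y \<in> sp c" if xy: "x \<in> sp c" "y \<in> sp c" for x y c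
  proof -
    obtain x1 x2 y1 y2 where "x = \<alpha> * x1 + c * x2" "y = \<alpha> * y1 + c * y2"
      "x1 \<in> OK" "x2 \<in> OK" "y1 \<in> OK" "y2 \<in> OK" using xy unfolding sp_def by blast
    thus ?thesis unfolding sp_def mem_Collect_eq
      by (intro exI[of _ "x1 + y1"] exI[of _ "x2 + y2"]) (simp add: algebra_simps)
  qed
  have spm: "r * x \<in> sp c" if rx: "r \<in> OK" "x \<in> sp c" for r x c
  proof -
    obtain x1 x2 where "x = \<alpha> * x1 + c * x2" "x1 \<in> OK" "x2 \<in> OK" using rx(2) unfolding sp_def by blast
    thus ?thesis unfolding sp_def mem_Collect_eq using rx(1)
      by (intro exI[of _ "r * x1"] exI[of _ "r * x2"]) (simp add: algebra_simps)
  qed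
  have sp\<alpha>: "\<alpha> * x \<in> sp c" "c * x \<in> sp c" if x: "x \<in> OK" for x c
  proof -
    have "\<alpha> * x = \<alpha> * x + c * 0" "c * x = \<alpha> * 0 + c * x" "0 \<in> OK" by simp_all
    thus "\<alpha> * x \<in> sp c" "c * x \<in> sp c" unfolding sp_def mem_Collect_eq using x by blast+
  qed
  define I where "I = sp b"
  have I\<alpha>: "\<alpha> \<in> I" "b \<in> I" unfolding I_def using sp\<alpha>[of 1 b] by auto
  have I: "nz_ideal K I" unfolding nz_ideal_def
  proof (intro conjI ballI)
    show "I \<subseteq> OK" unfolding I_def sp_def using assms(1,3) by auto
    show "I \<noteq> {0}" using I\<alpha>(1) assms(2) by auto
  qed (auto simp: I_def sp0 spa spm)
  have sub: "ideal_pow K I k \<subseteq> sp (b ^ k)" for k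
  proof (induction k)
    case 0
    thus ?case using sp\<alpha>(2)[of _ 1] by auto
  next
    case (Suc k)
    show ?case unfolding ideal_pow.simps
    proof (rule ideal_mult_least)
      fix x y assume "x \<in> I" "y \<in> ideal_pow K I k"
      hence "y \<in> sp (b ^ k)" using Suc by auto
      then obtain y1 y2 where y: "y = \<alpha> * y1 + b ^ k * y2" "y1 \<in> OK" "y2 \<in> OK" unfolding sp_def by auto
      obtain x1 x2 where x: "x = \<alpha> * x1 + b * x2" "x1 \<in> OK" "x2 \<in> OK"
        using \<open>x \<in> I\<close> unfolding I_def sp_def by auto
      have "x * y = \<alpha> * (x1 * y + b * x2 * y1) + b ^ Suc k * (x2 * y2)"
        unfolding x y by (simp add: algebra_simps)
      moreover have "y \<in> OK" using y assms by auto
      ultimately show "x * y \<in> sp (b ^ Suc k)" unfolding sp_def using x y assms(3) by blast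
    qed (auto simp: sp0 spa)
  qed
  have "ideal_pow K I l = (\<lambda>x. \<alpha> * x) ` OK"
  proof
    show "ideal_pow K I l \<subseteq> (\<lambda>x. \<alpha> * x) ` OK"
    proof
      fix x assume "x \<in> ideal_pow K I l"
      then obtain x1 x2 where "x = \<alpha> * x1 + b ^ l * x2" "x1 \<in> OK" "x2 \<in> OK"
        using sub[of l] unfolding sp_def by blast
      hence "x = \<alpha> * (x1 + \<gamma> * x2)" "x1 + \<gamma> * x2 \<in> OK"
        using assms(4) unfolding assms(5)[symmetric] by (simp_all add: distrib_left mult.assoc)
      thus "x \<in> (\<lambda>x. \<alpha> * x) ` OK" by blast
    qed
    \<comment> \<open>Modulo \<open>\<gamma>\<close> the number \<open>u * \<alpha>\<close> is 1,
      hence so are its powers. Multiplying the case \<open>k = l - 1\<close> by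
      \<open>\<alpha>\<close> turns \<open>\<alpha> * \<gamma>\<close> into
      \<open>b^l\<close>.\<close>
    have "\<exists>w\<in>OK. 1 = u ^ k * \<alpha> ^ k + \<gamma> * w" for k
    proof (induction k)
      case (Suc k)
      then obtain w where w: "w \<in> OK" "1 = u ^ k * \<alpha> ^ k + \<gamma> * w" by blast
      have "1 = (u * \<alpha> + v * \<gamma>) * (u ^ k * \<alpha> ^ k + \<gamma> * w)" using w(2) comax(3) by simp
      also have "\<dots> = u ^ Suc k * \<alpha> ^ Suc k + \<gamma> * (u * \<alpha> * w + v * (u ^ k * \<alpha> ^ k + \<gamma> * w))"
        by (simp add: algebra_simps)
      finally show ?case using w comax assms by (intro bexI[of _ "u * \<alpha> * w + v * (u ^ k * \<alpha> ^ k + \<gamma> * w)"]) auto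
    qed (auto intro!: bexI[of _ 0])
    then obtain w where w: "w \<in> OK" "1 = u ^ (l - 1) * \<alpha> ^ (l - 1) + \<gamma> * w" by blast
    have "\<alpha> = \<alpha> * (u ^ (l - 1) * \<alpha> ^ (l - 1) + \<gamma> * w)" using w(2) by simp
    also have "\<dots> = u ^ (l - 1) * \<alpha> ^ l + w * b ^ l"
      using assms(5,6) by (cases l) (auto simp: algebra_simps)
    finally have "\<alpha> = u ^ (l - 1) * \<alpha> ^ l + w * b ^ l" .
    moreover note nz = nz_idealD[OF nz_ideal_pow[OF I, of l]]
    have "u ^ (l - 1) * \<alpha> ^ l + w * b ^ l \<in> ideal_pow K I l"
      using power_mem_ideal_pow[OF I\<alpha>(1), of l] power_mem_ideal_pow[OF I\<alpha>(2), of l] comax(1) w(1)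
      by (intro nz(4,5)) auto
    ultimately have "\<alpha> \<in> ideal_pow K I l" by simp
    thus "(\<lambda>x. \<alpha> * x) ` OK \<subseteq> ideal_pow K I l" using nz(5) by (auto simp: mult.commute)
  qed
  thus ?thesis using I by blast
qed

lemma principal_generators_unit:
  assumes "(\<lambda>x. a * x) ` OK = (\<lambda>x. b * x) ` OK" "a \<noteq> 0"
  obtains u v where "u \<in> OK" "v \<in> OK" "u * v = 1" "a = u * b"
proof -
  have "a \<in> (\<lambda>x. a * x) ` OK" by (rule image_eqI[of _ _ 1]) auto
  moreover have "b \<in> (\<lambda>x. b * x) ` OK" by (rule image_eqI[of _ _ 1]) auto
  ultimately have "a \<in> (\<lambda>x. b * x) ` OK" "b \<in> (\<lambda>x. a * x) ` OK" using assms(1) by simp_all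
  then obtain u v where uv: "u \<in> OK" "a = b * u" "v \<in> OK" "b = a * v" by blast
  have "a * v * u = a" using uv(2) unfolding uv(4) by (rule sym)
  hence "a * (u * v) = a * 1" by (metis mult.assoc mult.commute mult_1_right)
  hence "u * v = 1" using assms(2) mult_cancel_left by blast
  moreover have "a = u * b" using uv(2) by (metis mult.commute)
  ultimately show ?thesis using that uv(1,3) by blast
qed

end

section \<open>Relations between units and power residues\<close>

lemma rp_cnj: "rp h (cnj z) = cnj (rp h z)"
proof (induction h)
  case (pCons a h)
  have "cnj (of_rat a) = (of_rat a :: complex)"
    by (cases a) (simp add: Fract_of_int_quotient of_rat_divide)
  thus ?case using pCons by simp
qed simp

text \<open>If \<open>p\<close> did not divide \<open>r\<close>, one could write
  \<open>r x = p y + 1\<close>, and \<open>c = (c^r)^x * d^(p y)\<close> modulo \<open>Q\<close>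
  would be a \<open>p\<close>-th power, \<open>d\<close> being the inverse of
  \<open>c\<close>.\<close>

lemma not_power_residue_exponent:
  fixes c d z Q :: int and p r :: nat
  assumes "prime p" "[c * d = 1] (mod Q)" "\<And>z. \<not> [z ^ p = c] (mod Q)" "[z ^ p = c ^ r] (mod Q)"
  shows "p dvd r"
proof (rule ccontr)
  assume "\<not> p dvd r"
  hence "gcd r p = 1" using assms(1) by (metis coprime_commute coprime_iff_gcd_eq_1 prime_imp_coprime)
  moreover have "r \<noteq> 0" using \<open>\<not> p dvd r\<close> by (metis dvd_0_right)
  ultimately obtain x y where xy: "r * x = p * y + 1" using bezout_nat[of r p] by auto
  have "[(z ^ x * d ^ y) ^ p = (z ^ p) ^ x * d ^ (p * y)] (mod Q)"
    by (simp add: power_mult_distrib power_mult[symmetric] mult.commute)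
  also have "[(z ^ p) ^ x * d ^ (p * y) = (c ^ r) ^ x * d ^ (p * y)] (mod Q)"
    by (intro cong_mult cong_pow assms(4) cong_refl)
  also have "(c ^ r) ^ x * d ^ (p * y) = c * (c * d) ^ (p * y)"
    by (simp add: power_mult[symmetric] xy power_add power_mult_distrib)
  also have "[c * (c * d) ^ (p * y) = c * 1 ^ (p * y)] (mod Q)"
    by (intro cong_mult cong_pow assms(2) cong_refl)
  finally show False using assms(3) by simp
qed

lemma pigeonhole_fiber:
  assumes "finite A" "finite B" "B \<noteq> {}" "\<And>x. x \<in> A \<Longrightarrow> F x \<in> B" "Z * card B < card A"
  obtains y where "Z < card {x \<in> A. F x = y}"
proof -
  obtain y where y: "card (F -` {y} \<inter> A) * card B \<ge> card A"
    using pigeonhole_card[of F A B] assms by auto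
  hence "Z * card B < card (F -` {y} \<inter> A) * card B" using assms(5) by linarith
  hence "Z < card (F -` {y} \<inter> A)" by simp
  moreover have "F -` {y} \<inter> A = {x \<in> A. F x = y}" by auto
  ultimately show ?thesis using that by metis
qed

text \<open>The largest common power of \<open>p\<close> is split off; it exists because one entry
  is nonzero.\<close>

lemma integer_vector_primitive:
  fixes e :: "nat \<Rightarrow> int" and p :: nat
  assumes "i < m" "e i \<noteq> 0" "prime p"
  obtains k e' where "\<And>i. i < m \<Longrightarrow> e i = int (p ^ k) * e' i" "\<exists>i<m. \<not> int p dvd e' i"
proof -
  have p1: "p > 1" using assms(3) prime_gt_1_nat by blast
  define D where "D = {k. \<forall>i<m. int (p ^ k) dvd e i}"
  have b: "k \<le> nat \<bar>e i\<bar>" if "k \<in> D" for k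
  proof -
    have "int (p ^ k) dvd e i" using that assms(1) unfolding D_def by auto
    hence "\<bar>int (p ^ k)\<bar> \<le> \<bar>e i\<bar>" by (rule dvd_imp_le_int[OF assms(2)])
    hence "int (p ^ k) \<le> \<bar>e i\<bar>" by simp
    moreover have "k < p ^ k" using power_gt_expt[of p k] p1 by simp
    ultimately show ?thesis by linarith
  qed
  have fin: "finite D" using b by (intro finite_subset[of D "{..nat \<bar>e i\<bar>}"]) auto
  have "0 \<in> D" unfolding D_def by simp
  define k where "k = Max D"
  have k: "k \<in> D" unfolding k_def using fin \<open>0 \<in> D\<close> by (intro Max_in) auto
  define e' where "e' i = e i div int (p ^ k)" for i
  have e': "e i = int (p ^ k) * e' i" if "i < m" for i
    using k that unfolding D_def e'_def by (simp add: dvd_mult_div_cancel)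
  have "\<exists>i<m. \<not> int p dvd e' i"
  proof (rule ccontr)
    assume "\<not> ?thesis"
    hence "\<forall>i<m. int (p ^ Suc k) dvd e i"
      using e' by (metis mult.commute mult_dvd_mono dvd_refl of_nat_mult power_Suc)
    hence "Suc k \<in> D" unfolding D_def by simp
    thus False using Max_ge[OF fin] unfolding k_def by fastforce
  qed
  thus ?thesis using that e' by blast
qed

context number_field_poly
begin

lemma emb_cnj: "i < n \<Longrightarrow> j < n \<Longrightarrow> \<rho> j = cnj (\<rho> i) \<Longrightarrow> x \<in> K \<Longrightarrow> emb j x = cnj (emb i x)"
  by (elim K_cases) (simp add: rp_cnj)

lemma K_real: "\<theta> \<in> \<real> \<Longrightarrow> x \<in> K \<Longrightarrow> x \<in> \<real>"
proof -
  assume t: "\<theta> \<in> \<real>" and "x \<in> K"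
  then obtain h where "x = rp h \<theta>" by (elim K_cases)
  hence "cnj x = x" using rp_cnj[of h \<theta>] t by (simp add: Reals_cnj_iff)
  thus ?thesis by (simp add: Reals_cnj_iff)
qed

text \<open>Modulo the conjugation symmetry and the product formula, the logarithmic embedding of the
  units takes values in a space of dimension \<open>n - 2\<close>, while there are \<open>n - 1\<close> units.\<close>

lemma unit_relation:
  assumes n3: "n \<ge> 3" and pair: "c1 < n" "c2 < n" "c1 \<noteq> c2" "\<rho> c2 = cnj (\<rho> c1)"
    and u: "\<And>i. i < n - 1 \<Longrightarrow> u i \<in> OK" "\<And>i. i < n - 1 \<Longrightarrow> v i \<in> OK" "\<And>i. i < n - 1 \<Longrightarrow> u i * v i = 1"
  obtains x y :: "nat \<Rightarrow> nat" and i where "i < n - 1" "x i \<noteq> y i" "(\<Prod>i<n - 1. u i ^ x i) = (\<Prod>i<n - 1. u i ^ y i)"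
proof -
  have "\<exists>d. d < n \<and> d \<noteq> c1 \<and> d \<noteq> c2"
  proof (rule ccontr)
    assume "\<not> ?thesis"
    hence "{..<n} \<subseteq> {c1, c2}" by auto
    hence "card {..<n} \<le> card {c1, c2}" by (intro card_mono) auto
    thus False using n3 card_insert_le_m1[of 2 "{c2}" c1] by simp
  qed
  then obtain d where d: "d < n" "d \<noteq> c1" "d \<noteq> c2" by blast
  \<comment> \<open>The coordinate at \<open>c2\<close> repeats the one at \<open>c1\<close>, and
    the one at \<open>d\<close> is determined by the vanishing sum; \<open>n - 2\<close> coordinates
    remain.\<close>
  define T where "T = {..<n} - {c2, d}"
  have cT: "card T = n - 2" unfolding T_def using pair d by (subst card_Diff_subset) auto
  have fT: "finite T" unfolding T_def by simp
  have c1T: "c1 \<in> T" using pair d unfolding T_def by auto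
  define lg where "lg k i = ln (cmod (emb k (u i)))" for k i
  define L where "L x k = (\<Sum>i<n - 1. real (x i) * lg k i)" for x :: "nat \<Rightarrow> nat" and k
  have u0: "emb k (u i) \<noteq> 0" "u i \<noteq> 0" if "k < n" "i < n - 1" for k i
    using u(3)[OF that(2)] emb_eq_0_iff[OF that(1) OK_K[OF u(1)[OF that(2)]]] by auto
  have lgc: "lg c2 i = lg c1 i" if "i < n - 1" for i
    unfolding lg_def using emb_cnj[OF pair(1,2,4) OK_K[OF u(1)[OF that]]] by simp
  have lgsum: "(\<Sum>k<n. lg k i) = 0" if "i < n - 1" for i
  proof -
    have "(\<Sum>k<n. lg k i) = ln (\<Prod>k<n. cmod (emb k (u i)))"
      unfolding lg_def using u0 that by (subst ln_prod) auto
    thus ?thesis using unit_norm[OF u(1,2,3)[OF that]] by simp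
  qed
  have Lc: "L x c2 = L x c1" for x unfolding L_def using lgc by simp
  have Lsum: "(\<Sum>k<n. L x k) = 0" for x
    unfolding L_def by (subst sum.swap) (simp add: sum_distrib_left[symmetric] lgsum)
  obtain C :: nat where C: "(\<Sum>k<n. \<Sum>i<n - 1. \<bar>lg k i\<bar>) \<le> real C" using real_arch_simple by blast
  have Lb: "\<bar>L x k\<bar> \<le> real N * real C" if x: "\<And>i. i < n - 1 \<Longrightarrow> x i \<le> N" and k: "k < n" for x N k
  proof -
    have "\<bar>L x k\<bar> \<le> (\<Sum>i<n - 1. \<bar>real (x i) * lg k i\<bar>)" unfolding L_def by (rule sum_abs)
    also have "\<dots> \<le> (\<Sum>i<n - 1. real N * \<bar>lg k i\<bar>)"
      using x by (intro sum_mono) (auto simp: abs_mult intro!: mult_right_mono)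
    also have "\<dots> = real N * (\<Sum>i<n - 1. \<bar>lg k i\<bar>)" by (simp add: sum_distrib_left)
    also have "(\<Sum>i<n - 1. \<bar>lg k i\<bar>) \<le> (\<Sum>k<n. \<Sum>i<n - 1. \<bar>lg k i\<bar>)"
      using k by (intro member_le_sum) (auto intro: sum_nonneg)
    finally show ?thesis using C by (smt (verit) mult_left_mono of_nat_0_le_iff)
  qed
  \<comment> \<open>Two products of units whose logarithms differ by at most 1 on \<open>T\<close>
    differ by at most 1 at every embedding except \<open>d\<close>, and by at most \<open>n\<close>
    from above at \<open>d\<close>. Their quotient therefore lies in the finite set
    \<open>E\<close>.\<close>
  define E where "E = {x \<in> OK. \<forall>i<n. cmod (emb i x) \<le> exp (real n)}"
  have fE: "finite E" unfolding E_def by (rule finite_bounded_integers)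
  define Z where "Z = card E"
  \<comment> \<open>There are \<open>N^(n - 1)\<close> exponent vectors and at most
    \<open>((2C + 3)N)^(n - 2)\<close> boxes, so this \<open>N\<close> forces more than
    \<open>Z\<close> vectors into one box, more than \<open>E\<close> has room for.\<close>
  define N where "N = Suc (Z * (2 * C + 3) ^ (n - 2))"
  define A where "A = (\<Pi>\<^sub>E i\<in>{..<n - 1}. {..<N})"
  define B where "B = (\<Pi>\<^sub>E k\<in>T. {- int (N * (C + 1)) .. int (N * (C + 1))})"
  define F where "F x = restrict (\<lambda>k. \<lfloor>L x k\<rfloor>) T" for x
  have cA: "card A = N ^ (n - 1)" unfolding A_def by (simp add: card_PiE)
  have cB: "card B = (2 * N * (C + 1) + 1) ^ (n - 2)"
    unfolding B_def using fT cT by (simp add: card_PiE nat_add_distrib nat_mult_distrib algebra_simps)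
  have "Z * card B < card A"
  proof -
    have "2 * N * (C + 1) + 1 \<le> (2 * C + 3) * N" unfolding N_def by (simp add: algebra_simps)
    hence "card B \<le> (2 * C + 3) ^ (n - 2) * N ^ (n - 2)"
      unfolding cB power_mult_distrib[symmetric] by (intro power_mono) auto
    hence "Z * card B \<le> (Z * (2 * C + 3) ^ (n - 2)) * N ^ (n - 2)"
      by (metis mult.assoc mult_le_mono2)
    also have "\<dots> < N * N ^ (n - 2)" unfolding N_def by (intro mult_strict_right_mono) auto
    also have "\<dots> = card A" unfolding cA using n3 by (simp add: power_Suc[symmetric] numeral_2_eq_2 Suc_diff_Suc del: power_Suc)
    finally show ?thesis .
  qed
  moreover have "F x \<in> B" if "x \<in> A" for x
  proof -
    have "x i \<le> N" if "i < n - 1" for i using \<open>x \<in> A\<close> that unfolding A_def by (auto simp: PiE_iff less_imp_le)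
    hence b: "\<bar>L x k\<bar> \<le> real (N * C)" if "k \<in> T" for k using Lb[of x N k] that unfolding T_def by simp
    have "\<lfloor>L x k\<rfloor> \<in> {- int (N * (C + 1)) .. int (N * (C + 1))}" if "k \<in> T" for k
    proof -
      have "N * C + 1 \<le> N * (C + 1)" unfolding N_def by simp
      hence "real (N * C) + 1 \<le> real (N * (C + 1))" by (metis of_nat_1 of_nat_add of_nat_mono)
      thus ?thesis using b[OF that] by (simp add: floor_le_iff le_floor_iff) linarith
    qed
    thus ?thesis unfolding F_def B_def by auto
  qed
  moreover have "finite A" "finite B" unfolding A_def B_def using fT by (auto intro!: finite_PiE)
  moreover have "B \<noteq> {}" unfolding B_def by (auto simp: PiE_eq_empty_iff)
  ultimately obtain y where y: "Z < card {x \<in> A. F x = y}" using pigeonhole_fiber[of A B F Z] by metis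
  define H where "H = {x \<in> A. F x = y}"
  obtain x0 where x0: "x0 \<in> H" using y unfolding H_def[symmetric] by fastforce
  define pr where "pr x = (\<Prod>i<n - 1. u i ^ x i)" for x :: "nat \<Rightarrow> nat"
  define q where "q = (\<Prod>i<n - 1. v i ^ x0 i)"
  have pq: "pr x0 * q = 1" unfolding pr_def q_def using u(3)
    by (simp add: prod.distrib[symmetric] power_mult_distrib[symmetric])
  have prOK: "pr x \<in> OK" for x unfolding pr_def using u(1) by (intro OK_prod OK_closed) auto
  have qOK: "q \<in> OK" unfolding q_def using u(2) by (intro OK_prod OK_closed) auto
  have lnpr: "ln (cmod (emb k (pr x))) = L x k" "cmod (emb k (pr x)) > 0" if k: "k < n" for k x
  proof -
    have e: "cmod (emb k (pr x)) = (\<Prod>i<n - 1. cmod (emb k (u i)) ^ x i)"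
      unfolding pr_def using k u(1) by (subst emb_prod) (auto simp: prod_norm[symmetric] norm_power OK_K K_power)
    show "cmod (emb k (pr x)) > 0" unfolding e using u0 k by (intro prod_pos) auto
    show "ln (cmod (emb k (pr x))) = L x k" unfolding e L_def lg_def
      using u0 k by (subst ln_prod) (auto simp: ln_realpow intro!: sum.cong)
  qed
  have wE: "pr x * q \<in> E" if x: "x \<in> H" for x
  proof -
    have dT: "L x k - L x0 k \<le> 1 \<and> L x0 k - L x k \<le> 1" if "k \<in> T" for k
    proof -
      have "F x k = F x0 k" using x x0 unfolding H_def by simp
      hence "\<lfloor>L x k\<rfloor> = \<lfloor>L x0 k\<rfloor>" using that unfolding F_def by simp
      thus ?thesis by linarith
    qed
    hence dT': "L x k - L x0 k \<le> 1 \<and> L x0 k - L x k \<le> 1" if "k < n" "k \<noteq> d" for k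
      using that c1T by (cases "k = c2") (auto simp: Lc T_def)
    have "L x d - L x0 d = (\<Sum>k\<in>{..<n} - {d}. L x0 k - L x k)"
      using Lsum[of x] Lsum[of x0] d(1) by (simp add: sum_subtractf sum.remove[of "{..<n}" d])
    also have "\<dots> \<le> (\<Sum>k\<in>{..<n} - {d}. 1)" using dT' by (intro sum_mono) auto
    also have "\<dots> \<le> real n" using d(1) by simp
    finally have dd: "L x d - L x0 d \<le> real n" .
    have "cmod (emb k (pr x * q)) \<le> exp (real n)" if k: "k < n" for k
    proof -
      have "emb k (pr x0) * emb k q = 1" using pq k prOK qOK OK_K by (metis emb_simps(3,8))
      hence "cmod (emb k (pr x0)) * cmod (emb k q) = 1" by (metis norm_mult norm_one)
      hence q: "cmod (emb k q) = inverse (cmod (emb k (pr x0)))" by (metis inverse_unique)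
      have "cmod (emb k (pr x * q)) = cmod (emb k (pr x)) / cmod (emb k (pr x0))"
        using k prOK qOK by (simp add: OK_K norm_mult q divide_inverse)
      also have "\<dots> = exp (L x k - L x0 k)"
        using lnpr[OF k] by (simp add: exp_diff flip: lnpr(1)[OF k])
      also have "L x k - L x0 k \<le> real n" using dd dT'[OF k] n3 by (cases "k = d") auto
      finally show ?thesis by simp
    qed
    thus ?thesis unfolding E_def using prOK qOK by auto
  qed
  have "\<not> inj_on (\<lambda>x. pr x * q) H"
  proof
    assume "inj_on (\<lambda>x. pr x * q) H"
    hence "card H \<le> card E" using wE fE by (intro card_inj_on_le) auto
    thus False using y unfolding Z_def H_def by simp
  qed
  then obtain x y where xy: "x \<in> H" "y \<in> H" "x \<noteq> y" "pr x * q = pr y * q" unfolding inj_on_def by blast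
  have "q \<noteq> 0" using pq by auto
  hence pr: "pr x = pr y" using xy(4) by simp
  have "\<exists>i<n - 1. x i \<noteq> y i"
  proof (rule ccontr)
    assume "\<not> ?thesis"
    hence "x = y" using xy(1,2) unfolding H_def A_def by (intro PiE_ext[of _ "{..<n - 1}"]) auto
    thus False using xy(3) by simp
  qed
  thus ?thesis using that pr unfolding pr_def by blast
qed

text \<open>Each \<open>\<alpha> i\<close> is a unit times a \<open>p\<close>-th power, so a
  relation between the units becomes one between the \<open>\<alpha> i\<close> modulo
  \<open>p\<close>-th powers. Splitting off the common power of \<open>p\<close> from the exponents
  keeps one of them prime to \<open>p\<close>, at the price of a root of unity \<open>w\<close>,
  which is a sign because \<open>K\<close> is real.\<close>

lemma power_relation:
  assumes n3: "n \<ge> 3" and pair: "c1 < n" "c2 < n" "c1 \<noteq> c2" "\<rho> c2 = cnj (\<rho> c1)"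
    and real: "\<theta> \<in> \<real>" and p: "prime p"
    and al: "\<And>i. i < n - 1 \<Longrightarrow> \<alpha> i \<in> OK" "\<And>i. i < n - 1 \<Longrightarrow> Re (\<alpha> i) > 0"
    and be: "\<And>i. i < n - 1 \<Longrightarrow> \<beta> i \<in> OK"
      "\<And>i. i < n - 1 \<Longrightarrow> (\<lambda>x. \<alpha> i * x) ` OK = (\<lambda>x. \<beta> i ^ p * x) ` OK"
  obtains r :: "nat \<Rightarrow> nat" and \<gamma> where "\<exists>i<n - 1. \<not> p dvd r i" "\<gamma> \<in> OK" "(\<Prod>i<n - 1. \<alpha> i ^ r i) = \<gamma> ^ p"
proof -
  have al0: "\<alpha> i \<noteq> 0" if "i < n - 1" for i using al(2)[OF that] by auto
  have "\<forall>i\<in>{..<n - 1}. \<exists>uv. fst uv \<in> OK \<and> snd uv \<in> OK \<and> fst uv * snd uv = 1 \<and> \<alpha> i = fst uv * \<beta> i ^ p"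
  proof
    fix i assume "i \<in> {..<n - 1}"
    hence i: "i < n - 1" by simp
    show "\<exists>uv. fst uv \<in> OK \<and> snd uv \<in> OK \<and> fst uv * snd uv = 1 \<and> \<alpha> i = fst uv * \<beta> i ^ p"
      using principal_generators_unit[OF be(2)[OF i] al0[OF i]] by (metis fst_conv snd_conv)
  qed
  then obtain uv where "\<forall>i\<in>{..<n - 1}. fst (uv i) \<in> OK \<and> snd (uv i) \<in> OK \<and> fst (uv i) * snd (uv i) = 1 \<and> \<alpha> i = fst (uv i) * \<beta> i ^ p"
    unfolding bchoice_iff by blast
  then obtain u v where u: "\<And>i. i < n - 1 \<Longrightarrow> u i \<in> OK" "\<And>i. i < n - 1 \<Longrightarrow> v i \<in> OK"
    "\<And>i. i < n - 1 \<Longrightarrow> u i * v i = 1" "\<And>i. i < n - 1 \<Longrightarrow> \<alpha> i = u i * \<beta> i ^ p"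
    using that[of "\<lambda>i. fst (uv i)" "\<lambda>i. snd (uv i)"] by auto
  obtain x y :: "nat \<Rightarrow> nat" and i0 where xy: "i0 < n - 1" "x i0 \<noteq> y i0"
    "(\<Prod>i<n - 1. u i ^ x i) = (\<Prod>i<n - 1. u i ^ y i)"
    using unit_relation[of c1 c2 u v, OF n3 pair u(1-3)] by blast
  have u0: "u i \<noteq> 0" if "i < n - 1" for i using u(3)[OF that] by auto
  have b0: "\<beta> i \<noteq> 0" if "i < n - 1" for i using al0[OF that] u(4)[OF that] p prime_gt_0_nat by auto
  define e where "e i = int (x i) - int (y i)" for i
  have e1: "(\<Prod>i<n - 1. u i powi e i) = 1"
  proof -
    have "(\<Prod>i<n - 1. u i powi e i) = (\<Prod>i<n - 1. u i ^ x i / u i ^ y i)"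
      using u0 by (intro prod.cong) (auto simp: e_def power_int_diff)
    also have "\<dots> = 1" using xy(3) u0 by (simp add: prod_dividef)
    finally show ?thesis .
  qed
  obtain k e' where e': "\<And>i. i < n - 1 \<Longrightarrow> e i = int (p ^ k) * e' i" "\<exists>i<n - 1. \<not> int p dvd e' i"
    using integer_vector_primitive[of i0 "n - 1" e p] xy p unfolding e_def by auto
  define w where "w = (\<Prod>i<n - 1. u i powi e' i)"
  have Kpow: "u i powi m \<in> K" if "i < n - 1" for i m
    using OK_K[OF u(1)[OF that]] by (auto simp: power_int_def)
  have wK: "w \<in> K" unfolding w_def using Kpow by auto
  have "w ^ (p ^ k) = (\<Prod>i<n - 1. u i powi e i)"
    unfolding w_def prod_power_distrib using e'(1)
    by (intro prod.cong) (auto simp: power_int_mult mult.commute power_int_power')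
  hence "w ^ (p ^ k) = 1" using e1 by simp
  hence "cmod w = 1" using p prime_gt_0_nat by (metis norm_power norm_one power_eq_1_iff norm_ge_zero zero_less_power less_numeral_extra(3) power_eq_imp_eq_base power_one zero_le_one)
  hence w1: "w = 1 \<or> w = -1" using K_real[OF real wK] by (auto elim!: Reals_cases simp: abs_if split: if_splits)
  \<comment> \<open>Reducing the exponents modulo \<open>p\<close> makes them natural numbers; the
    quotients \<open>t i\<close> are absorbed into the base of the \<open>p\<close>-th
    power.\<close>
  define r where "r i = nat (e' i mod int p)" for i
  define t where "t i = e' i div int p" for i
  have p0: "int p > 0" using p prime_gt_0_nat by simp
  have rt: "int (r i) = e' i - int p * t i" for i
    unfolding r_def t_def using p0 by (simp add: minus_mult_div_eq_mod)
  define \<gamma>0 where "\<gamma>0 = (\<Prod>i<n - 1. u i powi (- t i) * \<beta> i ^ r i)"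
  have \<gamma>0K: "\<gamma>0 \<in> K" unfolding \<gamma>0_def using Kpow be(1) by (auto simp: OK_K intro!: K_prod K_mult)
  have "\<alpha> i ^ r i = u i powi e' i * (u i powi (- t i) * \<beta> i ^ r i) ^ p" if "i < n - 1" for i
  proof -
    have "u i ^ r i = u i powi (e' i - int p * t i)" by (metis power_int_of_nat rt)
    also have "\<dots> = u i powi e' i * (u i powi (- t i)) ^ p"
      using u0[OF that] by (simp add: power_int_diff power_int_minus power_inverse divide_inverse
        power_int_mult[symmetric] mult.commute power_int_power')
    finally show ?thesis unfolding u(4)[OF that]
      by (simp add: power_mult_distrib power_mult[symmetric] mult_ac)
  qed
  hence rel: "(\<Prod>i<n - 1. \<alpha> i ^ r i) = w * \<gamma>0 ^ p"
    unfolding w_def \<gamma>0_def prod_power_distrib prod.distrib[symmetric] by (intro prod.cong) auto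
  have "\<exists>\<gamma>\<in>K. (\<Prod>i<n - 1. \<alpha> i ^ r i) = \<gamma> ^ p"
  proof (cases "w = 1")
    case False
    hence w: "w = -1" using w1 by auto
    show ?thesis
    proof (cases "odd p")
      case True
      thus ?thesis using rel w \<gamma>0K by (intro bexI[of _ "- \<gamma>0"]) auto
    next
      case False
      \<comment> \<open>For odd \<open>p\<close> a sign is itself a \<open>p\<close>-th power. For
        \<open>p = 2\<close> the sign -1 is impossible: the left side is a positive real number and
        the right side minus a real square.\<close>
      hence "p = 2" using p by (metis primes_dvd_imp_eq two_is_prime_nat)
      obtain g where g: "\<gamma>0 = of_real g" using K_real[OF real \<gamma>0K] by (auto elim: Reals_cases)
      have "\<alpha> i = of_real (Re (\<alpha> i))" if "i < n - 1" for i
        using K_real[OF real OK_K[OF al(1)[OF that]]] by (auto elim: Reals_cases)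
      hence "(\<Prod>i<n - 1. \<alpha> i ^ r i) = of_real (\<Prod>i<n - 1. Re (\<alpha> i) ^ r i)"
        unfolding of_real_prod of_real_power by (intro prod.cong refl) (metis lessThan_iff)
      moreover have "w * \<gamma>0 ^ p = of_real (- (g\<^sup>2))" unfolding w g \<open>p = 2\<close> by simp
      ultimately have "complex_of_real (\<Prod>i<n - 1. Re (\<alpha> i) ^ r i) = of_real (- (g\<^sup>2))" using rel by metis
      hence "(\<Prod>i<n - 1. Re (\<alpha> i) ^ r i) = - (g\<^sup>2)" by (simp only: of_real_eq_iff)
      moreover have "(\<Prod>i<n - 1. Re (\<alpha> i) ^ r i) > 0" using al(2) by (intro prod_pos) auto
      moreover have "g\<^sup>2 \<ge> 0" by simp
      ultimately show ?thesis by linarith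
    qed
  qed (use rel \<gamma>0K in auto)
  then obtain \<gamma> where \<gamma>: "\<gamma> \<in> K" "(\<Prod>i<n - 1. \<alpha> i ^ r i) = \<gamma> ^ p" by blast
  have "(\<Prod>i<n - 1. \<alpha> i ^ r i) \<in> OK" using al(1) by (intro OK_prod OK_closed) auto
  hence "algebraic_integer (\<gamma> ^ p)" using \<gamma>(2) OK_int by simp
  hence "\<gamma> \<in> OK" using algebraic_integer_root \<gamma>(1) p prime_gt_0_nat unfolding OK_iff by blast
  moreover have "\<exists>i<n - 1. \<not> p dvd r i"
  proof -
    obtain i where i: "i < n - 1" "\<not> int p dvd e' i" using e'(2) by blast
    have "\<not> int p dvd int (r i)" unfolding r_def using i(2) p0 by (simp add: dvd_mod_iff)
    thus ?thesis using i(1) by (auto simp: int_dvd_int_iff)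
  qed
  ultimately show ?thesis using that \<gamma>(2) by blast
qed

lemma ip_zero_dvd: assumes "ip h \<theta> = 0" shows "f dvd h"
proof -
  obtain q r where qr: "pseudo_divmod h f = (q, r)" by force
  have "f \<noteq> 0" using monic_f by auto
  from pseudo_divmod[OF this qr] have h: "h = f * q + r" "r = 0 \<or> degree r < n"
    using monic_f degree_f by auto
  have "ip r \<theta> = 0" using assms ip_f_root[OF npos] unfolding h(1) \<theta>_def by (simp add: hom_distribs)
  hence "rp (map_poly of_int r) \<theta> = 0" by (simp only: rp_of_int_poly)
  hence "fq dvd map_poly of_int r" using rp_root_iff[OF npos] \<theta>_def by simp
  hence "map_poly rat_of_int r = 0" using h(2) degree_lt_dvd[of "map_poly of_int r"] by auto
  thus ?thesis using h(1) by simp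
qed

text \<open>Reduction modulo the prime \<open>(Q, \<theta> - t)\<close>, applied to \<open>f'(\<theta>) \<gamma> \<in> \<int>[\<theta>]\<close>.\<close>

lemma power_residue:
  assumes g: "\<gamma> \<in> OK" "\<gamma> ^ p = ip g \<theta>" and Q: "prime Q" "Q dvd poly f t" "\<not> Q dvd poly (pderiv f) t"
  shows "\<exists>z. [z ^ p = poly g t] (mod Q)"
proof -
  obtain h where "emb 0 \<gamma> * ip (pderiv f) (\<rho> 0) = ip h (\<rho> 0)"
    using different_multiple[OF g(1)] npos by metis
  hence "\<gamma> * ip (pderiv f) \<theta> = ip h \<theta>" using emb_0[OF OK_K[OF g(1)]] \<theta>_def by simp
  hence "ip (h ^ p - g * pderiv f ^ p) \<theta> = 0"
    by (simp add: hom_distribs g(2)[symmetric] power_mult_distrib flip: \<open>_ = ip h \<theta>\<close>)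
  hence "f dvd h ^ p - g * pderiv f ^ p" by (rule ip_zero_dvd)
  then obtain k where k: "h ^ p - g * pderiv f ^ p = f * k" by auto
  have "poly h t ^ p - poly g t * poly (pderiv f) t ^ p = poly f t * poly k t"
    using arg_cong[OF k, of "\<lambda>x. poly x t"] by simp
  hence 1: "[poly h t ^ p = poly g t * poly (pderiv f) t ^ p] (mod Q)"
    using Q(2) by (simp add: cong_iff_dvd_diff)
  have "Rings.coprime (poly (pderiv f) t) Q" using Q(1,3) by (metis coprime_commute prime_imp_coprime)
  then obtain d where d: "[poly (pderiv f) t * d = 1] (mod Q)" using cong_solve_coprime_int by blast
  have "[(poly h t * d) ^ p = poly g t * (poly (pderiv f) t * d) ^ p] (mod Q)"
    using cong_mult[OF 1 cong_refl[of "d ^ p" Q]] by (simp add: power_mult_distrib mult.assoc)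
  also have "[poly g t * (poly (pderiv f) t * d) ^ p = poly g t * 1 ^ p] (mod Q)"
    by (intro cong_mult cong_pow d cong_refl)
  finally show ?thesis by auto
qed

text \<open>The hypothesis \<open>res\<close> provides, for each \<open>p\<close> and
  \<open>i\<close>, a prime modulo which \<open>\<alpha> i\<close> becomes the non-residue
  \<open>c\<close> and the other \<open>\<alpha> j\<close> with \<open>j < n - 1\<close> become 1.
  It reads off the single exponent \<open>r i\<close> from a relation, so a \<open>p\<close>-th
  power forces \<open>p dvd r i\<close> for every \<open>i\<close>.\<close>

lemma product_family_class:
  fixes a :: "nat \<Rightarrow> int" and b :: int
  assumes n3: "n \<ge> 3" and l: "l \<ge> 1" and pair: "c1 < n" "c2 < n" "c1 \<noteq> c2" "\<rho> c2 = cnj (\<rho> c1)"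
    and real: "\<theta> \<in> \<real>" and big: "\<And>j. j < n \<Longrightarrow> real_of_int (a j) < Re \<theta>"
    and f: "f = (\<Prod>j<n. [:- a j, 1:]) - [:b ^ l:]"
    and cop: "\<And>i. i < n - 1 \<Longrightarrow> Rings.coprime (\<Prod>j\<in>{..<n} - {i}. a i - a j) b"
    and res: "\<And>p i. prime p \<Longrightarrow> p dvd l \<Longrightarrow> i < n - 1 \<Longrightarrow> \<exists>Q t c d. prime Q \<and> Q dvd poly f t \<and>
      \<not> Q dvd poly (pderiv f) t \<and> [t - a i = c] (mod Q) \<and> (\<forall>j<n - 1. j \<noteq> i \<longrightarrow> [t - a j = 1] (mod Q)) \<and>
      [c * d = 1] (mod Q) \<and> (\<forall>z. \<not> [z ^ p = c] (mod Q))"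
  shows "has_class_of_order K l"
proof -
  define \<alpha> where "\<alpha> i = \<theta> - of_int (a i)" for i
  have \<alpha>OK: "\<alpha> i \<in> OK" for i unfolding \<alpha>_def by auto
  have \<alpha>pos: "Re (\<alpha> i) > 0" if "i < n" for i unfolding \<alpha>_def using big[OF that] by simp
  have \<alpha>pos': "Re (\<alpha> i) > 0" if "i < n - 1" for i using \<alpha>pos[of i] that by simp
  have "ip f \<theta> = 0" using ip_f_root[OF npos] \<theta>_def by simp
  hence prod: "(\<Prod>j<n. \<alpha> j) = of_int (b ^ l)"
    unfolding f \<alpha>_def by (simp add: hom_distribs poly_prod of_int_hom.hom_prod of_int_poly_hom.hom_prod)
  have "\<exists>I. nz_ideal K I \<and> ideal_pow K I l = (\<lambda>x. \<alpha> i * x) ` OK" if i: "i < n - 1" for i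
  proof -
    define G where "G = (\<Prod>j\<in>{..<n} - {i}. [:- a j, 1:])"
    have G: "ip G \<theta> = (\<Prod>j\<in>{..<n} - {i}. \<alpha> j)"
      unfolding G_def \<alpha>_def by (simp add: poly_prod of_int_poly_hom.hom_prod hom_distribs)
    \<comment> \<open>This is \<open>G(\<theta>)\<close> modulo \<open>\<alpha> i\<close>. Since it
      is coprime to \<open>b^l\<close>, which equals \<open>\<alpha> i * G(\<theta>)\<close>, the
      two factors are comaximal as \<open>power_ideal\<close> requires.\<close>
    define m where "m = poly G (a i)"
    have m: "m = (\<Prod>j\<in>{..<n} - {i}. a i - a j)" unfolding m_def G_def by (simp add: poly_prod)
    have "poly (G - [:m:]) (a i) = 0" unfolding m_def by simp
    then obtain H where "G - [:m:] = [:- a i, 1:] * H" by (metis poly_eq_0_iff_dvd dvdE)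
    hence "ip (G - [:m:]) \<theta> = ip ([:- a i, 1:] * H) \<theta>" by (simp only:)
    hence GH: "ip G \<theta> = \<alpha> i * ip H \<theta> + of_int m"
      unfolding \<alpha>_def by (simp add: hom_distribs algebra_simps)
    have "Rings.coprime m (b ^ l)" using cop[OF i] m by simp
    then obtain s t where "s * m + t * b ^ l = 1"
      by (metis bezout_coefficients_fst_snd coprime_imp_gcd_eq_1)
    hence st: "of_int s * of_int m + of_int t * of_int (b ^ l) = (1 :: complex)"
      by (metis of_int_1 of_int_add of_int_mult)
    have \<alpha>G: "\<alpha> i * ip G \<theta> = of_int b ^ l"
      using prod i unfolding G by (simp add: prod.remove[of "{..<n}" i])
    have "(of_int t * ip G \<theta> - of_int s * ip H \<theta>) * \<alpha> i + of_int s * ip G \<theta> =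
        of_int t * (\<alpha> i * ip G \<theta>) + of_int s * (ip G \<theta> - \<alpha> i * ip H \<theta>)" by (simp add: algebra_simps)
    also have "\<dots> = of_int t * of_int (b ^ l) + of_int s * of_int m" unfolding \<alpha>G using GH by simp
    also have "\<dots> = 1" using st by (simp only: add.commute)
    finally have "(of_int t * ip G \<theta> - of_int s * ip H \<theta>) * \<alpha> i + of_int s * ip G \<theta> = 1" .
    moreover have "i < n" using i by simp
    hence "\<alpha> i \<noteq> 0" using \<alpha>pos[of i] by auto
    ultimately show ?thesis
      by (intro power_ideal[OF \<alpha>OK _ _ _ \<alpha>G l]) auto
  qed
  then obtain I where I: "\<And>i. i < n - 1 \<Longrightarrow> nz_ideal K (I i)"
    "\<And>i. i < n - 1 \<Longrightarrow> ideal_pow K (I i) l = (\<lambda>x. \<alpha> i * x) ` OK" by metis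
  have Iprin: "principal_ideal K (ideal_pow K (I i) l)" if "i < n - 1" for i
    unfolding principal_ideal_def I(2)[OF that] using \<alpha>OK by blast
  show ?thesis
  proof (rule ideal_class_exact_order[OF l])
    fix p assume p: "prime p" "p dvd l"
    have "\<exists>i<n - 1. \<not> principal_ideal K (ideal_pow K (I i) (l div p))"
    proof (rule ccontr)
      assume "\<not> ?thesis"
      hence "\<forall>i\<in>{..<n - 1}. \<exists>\<beta>. \<beta> \<in> OK \<and> ideal_pow K (I i) (l div p) = (\<lambda>x. \<beta> * x) ` OK"
        unfolding principal_ideal_def by blast
      then obtain \<beta> where "\<forall>i\<in>{..<n - 1}. \<beta> i \<in> OK \<and> ideal_pow K (I i) (l div p) = (\<lambda>x. \<beta> i * x) ` OK"
        unfolding bchoice_iff by blast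
      hence \<beta>: "\<And>i. i < n - 1 \<Longrightarrow> \<beta> i \<in> OK"
        "\<And>i. i < n - 1 \<Longrightarrow> ideal_pow K (I i) (l div p) = (\<lambda>x. \<beta> i * x) ` OK" by auto
      have "(\<lambda>x. \<alpha> i * x) ` OK = (\<lambda>x. \<beta> i ^ p * x) ` OK" if i: "i < n - 1" for i
      proof -
        have pw: "ideal_pow K ((\<lambda>x. \<beta> i * x) ` OK) k = (\<lambda>x. \<beta> i ^ k * x) ` OK" for k
        proof (induction k)
          case (Suc k)
          have nz: "nz_ideal K (ideal_pow K ((\<lambda>x. \<beta> i * x) ` OK) k)"
            unfolding \<beta>(2)[OF i, symmetric] by (intro nz_ideal_pow I(1) i)
          show ?case unfolding ideal_pow.simps
            using ideal_mult_principal[OF nz, of "\<beta> i"] Suc by (simp add: image_image mult.assoc)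
        qed simp
        have "(\<lambda>x. \<alpha> i * x) ` OK = ideal_pow K (ideal_pow K (I i) (l div p)) p"
          using ideal_pow_mult[OF I(1)[OF i], of "l div p" p] I(2)[OF i] p(2) by simp
        thus ?thesis unfolding \<beta>(2)[OF i] pw .
      qed
      then obtain r :: "nat \<Rightarrow> nat" and \<gamma> where r: "\<exists>i<n - 1. \<not> p dvd r i" "\<gamma> \<in> OK"
        "(\<Prod>i<n - 1. \<alpha> i ^ r i) = \<gamma> ^ p"
        using power_relation[of c1 c2 p \<alpha> \<beta>, OF n3 pair real p(1)] \<alpha>OK \<alpha>pos' \<beta>(1) by blast
      define g where "g = (\<Prod>i<n - 1. [:- a i, 1:] ^ r i)"
      have g: "\<gamma> ^ p = ip g \<theta>" unfolding r(3)[symmetric] g_def \<alpha>_def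
        by (simp add: poly_prod of_int_poly_hom.hom_prod hom_distribs)
      obtain i where i: "i < n - 1" "\<not> p dvd r i" using r(1) by blast
      obtain Q t c d where Q: "prime Q" "Q dvd poly f t" "\<not> Q dvd poly (pderiv f) t" "[t - a i = c] (mod Q)"
        "\<forall>j<n - 1. j \<noteq> i \<longrightarrow> [t - a j = 1] (mod Q)" "[c * d = 1] (mod Q)" "\<forall>z. \<not> [z ^ p = c] (mod Q)"
        using res[OF p i(1)] by blast
      obtain z where z: "[z ^ p = poly g t] (mod Q)" using power_residue[OF r(2) g Q(1-3)] by blast
      have "poly g t = (\<Prod>j<n - 1. (t - a j) ^ r j)" unfolding g_def by (simp add: poly_prod)
      also have "[(\<Prod>j<n - 1. (t - a j) ^ r j) = (\<Prod>j<n - 1. (if j = i then c else 1) ^ r j)] (mod Q)"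
        using Q(4,5) by (intro cong_prod cong_pow) auto
      also have "(\<Prod>j<n - 1. (if j = i then c else 1) ^ r j) = (\<Prod>j<n - 1. if j = i then c ^ r i else 1)"
        by (intro prod.cong) auto
      also have "\<dots> = c ^ r i" using i(1) by simp
      finally have "[z ^ p = c ^ r i] (mod Q)" using z cong_trans by blast
      thus False using not_power_residue_exponent[OF p(1) Q(6)] Q(7) i(2) by blast
    qed
    thus "\<exists>I. nz_ideal K I \<and> principal_ideal K (ideal_pow K I l) \<and> \<not> principal_ideal K (ideal_pow K I (l div p))"
      using I(1) Iprin by blast
  qed
qed

end

section \<open>Counting isomorphism classes\<close>

lemma number_field_poly_exists:
  fixes f :: "int poly"
  assumes "n > 0" "degree f = n" "lead_coeff f = 1" "irreducible (map_poly rat_of_int f)" "ip f z = 0"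
  obtains \<rho> where "number_field_poly f n \<rho>" "\<rho> 0 = z"
proof -
  obtain as where as: "smult (lead_coeff (map_poly of_int f)) (\<Prod>a\<leftarrow>as. [:- a, 1:]) = (map_poly of_int f :: complex poly)"
    "length as = degree (map_poly of_int f :: complex poly)"
    using fundamental_theorem_algebra_factorized by blast
  have len: "length as = n" using as(2) assms(2) by simp
  have "(map_poly of_int f :: complex poly) = (\<Prod>a\<leftarrow>as. [:- a, 1:])" using as(1) assms(3) by simp
  also have "\<dots> = (\<Prod>i<n. [:- (as ! i), 1:])"
    using len by (simp add: prod.list_conv_set_nth atLeast0LessThan)
  finally have f: "(map_poly of_int f :: complex poly) = (\<Prod>i<n. [:- (as ! i), 1:])" .
  have "(\<Prod>i<n. z - as ! i) = 0" using assms(5) unfolding f by (simp add: poly_prod)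
  then obtain k where k: "k < n" "as ! k = z" by auto
  \<comment> \<open>The transposition moves the prescribed root to index 0, where the locale expects
    the generator.\<close>
  define \<rho> where "\<rho> i = as ! (Transposition.transpose 0 k i)" for i
  have "Transposition.transpose 0 k permutes {..<n}" using k assms(1) by (intro permutes_swap_id) auto
  hence "(\<Prod>i<n. [:- \<rho> i, 1:]) = (\<Prod>i<n. [:- (as ! i), 1:])"
    unfolding \<rho>_def using prod.permute[of "Transposition.transpose 0 k" "{..<n}" "\<lambda>i. [:- (as ! i), 1:]"]
    by (simp add: o_def)
  hence "number_field_poly f n \<rho>" using assms f by unfold_locales auto
  moreover have "\<rho> 0 = z" unfolding \<rho>_def using k by simp
  ultimately show ?thesis using that by blast
qed

lemma (in number_field_poly) minimal_polynomial_unique: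
  assumes "number_field_poly g n \<rho>'" "ip f t = 0" "ip g t = 0" shows "f = g"
proof -
  interpret g: number_field_poly g n \<rho>' by fact
  obtain i where i: "i < n" "t = \<rho> i" using root_cases[OF assms(2)] by blast
  have "rp (map_poly of_int g) (\<rho> i) = 0" using assms(3) i(2) by (simp add: rp_of_int_poly)
  hence "fq dvd map_poly of_int g" using rp_root_iff[OF i(1)] by blast
  then obtain k where k: "map_poly rat_of_int g = fq * k" by auto
  have "map_poly rat_of_int g \<noteq> 0" using g.irr by auto
  hence "fq \<noteq> 0" "k \<noteq> 0" using k by auto
  hence "degree k = 0" using arg_cong[OF k, of degree] degree_fq g.degree_fq by (simp add: degree_mult_eq)
  then obtain c where c: "k = [:c:]" by (rule degree_eq_zeroE)
  have "lead_coeff (map_poly rat_of_int g) = lead_coeff fq * c" unfolding k c by simp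
  hence "c = 1" using monic_f g.monic_f by simp
  hence "map_poly rat_of_int g = map_poly rat_of_int f" using k c by simp
  thus ?thesis by (simp add: of_int_poly_hom.eq_iff)
qed

lemma subfield_CD:
  assumes "subfield_C K"
  shows "0 \<in> K" "1 \<in> K" "x \<in> K \<Longrightarrow> y \<in> K \<Longrightarrow> x + y \<in> K" "x \<in> K \<Longrightarrow> y \<in> K \<Longrightarrow> x * y \<in> K"
    "x \<in> K \<Longrightarrow> - x \<in> K"
  using assms unfolding subfield_C_def by auto

lemma subfield_of_int: assumes "subfield_C K" shows "of_int m \<in> K"
proof -
  note K = subfield_CD[OF assms]
  have nat: "of_nat k \<in> K" for k by (induction k) (auto intro: K)
  show ?thesis
  proof (cases "m \<ge> 0")
    case True
    thus ?thesis using nat[of "nat m"] by simp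
  next
    case False
    thus ?thesis using K(5)[OF nat[of "nat (- m)"]] by simp
  qed
qed

lemma fields_isomorphic_sym:
  assumes "fields_isomorphic K L" "subfield_C K"
  shows "fields_isomorphic L K"
proof -
  obtain \<phi> where \<phi>: "bij_betw \<phi> K L" "\<And>x y. x \<in> K \<Longrightarrow> y \<in> K \<Longrightarrow> \<phi> (x + y) = \<phi> x + \<phi> y \<and> \<phi> (x * y) = \<phi> x * \<phi> y"
    using assms(1) unfolding fields_isomorphic_def by auto
  define \<psi> where "\<psi> = inv_into K \<phi>"
  have \<psi>: "\<psi> y \<in> K" "\<phi> (\<psi> y) = y" if "y \<in> L" for y
    using \<phi>(1) that unfolding \<psi>_def bij_betw_def by (auto simp: inv_into_into f_inv_into_f)
  have \<psi>\<phi>: "\<psi> (\<phi> x) = x" if "x \<in> K" for x using \<phi>(1) that unfolding \<psi>_def bij_betw_def by simp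
  have "\<psi> (x + y) = \<psi> x + \<psi> y" "\<psi> (x * y) = \<psi> x * \<psi> y" if "x \<in> L" "y \<in> L" for x y
    using \<phi>(2)[of "\<psi> x" "\<psi> y"] \<psi>[OF that(1)] \<psi>[OF that(2)] subfield_CD(3,4)[OF assms(2)] \<psi>\<phi> by metis+
  moreover have "bij_betw \<psi> L K" unfolding \<psi>_def by (rule bij_betw_inv_into[OF \<phi>(1)])
  ultimately show ?thesis unfolding fields_isomorphic_def by blast
qed

lemma fields_isomorphic_refl: "fields_isomorphic K K"
  unfolding fields_isomorphic_def by (intro exI[of _ id]) auto

lemma fields_isomorphic_root:
  assumes iso: "fields_isomorphic K L" and K: "subfield_C K" and L: "subfield_C L" and x: "x \<in> K" "ip p x = 0"
  obtains y where "y \<in> L" "ip p y = 0"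
proof -
  note KD = subfield_CD[OF K]
  obtain \<phi> where \<phi>: "bij_betw \<phi> K L" "\<And>x y. x \<in> K \<Longrightarrow> y \<in> K \<Longrightarrow> \<phi> (x + y) = \<phi> x + \<phi> y"
    "\<And>x y. x \<in> K \<Longrightarrow> y \<in> K \<Longrightarrow> \<phi> (x * y) = \<phi> x * \<phi> y"
    using iso unfolding fields_isomorphic_def by auto
  have p0: "\<phi> 0 = 0" using \<phi>(2)[of 0 0] KD(1) by simp
  \<comment> \<open>Isomorphisms are not defined to preserve 1; it is mapped to a nonzero idempotent
    of a field.\<close>
  have "\<phi> 1 \<noteq> \<phi> 0" using \<phi>(1) KD(1,2) unfolding bij_betw_def inj_on_def by fastforce
  moreover have "\<phi> 1 * \<phi> 1 = \<phi> 1" using \<phi>(3)[of 1 1] KD(2) by simp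
  ultimately have p1: "\<phi> 1 = 1" using p0 by simp
  have pnat: "\<phi> (of_nat k) = of_nat k" for k
  proof (induction k)
    case (Suc k)
    have "of_nat k \<in> K" using subfield_of_int[OF K, of "int k"] by simp
    thus ?case using \<phi>(2)[of 1 "of_nat k"] p1 Suc KD(2) by simp
  qed (use p0 in simp)
  have pint: "\<phi> (of_int m) = of_int m" for m
  proof (cases "m \<ge> 0")
    case True
    thus ?thesis using pnat[of "nat m"] by simp
  next
    case False
    have "\<phi> (of_int m + of_int (- m)) = \<phi> (of_int m) + \<phi> (of_int (- m))"
      by (rule \<phi>(2)[OF subfield_of_int[OF K] subfield_of_int[OF K]])
    moreover have "\<phi> (of_int (- m)) = - of_int m" using pnat[of "nat (- m)"] False by simp
    ultimately have "\<phi> (of_int m) + - of_int m = 0" using p0 by simp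
    thus ?thesis by simp
  qed
  have "ip q x \<in> K \<and> \<phi> (ip q x) = ip q (\<phi> x)" for q
  proof (induction q)
    case (pCons c q)
    thus ?case using x(1) subfield_of_int[OF K] KD(3,4) \<phi>(2,3) pint by (simp add: hom_distribs)
  qed (use p0 KD(1) in simp)
  hence "ip p (\<phi> x) = 0" using x(2) p0 by metis
  moreover have "\<phi> x \<in> L" using \<phi>(1) x(1) unfolding bij_betw_def by auto
  ultimately show ?thesis using that by blast
qed

text \<open>If the roots of all polynomials of the family are labelled by nearby points of a fixed
  finite set, then two members generating the same field with the same labels in all embeddings
  differ by an algebraic integer all of whose conjugates are small.\<close>

lemma many_nonisomorphic_fields:
  fixes F :: "'a \<Rightarrow> int poly" and R :: "'a \<Rightarrow> nat \<Rightarrow> complex" and c :: "'w \<Rightarrow> complex"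
  assumes fin: "finite A" and inj: "inj_on F A" and nf: "\<And>a. a \<in> A \<Longrightarrow> number_field_poly (F a) n (R a)"
    and fin\<Omega>: "finite \<Omega>"
    and near: "\<And>a z. a \<in> A \<Longrightarrow> ip (F a) z = 0 \<Longrightarrow> \<exists>\<omega>\<in>\<Omega>. cmod (z - c \<omega>) < 1 / 2"
  obtains S where "S \<subseteq> (\<lambda>a. number_field_poly.K (R a)) ` A"
    "\<forall>K\<in>S. \<forall>L\<in>S. K \<noteq> L \<longrightarrow> \<not> fields_isomorphic K L"
    "card A \<le> card S * card \<Omega> ^ n"
proof -
  define Kf where "Kf a = number_field_poly.K (R a)" for a
  have sf: "subfield_C (Kf a)" if "a \<in> A" for a
    unfolding Kf_def using number_field_poly.subfield[OF nf[OF that]] .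
  define good where "good S \<longleftrightarrow> S \<subseteq> Kf ` A \<and> (\<forall>K\<in>S. \<forall>L\<in>S. K \<noteq> L \<longrightarrow> \<not> fields_isomorphic K L)" for S
  have finK: "finite (Kf ` A)" using fin by simp
  have "{S. good S} \<subseteq> Pow (Kf ` A)" by (auto simp: good_def)
  hence "finite {S. good S}" using finK by (meson finite_Pow_iff finite_subset)
  moreover have "{S. good S} \<noteq> {}" by (auto simp: good_def intro: exI[of _ "{}"])
  \<comment> \<open>A set of maximal size among the pairwise non-isomorphic ones: by maximality
    every field of the family is isomorphic to a member.\<close>
  ultimately obtain S where S: "good S" "\<And>S'. good S' \<Longrightarrow> card S' \<le> card S"
    using obtains_MAX[of "{S. good S}" card] by (metis (no_types, lifting) Max_ge finite_imageI imageI mem_Collect_eq)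
  have finS: "finite S" using S(1) finK unfolding good_def by (meson finite_subset)
  have cover: "\<exists>L\<in>S. fields_isomorphic (Kf a) L" if a: "a \<in> A" for a
  proof (rule ccontr)
    assume no: "\<not> (\<exists>L\<in>S. fields_isomorphic (Kf a) L)"
    hence "Kf a \<notin> S" using fields_isomorphic_refl by blast
    have "\<not> fields_isomorphic L (Kf a)" if "L \<in> S" for L
      using that no S(1) sf fields_isomorphic_sym unfolding good_def by blast
    hence "good (insert (Kf a) S)" using S(1) no a unfolding good_def by auto
    from S(2)[OF this] \<open>Kf a \<notin> S\<close> finS show False by simp
  qed
  have fiber: "card {a \<in> A. fields_isomorphic (Kf a) L} \<le> card \<Omega> ^ n" if L: "L \<in> S" for L
  proof -
    obtain a0 where a0: "a0 \<in> A" "L = Kf a0" using L S(1) unfolding good_def by auto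
    interpret N: number_field_poly "F a0" n "R a0" using nf[OF a0(1)] .
    have LK: "L = N.K" using a0 unfolding Kf_def by simp
    define D where "D = {a \<in> A. fields_isomorphic (Kf a) L}"
    have "\<exists>t\<in>L. ip (F a) t = 0" if "a \<in> D" for a
    proof -
      interpret Na: number_field_poly "F a" n "R a" using nf that unfolding D_def by auto
      have "ip (F a) Na.\<theta> = 0" using Na.ip_f_root[OF Na.npos] Na.\<theta>_def by simp
      thus ?thesis
        using fields_isomorphic_root[of "Kf a" L Na.\<theta> "F a"] sf that a0 Na.theta_in_K
        unfolding D_def Kf_def by blast
    qed
    then obtain t where t: "\<And>a. a \<in> D \<Longrightarrow> t a \<in> L" "\<And>a. a \<in> D \<Longrightarrow> ip (F a) (t a) = 0" by metis
    have tOK: "t a \<in> N.OK" if "a \<in> D" for a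
    proof -
      interpret Na: number_field_poly "F a" n "R a" using nf that unfolding D_def by auto
      show ?thesis using t[OF that] Na.monic_f unfolding N.OK_iff LK algebraic_integer_def by blast
    qed
    have "\<exists>\<omega>\<in>\<Omega>. cmod (N.emb i (t a) - c \<omega>) < 1 / 2" if "a \<in> D" "i < n" for a i
      using near[of a "N.emb i (t a)"] N.emb_ip[OF that(2), of "t a" "F a"] t[OF that(1)] that LK
      unfolding D_def by simp
    then obtain lb where lb: "\<And>a i. a \<in> D \<Longrightarrow> i < n \<Longrightarrow> lb a i \<in> \<Omega> \<and> cmod (N.emb i (t a) - c (lb a i)) < 1 / 2"
      by metis
    define lab where "lab a = restrict (lb a) {..<n}" for a
    have "inj_on lab D"
    proof (rule inj_onI)
      fix a b assume ab: "a \<in> D" "b \<in> D" "lab a = lab b"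
      have "cmod (N.emb i (t a - t b)) < 1" if "i < n" for i
      proof -
        have "lb a i = lb b i" using fun_cong[OF ab(3), of i] that unfolding lab_def by simp
        hence "cmod (N.emb i (t a) - c (lb a i)) < 1 / 2" "cmod (N.emb i (t b) - c (lb a i)) < 1 / 2"
          using lb[OF ab(1) that] lb[OF ab(2) that] by auto
        hence "cmod ((N.emb i (t a) - c (lb a i)) - (N.emb i (t b) - c (lb a i))) < 1"
          using norm_triangle_ineq4[of "N.emb i (t a) - c (lb a i)" "N.emb i (t b) - c (lb a i)"] by linarith
        thus ?thesis using that t ab LK by simp
      qed
      hence "t a - t b = 0" using tOK[OF ab(1)] tOK[OF ab(2)] by (intro N.small_integer_zero) auto
      hence "t a = t b" by simp
      hence "F a = F b"
        using number_field_poly.minimal_polynomial_unique[OF nf nf, of a b "t a"] t(2)[OF ab(1)] t(2)[OF ab(2)] ab(1,2)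
        unfolding D_def by auto
      thus "a = b" using inj ab unfolding D_def inj_on_def by auto
    qed
    moreover have "lab a \<in> (\<Pi>\<^sub>E i\<in>{..<n}. \<Omega>)" if "a \<in> D" for a
      unfolding lab_def using lb[OF that] by (simp add: restrict_PiE_iff)
    hence "lab ` D \<subseteq> (\<Pi>\<^sub>E i\<in>{..<n}. \<Omega>)" by blast
    moreover have "finite (\<Pi>\<^sub>E i\<in>{..<n}. \<Omega>)" using fin\<Omega> by (intro finite_PiE) auto
    ultimately have "card D \<le> card (\<Pi>\<^sub>E i\<in>{..<n}. \<Omega>)" by (rule card_inj_on_le)
    thus ?thesis unfolding D_def by (simp add: card_PiE)
  qed
  have "A = (\<Union>L\<in>S. {a \<in> A. fields_isomorphic (Kf a) L})" using cover by auto
  hence "card A \<le> (\<Sum>L\<in>S. card {a \<in> A. fields_isomorphic (Kf a) L})"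
    using card_UN_le[OF finS] by metis
  also have "\<dots> \<le> (\<Sum>L\<in>S. card \<Omega> ^ n)" by (intro sum_mono fiber)
  also have "\<dots> = card S * card \<Omega> ^ n" by simp
  finally show ?thesis using that[of S] S(1) unfolding good_def Kf_def by auto
qed

section \<open>Estimates for products and roots near 1, and symmetric functions of roots\<close>

lemma prod_one_plus_first_order:
  fixes z :: "nat \<Rightarrow> complex"
  assumes "0 \<le> \<epsilon>" "\<epsilon> \<le> 1" "\<And>i. i < d \<Longrightarrow> cmod (z i) \<le> \<epsilon>"
  shows "cmod ((\<Prod>i<d. 1 + z i) - 1) \<le> (2 ^ d - 1) * \<epsilon>"
  using assms(3)
proof (induction d)
  case (Suc d)
  let ?P = "\<Prod>i<d. 1 + z i"
  have IH: "cmod (?P - 1) \<le> (2 ^ d - 1) * \<epsilon>" using Suc by auto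
  have "(\<Prod>i<Suc d. 1 + z i) - 1 = (?P - 1) + (?P - 1) * z d + z d" by (simp add: algebra_simps)
  hence "cmod ((\<Prod>i<Suc d. 1 + z i) - 1) \<le> cmod (?P - 1) + cmod (?P - 1) * cmod (z d) + cmod (z d)"
    by (metis norm_mult norm_triangle_mono norm_triangle_ineq order_refl)
  also have "\<dots> \<le> (2 ^ d - 1) * \<epsilon> + (2 ^ d - 1) * \<epsilon> * 1 + \<epsilon>"
    using IH Suc.prems[of d] assms(1,2) by (intro add_mono mult_mono) auto
  also have "\<dots> = (2 ^ Suc d - 1) * \<epsilon>" by (simp add: algebra_simps)
  finally show ?case .
qed simp

lemma prod_one_plus_second_order:
  fixes z :: "nat \<Rightarrow> complex"
  assumes "0 \<le> \<epsilon>" "\<epsilon> \<le> 1" "\<And>i. i < d \<Longrightarrow> cmod (z i) \<le> \<epsilon>"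
  shows "cmod ((\<Prod>i<d. 1 + z i) - 1 - (\<Sum>i<d. z i)) \<le> 4 ^ d * \<epsilon>\<^sup>2"
  using assms(3)
proof (induction d)
  case (Suc d)
  let ?P = "\<Prod>i<d. 1 + z i"
  have IH: "cmod (?P - 1 - (\<Sum>i<d. z i)) \<le> 4 ^ d * \<epsilon>\<^sup>2" using Suc by auto
  have 1: "cmod (?P - 1) \<le> (2 ^ d - 1) * \<epsilon>" 
    by (rule prod_one_plus_first_order[OF assms(1,2)]) (use Suc.prems in auto)
  have "(\<Prod>i<Suc d. 1 + z i) - 1 - (\<Sum>i<Suc d. z i) = (?P - 1 - (\<Sum>i<d. z i)) + (?P - 1) * z d"
    by (simp add: algebra_simps)
  hence "cmod ((\<Prod>i<Suc d. 1 + z i) - 1 - (\<Sum>i<Suc d. z i)) \<le>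
      cmod (?P - 1 - (\<Sum>i<d. z i)) + cmod (?P - 1) * cmod (z d)"
    by (metis norm_mult norm_triangle_ineq)
  also have "\<dots> \<le> 4 ^ d * \<epsilon>\<^sup>2 + (2 ^ d - 1) * \<epsilon> * \<epsilon>"
    using IH 1 Suc.prems[of d] assms(1,2) by (intro add_mono mult_mono) auto
  also have "(2 ^ d - 1) * \<epsilon> * \<epsilon> \<le> 4 ^ d * \<epsilon>\<^sup>2"
  proof -
    have "(2::real) ^ d - 1 \<le> 4 ^ d" using power_mono[of 2 "4::real" d] by simp
    thus ?thesis by (simp add: power2_eq_square mult.assoc mult_right_mono)
  qed
  also have "4 ^ d * \<epsilon>\<^sup>2 + 4 ^ d * \<epsilon>\<^sup>2 \<le> 4 ^ Suc d * \<epsilon>\<^sup>2" by simp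
  finally show ?case by simp
qed (simp add: assms)

text \<open>Let \<open>s\<close> be the principal root. As \<open>1 + \<delta>\<close> lies in the
  right half plane, so do the powers \<open>s^k\<close> with \<open>k < n\<close>, up to the
  boundary; hence \<open>1 + s + ... + s^(n - 1)\<close> has absolute value at least 1, and its
  product with \<open>s - 1\<close> is \<open>\<delta>\<close>.\<close>

lemma root_near_1:
  assumes "cmod \<delta> < 1" "n > 0"
  obtains s where "s ^ n = 1 + \<delta>" "cmod (s - 1) \<le> cmod \<delta>"
proof -
  define r where "r = cmod (1 + \<delta>)"
  define \<phi> where "\<phi> = Arg (1 + \<delta>)"
  have rc: "1 + \<delta> = rcis r \<phi>" unfolding r_def \<phi>_def by (simp add: rcis_cmod_Arg)
  have "\<bar>Re \<delta>\<bar> < 1" using assms(1) abs_Re_le_cmod[of \<delta>] by linarith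
  hence "Re (1 + \<delta>) > 0" by simp
  hence rcos: "r * cos \<phi> > 0" unfolding rc by simp
  have r0: "r \<ge> 0" unfolding r_def by simp
  have cpos: "cos \<phi> > 0" using rcos r0 by (simp add: zero_less_mult_iff)
  have b: "- pi < \<phi>" "\<phi> \<le> pi" unfolding \<phi>_def using Arg_bounded by auto
  have \<phi>: "\<bar>\<phi>\<bar> \<le> pi / 2"
  proof (rule ccontr)
    assume "\<not> ?thesis"
    hence "pi / 2 \<le> \<bar>\<phi>\<bar>" by simp
    hence "cos \<bar>\<phi>\<bar> \<le> cos (pi / 2)" using b by (intro cos_monotone_0_pi_le) auto
    hence "cos \<phi> \<le> 0" by (auto simp: abs_if split: if_splits)
    thus False using cpos by simp
  qed
  define s where "s = rcis (root n r) (\<phi> / real n)"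
  have sk: "s ^ k = rcis (root n r ^ k) (real k * (\<phi> / real n))" for k
    unfolding s_def by (rule DeMoivre2)
  have sn: "s ^ n = 1 + \<delta>" unfolding sk rc using assms(2) r0 by simp
  have "Re (s ^ k) \<ge> 0" if "k < n" for k
  proof -
    have "\<bar>real k * (\<phi> / real n)\<bar> = (real k / real n) * \<bar>\<phi>\<bar>" by (simp add: abs_mult)
    also have "\<dots> \<le> 1 * \<bar>\<phi>\<bar>" using that by (intro mult_right_mono) auto
    finally have "cos (real k * (\<phi> / real n)) \<ge> 0" using \<phi> by (intro cos_ge_zero) linarith+
    thus ?thesis unfolding sk using real_root_ge_zero[OF r0, of n] by simp
  qed
  hence "Re (\<Sum>k<n. s ^ k) \<ge> (\<Sum>k<n. if k = 0 then 1 else 0)"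
    unfolding Re_sum by (intro sum_mono) auto
  hence "Re (\<Sum>k<n. s ^ k) \<ge> 1" using assms(2) by simp
  hence ge1: "cmod (\<Sum>k<n. s ^ k) \<ge> 1" using complex_Re_le_cmod order_trans by blast
  have "\<delta> = s ^ n - 1" using sn by simp
  also have "\<dots> = (s - 1) * (\<Sum>k<n. s ^ k)" by (rule power_diff_1_eq)
  finally have "cmod \<delta> = cmod (s - 1) * cmod (\<Sum>k<n. s ^ k)" by (simp add: norm_mult)
  moreover have "cmod (s - 1) * 1 \<le> cmod (s - 1) * cmod (\<Sum>k<n. s ^ k)" using ge1 by (intro mult_left_mono) auto
  ultimately show ?thesis using that[OF sn] by simp
qed

text \<open>With \<open>s\<close> the root of \<open>z^n\<close> close to 1, take
  \<open>\<omega> = z / s\<close>; then \<open>z - \<omega> = \<omega> (s - 1)\<close>.\<close>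

lemma near_root_of_unity:
  assumes "cmod (z ^ n - 1) < 1" "n > 0"
  obtains \<omega> where "\<omega> ^ n = 1" "cmod (z - \<omega>) \<le> cmod (z ^ n - 1)"
proof -
  obtain s where s: "s ^ n = 1 + (z ^ n - 1)" "cmod (s - 1) \<le> cmod (z ^ n - 1)"
    using root_near_1[OF assms] by blast
  show ?thesis
  proof (cases "s = 0")
    case True
    hence zn: "z ^ n = 0" using s(1) assms(2) by (simp add: zero_power)
    have "cmod (z ^ n - 1) = 1" unfolding zn by simp
    thus ?thesis using assms(1) by linarith
  next
    case False
    have "z ^ n = s ^ n" using s(1) by simp
    hence w: "(z / s) ^ n = 1" using False by (simp only: power_divide) simp
    have "cmod (z / s) = 1" using assms(2) power_eq_1_iff[OF w] by simp
    have "z - z / s = (z / s) * (s - 1)" using False by (simp add: field_simps)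
    hence "cmod (z - z / s) = cmod (z / s) * cmod (s - 1)" by (simp only: norm_mult)
    hence "cmod (z - z / s) \<le> cmod (z ^ n - 1)" using s(2) \<open>cmod (z / s) = 1\<close> by simp
    thus ?thesis using that w by blast
  qed
qed

text \<open>The two coefficients below the leading one determine the sum of the roots and the sum of
  their squares; this is how non-real roots are detected later.\<close>

lemma prod_coeffs:
  fixes x :: "nat \<Rightarrow> 'a :: comm_ring_1"
  shows "coeff (\<Prod>i<Suc m. [:- x i, 1:]) m = - (\<Sum>i<Suc m. x i)"
    and "2 * coeff (\<Prod>i<Suc (Suc m). [:- x i, 1:]) m = (\<Sum>i<Suc (Suc m). x i)\<^sup>2 - (\<Sum>i<Suc (Suc m). (x i)\<^sup>2)"
proof -
  have step: "coeff (p * [:c, 1:]) (Suc k) = c * coeff p (Suc k) + coeff p k" "coeff (p * [:c, 1:]) 0 = c * coeff p 0"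
    for p :: "'a poly" and c k
    by (simp_all add: mult.commute[of p] coeff_pCons)
  have top: "coeff (\<Prod>i<m. [:- x i, 1:]) m = 1" for m
    using degree_prod_monic[of m "\<lambda>i. [:- x i, 1:]"] by (simp add: atLeast0LessThan)
  have 1: "coeff (\<Prod>i<Suc m. [:- x i, 1:]) m = - (\<Sum>i<Suc m. x i)" for m
  proof (induction m)
    case (Suc m)
    have "coeff (\<Prod>i<Suc (Suc m). [:- x i, 1:]) (Suc m) =
        - x (Suc m) * coeff (\<Prod>i<Suc m. [:- x i, 1:]) (Suc m) + coeff (\<Prod>i<Suc m. [:- x i, 1:]) m"
      by (subst prod.lessThan_Suc) (rule step)
    thus ?case using Suc top[of "Suc m"] by simp
  qed simp
  show "coeff (\<Prod>i<Suc m. [:- x i, 1:]) m = - (\<Sum>i<Suc m. x i)" by (rule 1)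
  show "2 * coeff (\<Prod>i<Suc (Suc m). [:- x i, 1:]) m = (\<Sum>i<Suc (Suc m). x i)\<^sup>2 - (\<Sum>i<Suc (Suc m). (x i)\<^sup>2)"
  proof (induction m)
    case 0
    show ?case by (simp add: power2_eq_square algebra_simps)
  next
    case (Suc m)
    define p where "p = (\<Prod>i<Suc (Suc m). [:- x i, 1:])"
    define S1 where "S1 = (\<Sum>i<Suc (Suc m). x i)"
    define S2 where "S2 = (\<Sum>i<Suc (Suc m). (x i)\<^sup>2)"
    have "coeff (p * [:- x (Suc (Suc m)), 1:]) (Suc m) = - x (Suc (Suc m)) * coeff p (Suc m) + coeff p m"
      by (rule step)
    moreover have "coeff p (Suc m) = - S1" unfolding p_def S1_def by (rule 1)
    moreover have "2 * coeff p m = S1\<^sup>2 - S2" using Suc unfolding p_def S1_def S2_def .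
    ultimately have "2 * coeff (p * [:- x (Suc (Suc m)), 1:]) (Suc m) =
        (S1 + x (Suc (Suc m)))\<^sup>2 - (S2 + (x (Suc (Suc m)))\<^sup>2)"
      by (simp only: distrib_left) (simp add: power2_eq_square algebra_simps)
    also have "p * [:- x (Suc (Suc m)), 1:] = (\<Prod>i<Suc (Suc (Suc m)). [:- x i, 1:])"
      unfolding p_def by (rule prod.lessThan_Suc[symmetric])
    also have "S1 + x (Suc (Suc m)) = (\<Sum>i<Suc (Suc (Suc m)). x i)"
      unfolding S1_def by (rule sum.lessThan_Suc[symmetric])
    also have "S2 + (x (Suc (Suc m)))\<^sup>2 = (\<Sum>i<Suc (Suc (Suc m)). (x i)\<^sup>2)"
      unfolding S2_def by (rule sum.lessThan_Suc[symmetric])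
    finally show ?case .
  qed
qed

section \<open>The polynomials\<close>

lemma prod_distance_pinched:
  fixes z :: complex and w :: "nat \<Rightarrow> complex"
  assumes "n > 0" "B > 0" "\<And>j. j < n \<Longrightarrow> cmod (w j) \<le> A" "cmod (\<Prod>j<n. z - w j) = B ^ n"
  shows "B - A \<le> cmod z" "cmod z \<le> B + A"
proof -
  have pr: "(\<Prod>j<n. cmod (z - w j)) = B ^ n" using assms(4) by (simp add: prod_norm)
  show "B - A \<le> cmod z"
  proof (rule ccontr)
    assume *: "\<not> B - A \<le> cmod z"
    have A0: "A \<ge> 0" using assms(3)[OF assms(1)] norm_ge_zero order_trans by blast
    have "(\<Prod>j<n. cmod (z - w j)) \<le> (\<Prod>j<n. cmod z + A)"
      using assms(3) norm_triangle_ineq4[of z] by (intro prod_mono) (smt (verit) lessThan_iff norm_ge_zero)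
    also have "\<dots> = (cmod z + A) ^ n" by simp
    also have "\<dots> < B ^ n" using * A0 assms(1) by (intro power_strict_mono) auto
    finally show False using pr by simp
  qed
  show "cmod z \<le> B + A"
  proof (rule ccontr)
    assume *: "\<not> cmod z \<le> B + A"
    have "B ^ n < (cmod z - A) ^ n" using * assms(1,2) by (intro power_strict_mono) auto
    also have "\<dots> = (\<Prod>j<n. cmod z - A)" by simp
    also have "\<dots> \<le> (\<Prod>j<n. cmod (z - w j))"
      using * assms(2,3) norm_triangle_ineq2[of z] by (intro prod_mono) (smt (verit) lessThan_iff)
    finally show False using pr by simp
  qed
qed

text \<open>Up to sign both numbers are powers of \<open>q\<close>, and distinct powers differ by a
  factor of at least 2, which a quotient strictly between 1/2 and 3/2 excludes together with
  opposite signs.\<close>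

lemma prime_power_close_imp_eq:
  fixes u v :: int and q :: nat
  assumes q: "prime q" and u: "u dvd int q ^ N" and v: "v dvd int q ^ N"
    and close: "\<bar>real_of_int u / real_of_int v - 1\<bar> < 1 / 2"
  shows "u = v"
proof -
  have pw: "\<exists>e. \<bar>x\<bar> = int q ^ e" if "x dvd int q ^ N" for x :: int
  proof -
    have "nat \<bar>x\<bar> dvd q ^ N" using that by (metis abs_dvd_iff int_dvd_int_iff nat_0_le abs_ge_zero of_nat_power)
    then obtain e where "nat \<bar>x\<bar> = q ^ e" using q divides_primepow_nat by blast
    hence "\<bar>x\<bar> = int q ^ e" by (metis abs_ge_zero nat_0_le of_nat_power)
    thus ?thesis ..
  qed
  obtain e e' where e: "\<bar>u\<bar> = int q ^ e" "\<bar>v\<bar> = int q ^ e'" using pw u v by metis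
  have q2: "q \<ge> 2" using q prime_ge_2_nat by blast
  have less: "2 * int q ^ i \<le> int q ^ j" if "i < j" for i j
  proof -
    have "int q ^ Suc i \<le> int q ^ j" using that q2 by (intro power_increasing) auto
    moreover have "2 * int q ^ i \<le> int q * int q ^ i" using q2 by (intro mult_right_mono) auto
    ultimately show ?thesis by simp
  qed
  have v0: "real_of_int \<bar>v\<bar> > 0" unfolding e using q2 by simp
  have r: "real_of_int u / real_of_int v > 1 / 2" "real_of_int u / real_of_int v < 3 / 2"
    using close unfolding abs_less_iff by linarith+
  have ab: "real_of_int \<bar>u\<bar> / real_of_int \<bar>v\<bar> = real_of_int u / real_of_int v"
  proof -
    have "real_of_int \<bar>u\<bar> / real_of_int \<bar>v\<bar> = \<bar>real_of_int u / real_of_int v\<bar>" by simp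
    also have "\<dots> = real_of_int u / real_of_int v" using r(1) by (intro abs_of_pos) linarith
    finally show ?thesis .
  qed
  have "2 * \<bar>u\<bar> > \<bar>v\<bar>" "2 * \<bar>u\<bar> < 3 * \<bar>v\<bar>"
    using r v0 unfolding ab[symmetric] by (simp_all add: divide_less_eq less_divide_eq flip: of_int_less_iff[where 'a = real])
  hence "\<not> e < e'" "\<not> e' < e" using less[of e e'] less[of e' e] unfolding e by auto
  hence "\<bar>u\<bar> = \<bar>v\<bar>" unfolding e by simp
  moreover have "u \<noteq> - v"
  proof
    assume "u = - v"
    hence "real_of_int u / real_of_int v = - 1" using v0 by simp
    thus False using r(1) by simp
  qed
  ultimately show ?thesis by linarith
qed

text \<open>Takes the place of Gauss's lemma: the roots of \<open>g\<close> are roots of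
  \<open>f\<close>, so values of \<open>g\<close> at integers are rational algebraic
  integers.\<close>

lemma monic_factor_values:
  fixes f :: "int poly" and g h :: "rat poly"
  assumes "map_poly rat_of_int f = g * h" "lead_coeff g = 1" and monic_f: "lead_coeff f = 1"
  obtains y where "\<And>x. rp g x = (\<Prod>m<degree g. x - y m)" "\<And>m. m < degree g \<Longrightarrow> ip f (y m) = 0"
    "\<And>m :: int. \<exists>v :: int. poly g (of_int m) = of_int v"
proof -
  let ?G = "map_poly of_rat g :: complex poly"
  obtain as where as: "smult (lead_coeff ?G) (\<Prod>a\<leftarrow>as. [:- a, 1:]) = ?G" "length as = degree ?G"
    using fundamental_theorem_algebra_factorized by blast
  have len: "length as = degree g" using as(2) by simp
  have "?G = (\<Prod>a\<leftarrow>as. [:- a, 1:])" using as(1) assms(2) by simp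
  also have "\<dots> = (\<Prod>m<degree g. [:- (as ! m), 1:])"
    using len by (simp add: prod.list_conv_set_nth atLeast0LessThan)
  finally have G: "rp g x = (\<Prod>m<degree g. x - as ! m)" for x unfolding rp_def by (simp add: poly_prod)
  have root: "ip f (as ! m) = 0" if "m < degree g" for m
  proof -
    have "rp g (as ! m) = 0" unfolding G using that by (intro prod_zero) auto
    hence "rp (map_poly of_int f) (as ! m) = 0" unfolding assms(1) by simp
    thus ?thesis by (simp only: rp_of_int_poly)
  qed
  have "\<exists>v :: int. poly g (of_int m) = of_int v" for m :: int
  proof -
    have "algebraic_integer (as ! i)" if "i < degree g" for i
      unfolding algebraic_integer_def using root[OF that] monic_f by blast
    hence "algebraic_integer (rp g (of_int m))"
      unfolding G by (intro algebraic_integer_prod algebraic_integer_diff) auto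
    moreover have rg: "rp g (of_int m) = of_rat (poly g (of_int m))"
      unfolding rp_def using of_rat_hom.poly_map_poly[of g "of_int m"] by simp
    ultimately obtain v :: int where "of_rat (poly g (of_int m)) = (of_int v :: complex)"
      using algebraic_integer_rational[of "rp g (of_int m)"] by (metis Rats_of_rat)
    hence "(of_rat (poly g (of_int m)) :: complex) = of_rat (of_int v)" by simp
    thus ?thesis by (metis of_rat_eq_iff)
  qed
  thus ?thesis using that G root by blast
qed

lemma irreducible_by_monic_factors:
  fixes f :: "int poly"
  assumes n: "degree f = n" "n > 0"
    and triv: "\<And>g h. map_poly rat_of_int f = g * h \<Longrightarrow> lead_coeff g = 1 \<Longrightarrow> degree g < n \<Longrightarrow> degree g = 0"
  shows "irreducible (map_poly rat_of_int f)"
proof (rule irreducibleI)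
  have d: "degree (map_poly rat_of_int f) = n" using n by simp
  thus "map_poly rat_of_int f \<noteq> 0" using n(2) by auto
  show "\<not> map_poly rat_of_int f dvd 1" using d n(2) is_unit_iff_degree[of "map_poly rat_of_int f"] by force
  fix g h assume gh: "map_poly rat_of_int f = g * h"
  hence nz: "g \<noteq> 0" "h \<noteq> 0" using d n(2) by auto
  have dg: "degree g + degree h = n" using arg_cong[OF gh, of degree] d nz by (simp add: degree_mult_eq)
  show "g dvd 1 \<or> h dvd 1"
  proof (cases "degree h = 0")
    case True
    thus ?thesis using nz by (simp add: is_unit_iff_degree)
  next
    case False
    define c where "c = lead_coeff g"
    have c0: "c \<noteq> 0" unfolding c_def using nz by simp
    have "map_poly rat_of_int f = smult (inverse c) g * smult c h" using gh c0 by simp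
    moreover have "lead_coeff (smult (inverse c) g) = 1" using c0 unfolding c_def by simp
    moreover have "degree (smult (inverse c) g) < n" using dg False c0 by simp
    ultimately have "degree (smult (inverse c) g) = 0" by (rule triv)
    thus ?thesis using nz c0 by (simp add: is_unit_iff_degree)
  qed
qed

text \<open>Here \<open>b = q^k\<close> and \<open>B\<close> is the real \<open>n\<close>-th root of
  \<open>b^l\<close>. The bound \<open>big\<close> is quadratic in \<open>A\<close> because
  \<open>sum0\<close> removes the linear term in the position of the roots; irreducibility needs
  only its linear consequence in \<open>B_large\<close>.\<close>

locale product_family =
  fixes n l k q :: nat and a :: "nat \<Rightarrow> int" and A B :: real
  assumes n3: "n \<ge> 3" and q: "prime q" and bnd: "\<And>j. j < n \<Longrightarrow> \<bar>real_of_int (a j)\<bar> \<le> A"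
    and A1: "A \<ge> 1" and B: "B > 0" "B ^ n = real q ^ (k * l)" and big: "64 * 4 ^ n * A\<^sup>2 \<le> B"
    and inj: "inj_on a {..<n}" and sum0: "(\<Sum>j<n. a j) = 0"
begin

definition f :: "int poly" where "f = (\<Prod>j<n. [:- a j, 1:]) - [:(int q ^ k) ^ l:]"

lemma B_large: "64 * 4 ^ n * A \<le> B" "B \<ge> 4096 * A"
proof -
  have "64 * 4 ^ n * A \<le> 64 * 4 ^ n * A\<^sup>2" using A1 by (simp add: power2_eq_square)
  thus 1: "64 * 4 ^ n * A \<le> B" using big by linarith
  have "(4::real) ^ 3 \<le> 4 ^ n" using n3 by (intro power_increasing) auto
  hence "4096 * A \<le> 64 * 4 ^ n * A" using A1 by simp
  thus "B \<ge> 4096 * A" using 1 by linarith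
qed

lemma monic_product: "degree (\<Prod>j<n. [:- a j, 1:]) = n" "lead_coeff (\<Prod>j<n. [:- a j, 1:]) = 1"
  using degree_prod_monic[of n "\<lambda>j. [:- a j, 1:]"] by (auto simp: atLeast0LessThan)

lemma degree_f: "degree f = n" and monic_f: "lead_coeff f = 1"
proof -
  have d: "degree [:(int q ^ k) ^ l:] < degree (\<Prod>j<n. [:- a j, 1:])" unfolding monic_product using n3 by simp
  show df: "degree f = n" unfolding f_def using degree_add_eq_left[of "- [:(int q ^ k) ^ l:]" "\<Prod>j<n. [:- a j, 1:]"] d monic_product
    by (simp only: diff_conv_add_uminus degree_minus)
  show "lead_coeff f = 1" unfolding df unfolding f_def using monic_product d by (simp add: coeff_eq_0)
qed

lemma ip_f: "ip f z = (\<Prod>j<n. z - of_int (a j)) - of_real (B ^ n)"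
  unfolding f_def by (simp add: hom_distribs poly_prod of_int_poly_hom.hom_prod B(2) power_mult)

lemma root_bounds:
  assumes "ip f z = 0" shows "B - A \<le> cmod z" "cmod z \<le> B + A"
proof -
  have "cmod (\<Prod>j<n. z - of_int (a j)) = B ^ n" using assms B(1) unfolding ip_f by (simp add: norm_power)
  thus "B - A \<le> cmod z" "cmod z \<le> B + A"
    using prod_distance_pinched[of n B "\<lambda>j. of_int (a j)" A z] n3 B(1) bnd by auto
qed

lemma root_near_center:
  assumes "ip f z = 0"
  shows "\<exists>\<omega>\<in>{\<omega>. \<omega> ^ n = 1}. cmod (z - of_real B * \<omega>) < 1 / 2"
proof -
  have zB: "cmod z \<ge> B / 2" "cmod z \<le> 2 * B" using root_bounds[OF assms] B_large A1 by auto
  hence z0: "z \<noteq> 0" using B(1) by auto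
  \<comment> \<open>Every root has absolute value at least \<open>B / 2\<close>, so the quotients
    \<open>a j / z\<close> are bounded by this.\<close>
  define \<epsilon> where "\<epsilon> = 2 * A / B"
  have \<epsilon>: "0 \<le> \<epsilon>" "\<epsilon> \<le> 1" unfolding \<epsilon>_def using A1 B(1) B_large by (auto simp: divide_le_eq)
  have zb: "cmod (- of_int (a j) / z) \<le> \<epsilon>" if "j < n" for j
  proof -
    have "cmod (- of_int (a j) / z) = \<bar>real_of_int (a j)\<bar> / cmod z" by (simp add: norm_divide)
    also have "\<dots> \<le> A / (B / 2)" using bnd[OF that] zB(1) B(1) A1 by (intro frac_le) auto
    finally show ?thesis unfolding \<epsilon>_def by (simp add: mult.commute)
  qed
  note so = prod_one_plus_second_order[of \<epsilon> n "\<lambda>j. - of_int (a j) / z", OF \<epsilon> zb]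
  have "(\<Sum>j<n. - of_int (a j) / z) = - of_int (\<Sum>j<n. a j) / z"
    by (simp add: sum_divide_distrib sum_negf)
  hence s0: "(\<Sum>j<n. - of_int (a j) / z) = 0" using sum0 by simp
  have "(\<Prod>j<n. 1 + - of_int (a j) / z) = (\<Prod>j<n. (z - of_int (a j)) / z)"
    using z0 by (intro prod.cong) (auto simp: field_simps)
  also have "\<dots> = of_real (B ^ n) / z ^ n" using assms unfolding ip_f by (simp add: prod_dividef)
  also have "\<dots> = (of_real B / z) ^ n" by (simp add: power_divide)
  finally have d: "cmod ((of_real B / z) ^ n - 1) \<le> 4 ^ n * \<epsilon>\<^sup>2" using so unfolding s0 by simp
  \<comment> \<open>The relative error is made so small that it stays below 1/2 after multiplication
    by \<open>cmod z\<close>, which is at most \<open>2 B\<close>.\<close>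
  have eB: "4 ^ n * \<epsilon>\<^sup>2 \<le> 1 / (16 * B)"
  proof -
    have "4 ^ n * \<epsilon>\<^sup>2 = (64 * 4 ^ n * A\<^sup>2) / (16 * B\<^sup>2)" unfolding \<epsilon>_def by (simp add: power_divide)
    also have "\<dots> \<le> B / (16 * B\<^sup>2)" using big B(1) by (intro divide_right_mono) auto
    also have "\<dots> = 1 / (16 * B)" using B(1) by (simp add: power2_eq_square)
    finally show ?thesis .
  qed
  have "1 / (16 * B) < 1" using B_large A1 by (simp add: divide_less_eq)
  hence "cmod ((of_real B / z) ^ n - 1) < 1" using d eB by linarith
  then obtain \<omega> where \<omega>: "\<omega> ^ n = 1" "cmod (of_real B / z - \<omega>) \<le> cmod ((of_real B / z) ^ n - 1)"
    using near_root_of_unity[of "of_real B / z" n] n3 by auto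
  have w1: "cmod \<omega> = 1" using n3 power_eq_1_iff[OF \<omega>(1)] by simp
  hence w0: "\<omega> \<noteq> 0" by auto
  \<comment> \<open>The estimate concerned \<open>B / z\<close>, so the root of unity near
    \<open>z / B\<close> is the inverse of \<open>\<omega>\<close>.\<close>
  have "z - of_real B * inverse \<omega> = - (z / \<omega>) * (of_real B / z - \<omega>)" using z0 w0 by (simp add: field_simps)
  hence "cmod (z - of_real B * inverse \<omega>) = cmod z * cmod (of_real B / z - \<omega>)"
    using w1 by (simp add: norm_mult norm_divide)
  also have "\<dots> \<le> (2 * B) * (1 / (16 * B))" using zB(2) \<omega>(2) d eB B(1) by (intro mult_mono) auto
  also have "\<dots> < 1 / 2" using B(1) by simp
  finally have "cmod (z - of_real B * inverse \<omega>) < 1 / 2" .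
  moreover have "inverse \<omega> ^ n = 1" using \<omega>(1) by (simp add: power_inverse)
  ultimately show ?thesis by blast
qed

text \<open>Each value \<open>g(a j)\<close> of a monic factor \<open>g\<close> is, up to sign, a power of \<open>q\<close>, and any two of
  them have quotient close to \<open>1\<close>, hence are equal.\<close>

lemma monic_factor_trivial:
  fixes g h :: "rat poly"
  assumes gh: "map_poly rat_of_int f = g * h" "lead_coeff g = 1" and deg: "degree g < n"
  shows "degree g = 0"
proof -
  have lh: "lead_coeff h = 1"
    using arg_cong[OF gh(1), of lead_coeff] gh(2) monic_f by (simp add: lead_coeff_mult)
  obtain y where y: "\<And>x. rp g x = (\<Prod>m<degree g. x - y m)" "\<And>m. m < degree g \<Longrightarrow> ip f (y m) = 0"
    "\<And>m :: int. \<exists>v :: int. poly g (of_int m) = of_int v"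
    using monic_factor_values[OF gh monic_f] by metis
  have hv: "\<exists>v :: int. poly h (of_int m) = of_int v" for m :: int
    using monic_factor_values[of f h g] gh(1) lh monic_f by (metis mult.commute)
  obtain u where u: "\<And>m :: int. poly g (of_int m) = of_int (u m)" using y(3) by metis
  obtain v where v: "\<And>m :: int. poly h (of_int m) = of_int (v m)" using hv by metis
  have dvd: "u (a i) dvd int q ^ (k * l)" if "i < n" for i
  proof -
    have "(\<Prod>j<n. poly [:- a j, 1:] (a i)) = 0" using that by (intro prod_zero) auto
    hence fa: "poly f (a i) = - (int q ^ (k * l))" unfolding f_def by (simp add: poly_prod power_mult)
    have "rat_of_int (poly f (a i)) = poly (map_poly of_int f) (of_int (a i))" by simp
    also have "\<dots> = of_int (u (a i) * v (a i))" unfolding gh(1) using u v by simp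
    finally have "- (int q ^ (k * l)) = u (a i) * v (a i)" unfolding fa by (simp only: of_int_eq_iff)
    thus ?thesis by (metis dvd_minus_iff dvd_triv_left)
  qed
  have ua: "u (a i) = u (a 0)" if i: "i < n" for i
  proof (rule prime_power_close_imp_eq[OF q dvd[OF i] dvd])
    show "0 < n" using n3 by simp
    \<comment> \<open>Two of the \<open>a j\<close> differ by at most \<open>2 A\<close>, and
      \<open>a 0\<close> has distance at least \<open>B / 2\<close> from the roots.\<close>
    define \<epsilon> where "\<epsilon> = 4 * A / B"
    have \<epsilon>: "0 \<le> \<epsilon>" "\<epsilon> \<le> 1" unfolding \<epsilon>_def using A1 B(1) B_large by (auto simp: divide_le_eq)
    have far: "cmod (of_int (a 0) - y m) \<ge> B / 2" if "m < degree g" for m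
    proof -
      have "cmod (y m) \<ge> B - A" using root_bounds y(2)[OF that] by blast
      moreover have "cmod (of_int (a 0)) \<le> A" using bnd[of 0] n3 by simp
      ultimately show ?thesis using norm_triangle_ineq2[of "y m" "of_int (a 0)"] B_large A1
        by (simp add: norm_minus_commute)
    qed
    have ne: "of_int (a 0) - y m \<noteq> 0" if "m < degree g" for m using far[OF that] B(1) by auto
    have uc: "of_int (u m) = (\<Prod>i<degree g. of_int m - y i)" for m
    proof -
      have "rp g (of_int m) = of_rat (poly g (of_int m))"
        unfolding rp_def using of_rat_hom.poly_map_poly[of g "of_int m"] by simp
      thus ?thesis unfolding y(1) u by simp
    qed
    define z where "z m = of_int (a i - a 0) / (of_int (a 0) - y m)" for m
    have zb: "cmod (z m) \<le> \<epsilon>" if "m < degree g" for m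
    proof -
      have "cmod (z m) = \<bar>real_of_int (a i) - real_of_int (a 0)\<bar> / cmod (of_int (a 0) - y m)"
        unfolding z_def norm_divide by (metis norm_of_int of_int_abs of_int_diff)
      also have "\<dots> \<le> (2 * A) / (B / 2)"
        using bnd[OF i] bnd[of 0] n3 far[OF that] B(1) A1 by (intro frac_le) (auto simp: abs_le_iff)
      finally show ?thesis unfolding \<epsilon>_def by (simp add: mult.commute)
    qed
    have "of_int (u (a i)) / of_int (u (a 0)) = (\<Prod>m<degree g. 1 + z m)"
      unfolding uc z_def prod_dividef[symmetric] using ne
      by (intro prod.cong) (auto simp: field_simps)
    hence "complex_of_real (real_of_int (u (a i)) / real_of_int (u (a 0)) - 1) = (\<Prod>m<degree g. 1 + z m) - 1"
      by simp
    hence "\<bar>real_of_int (u (a i)) / real_of_int (u (a 0)) - 1\<bar> = cmod ((\<Prod>m<degree g. 1 + z m) - 1)"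
      by (metis norm_of_real)
    also have "\<dots> \<le> (2 ^ degree g - 1) * \<epsilon>" by (rule prod_one_plus_first_order[OF \<epsilon> zb])
    also have "\<dots> \<le> 4 ^ n * \<epsilon>"
    proof -
      have "(2::real) ^ degree g \<le> 2 ^ n" using deg by (intro power_increasing) auto
      also have "(2::real) ^ n \<le> 4 ^ n" by (intro power_mono) auto
      finally show ?thesis using \<epsilon>(1) by (intro mult_right_mono) auto
    qed
    also have "\<dots> = (64 * 4 ^ n * A) / (16 * B)" unfolding \<epsilon>_def by simp
    also have "\<dots> \<le> B / (16 * B)" using B_large B(1) by (intro divide_right_mono) auto
    also have "\<dots> < 1 / 2" using B(1) by simp
    finally show "\<bar>real_of_int (u (a i)) / real_of_int (u (a 0)) - 1\<bar> < 1 / 2" .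
  qed
  \<comment> \<open>A polynomial of degree below \<open>n\<close> with equal values at
    \<open>n\<close> distinct points is constant.\<close>
  have "poly g (of_int (a i)) = poly [:of_int (u (a 0)):] (of_int (a i))" if "i < n" for i
    unfolding u ua[OF that] by simp
  moreover have "inj_on (\<lambda>i. rat_of_int (a i)) {..<n}" using inj by (auto simp: inj_on_def)
  ultimately have "g = [:of_int (u (a 0)):]"
    using deg n3 by (intro poly_eqI_degree[of "(\<lambda>i. rat_of_int (a i)) ` {..<n}"]) (auto simp: card_image)
  thus ?thesis by simp
qed

lemma irreducible_f: "irreducible (map_poly rat_of_int f)"
  using irreducible_by_monic_factors[of f n] degree_f n3 monic_factor_trivial by auto

lemma real_root: obtains t :: real where "ip f (of_real t) = 0" "\<And>j. j < n \<Longrightarrow> real_of_int (a j) < t"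
proof -
  define F where "F x = (\<Prod>j<n. x - real_of_int (a j)) - B ^ n" for x
  have fin: "finite (a ` {..<n})" "a ` {..<n} \<noteq> {}" using n3 by (auto simp: lessThan_empty_iff)
  define M where "M = Max (a ` {..<n})"
  have M: "a j \<le> M" if "j < n" for j unfolding M_def using that fin by (intro Max_ge) auto
  obtain j0 where j0: "j0 < n" "a j0 = M" using Max_in[OF fin] unfolding M_def by auto
  have B1: "B \<ge> 1" using B_large A1 by simp
  have p0: "(\<Prod>j<n. real_of_int M - real_of_int (a j)) = 0" using j0 by (intro prod_zero) auto
  have F0: "F (of_int M) < 0" unfolding F_def p0 using B(1) by simp
  have "(\<Prod>j<n. B) \<le> (\<Prod>j<n. of_int M + B - real_of_int (a j))"
    using M B(1) by (intro prod_mono) auto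
  hence F1: "F (of_int M + B) \<ge> 0" unfolding F_def by simp
  have "continuous_on {of_int M..of_int M + B} F" unfolding F_def by (intro continuous_intros)
  then obtain t where t: "of_int M \<le> t" "t \<le> of_int M + B" "F t = 0"
    using IVT'[of F "of_int M" 0 "of_int M + B"] F0 F1 B(1) by auto
  hence "t \<noteq> of_int M" using F0 by auto
  hence "of_int M < t" using t(1) by simp
  moreover have "ip f (of_real t) = of_real (F t)" unfolding ip_f F_def by simp
  ultimately show ?thesis using that[of t] t(3) M by (metis of_int_le_iff order_le_less_trans of_real_0)
qed

text \<open>For \<open>n \<ge> 3\<close> the polynomial shares its three leading coefficients with
  the product of the \<open>X - a j\<close>, so the sum of the squares of its roots is that of the
  \<open>a j\<close>, at most \<open>n A^2\<close>. If all roots were real, each would be at most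
  \<open>n A\<close>, whereas their absolute values are at least \<open>B - A\<close>.\<close>

lemma complex_conjugate_roots:
  assumes "number_field_poly f n \<rho>"
  obtains c1 c2 where "c1 < n" "c2 < n" "c1 \<noteq> c2" "\<rho> c2 = cnj (\<rho> c1)"
proof -
  interpret N: number_field_poly f n \<rho> by fact
  have "\<exists>i<n. \<rho> i \<notin> \<real>"
  proof (rule ccontr)
    assume "\<not> ?thesis"
    hence real: "\<rho> i \<in> \<real>" if "i < n" for i using that by blast
    obtain m where m: "n = Suc (Suc m)" "m \<ge> 1" using n3 by (metis Suc_diff_Suc Suc_le_lessD add_leD2 diff_Suc_1 less_Suc_eq_le
      numeral_3_eq_3 Suc_le_D Suc_le_mono One_nat_def)
    have eq: "(\<Prod>i<n. [:- \<rho> i, 1:]) = (\<Prod>i<n. [:- of_int (a i), 1:]) - [:of_real (B ^ n):]"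
      unfolding N.roots[symmetric] f_def
      by (simp add: hom_distribs of_int_poly_hom.hom_prod B(2) power_mult)
    have co: "coeff (\<Prod>i<n. [:- \<rho> i, 1:]) j = coeff (\<Prod>i<n. [:- of_int (a i), 1:]) j" if "j \<ge> 1" for j
      unfolding eq using that by (simp add: coeff_pCons split: nat.splits)
    have s1: "(\<Sum>i<n. \<rho> i) = (\<Sum>i<n. of_int (a i))"
      using co[of "Suc m"] prod_coeffs(1)[of \<rho> "Suc m"] prod_coeffs(1)[of "\<lambda>i. of_int (a i) :: complex" "Suc m"]
      unfolding m(1) by (metis le_add1 neg_equal_iff_equal plus_1_eq_Suc)
    have "(\<Sum>i<n. \<rho> i)\<^sup>2 - (\<Sum>i<n. (\<rho> i)\<^sup>2) = (\<Sum>i<n. of_int (a i))\<^sup>2 - (\<Sum>i<n. (of_int (a i))\<^sup>2)"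
      using co[OF m(2)] prod_coeffs(2)[of \<rho> m] prod_coeffs(2)[of "\<lambda>i. of_int (a i) :: complex" m]
      unfolding m(1) by metis
    hence s2: "(\<Sum>i<n. (\<rho> i)\<^sup>2) = (\<Sum>i<n. (of_int (a i))\<^sup>2)" using s1 by simp
    have re: "\<rho> i = of_real (Re (\<rho> i))" if "i < n" for i using real[OF that] by (auto elim: Reals_cases)
    have "complex_of_real (\<Sum>i<n. (Re (\<rho> i))\<^sup>2) = (\<Sum>i<n. (\<rho> i)\<^sup>2)"
      unfolding of_real_sum of_real_power by (intro sum.cong refl) (metis lessThan_iff re)
    also have "\<dots> = complex_of_real (\<Sum>i<n. (real_of_int (a i))\<^sup>2)" unfolding s2 by simp
    finally have rs: "(\<Sum>i<n. (Re (\<rho> i))\<^sup>2) = (\<Sum>i<n. (real_of_int (a i))\<^sup>2)" by (simp only: of_real_eq_iff)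
    have "(cmod (\<rho> 0))\<^sup>2 = (Re (\<rho> 0))\<^sup>2" using re[of 0] n3 by (metis norm_of_real power2_abs N.npos)
    also have "\<dots> \<le> (\<Sum>i<n. (Re (\<rho> i))\<^sup>2)" using N.npos by (intro member_le_sum) auto
    also have "\<dots> \<le> (\<Sum>i<n. A\<^sup>2)" unfolding rs using bnd
      by (intro sum_mono) (metis lessThan_iff power2_abs power_mono abs_ge_zero)
    also have "\<dots> = real n * A\<^sup>2" by simp
    also have "\<dots> \<le> (real n * A)\<^sup>2" using n3 A1 by (simp add: power2_eq_square mult_mono)
    finally have "cmod (\<rho> 0) \<le> real n * A" using A1 by (simp add: power2_le_iff_abs_le)
    moreover have "cmod (\<rho> 0) \<ge> B - A" using root_bounds[OF N.ip_f_root[OF N.npos]] by blast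
    moreover have "real n * A + A < B"
    proof -
      have "real n < 2 ^ n" by (rule of_nat_less_two_power)
      also have "(2 :: real) ^ n \<le> 4 ^ n" by (intro power_mono) auto
      finally have "real n + 1 < 64 * 4 ^ n" using one_le_power[of "4::real" n] by linarith
      hence "(real n + 1) * A < (64 * 4 ^ n) * A" using A1 by (intro mult_strict_right_mono) auto
      thus ?thesis using B_large(1) by (simp add: distrib_right)
    qed
    ultimately show False by linarith
  qed
  then obtain i where i: "i < n" "\<rho> i \<notin> \<real>" by blast
  have "rp (map_poly of_int f) (cnj (\<rho> i)) = 0"
    unfolding rp_cnj using N.ip_f_root[OF i(1)] by (simp add: rp_of_int_poly)
  hence "ip f (cnj (\<rho> i)) = 0" by (simp only: rp_of_int_poly)
  then obtain j where "j < n" "cnj (\<rho> i) = \<rho> j" using N.root_cases by blast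
  moreover from this have "i \<noteq> j" using i(2) by (metis Reals_cnj_iff)
  ultimately show ?thesis using that[of i j] i(1) by auto
qed

end

section \<open>Auxiliary primes\<close>

text \<open>A prime divisor \<open>Q\<close> of the cyclotomic value
  \<open>1 + x + ... + x^(p - 1)\<close> with \<open>x = p * fact N\<close> does not divide
  \<open>x\<close>, so it exceeds \<open>N\<close> and is not \<open>p\<close>. Modulo
  \<open>Q\<close> the order of \<open>x\<close> divides \<open>p\<close>; it is not 1, since
  otherwise the value would be congruent to \<open>p\<close>.\<close>

lemma prime_congruent_1:
  fixes p N :: nat
  assumes p: "prime p"
  obtains Q where "prime Q" "Q > N" "p dvd Q - 1"
proof -
  define x where "x = p * fact N"
  define s where "s = (\<Sum>i<p. x ^ i)"
  have p2: "p \<ge> 2" using p prime_ge_2_nat by blast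
  have x2: "x \<ge> 2" unfolding x_def using p2 mult_le_mono[OF p2 fact_ge_1[of N]] by simp
  obtain p' where p': "p = Suc p'" using p2 by (metis Suc_le_D numeral_2_eq_2)
  have s: "s = 1 + x * (\<Sum>i<p'. x ^ i)" unfolding s_def p' sum.lessThan_Suc_shift by (simp add: sum_distrib_left)
  have "(\<Sum>i<p'. x ^ i) \<ge> 1" using p2 x2 p' member_le_sum[of 0 "{..<p'}" "\<lambda>i. x ^ i"] by simp
  hence "x * (\<Sum>i<p'. x ^ i) \<ge> 2 * 1" using x2 by (intro mult_le_mono)
  hence "s \<noteq> 1" unfolding s by linarith
  then obtain Q where Q: "prime Q" "Q dvd s" using prime_factor_nat by blast
  have Qx: "\<not> Q dvd x"
  proof
    assume "Q dvd x"
    hence "Q dvd 1" using Q(2) unfolding s by (meson dvd_add_left_iff dvd_mult2)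
    thus False using Q(1) by simp
  qed
  have QN: "Q > N"
  proof (rule ccontr)
    assume "\<not> Q > N"
    hence "Q dvd fact N" using prime_ge_1_nat[OF Q(1)] by (intro dvd_fact) auto
    thus False using Qx unfolding x_def by simp
  qed
  have cop: "Rings.coprime Q x" using Q(1) Qx by (rule prime_imp_coprime)
  have "(int x - 1) * int s = int x ^ p - 1"
    unfolding s_def using power_diff_1_eq[of "int x" p] by simp
  hence "int Q dvd int (x ^ p) - int 1" using Q(2) by (metis dvd_mult int_dvd_int_iff of_nat_1 of_nat_power)
  hence "[x ^ p = 1] (mod Q)" by (metis cong_iff_dvd_diff cong_int_iff)
  hence "ord Q x dvd p" by (simp only: ord_divides)
  moreover have "ord Q x \<noteq> 1"
  proof
    assume "ord Q x = 1"
    hence "[x ^ 1 = 1] (mod Q)" by (simp only: ord_divides dvd_refl)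
    hence "[x ^ i = 1 ^ i] (mod Q)" for i by (intro cong_pow) simp
    hence "[s = (\<Sum>i<p. 1)] (mod Q)" unfolding s_def by (intro cong_sum) simp
    hence "Q dvd p" using Q(2) by (simp add: cong_dvd_iff)
    thus False using Qx unfolding x_def by simp
  qed
  ultimately have "ord Q x = p" using p by (metis prime_nat_iff)
  hence "p dvd Q - 1" using order_divides_totient[OF cop] totient_prime[OF Q(1)] by simp
  thus ?thesis using that Q(1) QN by blast
qed

text \<open>Among three non-residues at least one avoids the two roots of \<open>c\<^sup>2 + s c + 1\<close> modulo \<open>Q\<close>.\<close>

lemma prime_with_nonresidue:
  fixes p N :: nat and s :: int
  assumes p: "prime p"
  obtains Q :: nat and c d :: int where "prime Q" "Q > N" "[c * d = 1] (mod int Q)"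
    "\<And>z. \<not> [z ^ p = c] (mod int Q)" "\<not> int Q dvd s + c + d"
proof -
  \<comment> \<open>The margin keeps the exponents \<open>1 + j p\<close> with
    \<open>j \<le> 2\<close> below \<open>Q - 1\<close>, the order of \<open>g\<close>. So the three
    powers are distinct, and the subtraction in \<open>d j\<close> is not truncated.\<close>
  obtain Q where Q: "prime Q" "Q > N + 3 * p + 3" "p dvd Q - 1" using prime_congruent_1[OF p] by blast
  obtain g where g: "residue_primroot Q g" using prime_primitive_root_exists[of Q] Q(1) prime_gt_1_nat by blast
  have cop: "Rings.coprime Q g" and ordg: "ord Q g = Q - 1"
    using g Q(1) by (auto simp: residue_primroot_def totient_prime)
  define h where "h = (Q - 1) div p"
  have h: "Q - 1 = p * h" unfolding h_def using Q(3) by simp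
  have h0: "h > 0" using h Q(2) by (cases h) auto
  have p2: "p \<ge> 2" using p prime_ge_2_nat by blast
  \<comment> \<open>Exponents congruent to 1 modulo \<open>p\<close>, a divisor of
    \<open>Q - 1\<close>, so no such power of the primitive root \<open>g\<close> is a
    \<open>p\<close>-th power.\<close>
  define c where "c j = int g ^ (1 + j * p)" for j
  define d where "d j = int g ^ (Q - 1 - (1 + j * p))" for j
  have small: "1 + j * p < Q - 1" if "j \<le> 2" for j
    using Q(2) mult_le_mono1[OF that, of p] by linarith
  have cd: "[c j * d j = 1] (mod int Q)" if "j \<le> 2" for j
  proof -
    have "1 + j * p + (Q - 1 - (1 + j * p)) = Q - 1" using small[OF that] by simp
    hence "c j * d j = int (g ^ (Q - 1))" unfolding c_def d_def by (metis power_add of_nat_power)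
    moreover have "[g ^ (Q - 1) = 1] (mod Q)" unfolding ord_divides ordg by simp
    ultimately show ?thesis by (metis cong_int_iff of_nat_1)
  qed
  have nonres: "\<not> [z ^ p = c j] (mod int Q)" for z j
  proof
    assume z: "[z ^ p = c j] (mod int Q)"
    define y where "y = nat (z mod int Q)"
    have y: "int y = z mod int Q" unfolding y_def using Q(1) prime_gt_0_nat by simp
    have "[int y ^ p = z ^ p] (mod int Q)" unfolding y by (intro cong_pow) simp
    hence "[int (y ^ p) = int (g ^ (1 + j * p))] (mod int Q)" using z unfolding c_def by (metis cong_trans of_nat_power)
    hence yg: "[y ^ p = g ^ (1 + j * p)] (mod Q)" by (simp only: cong_int_iff)
    have "\<not> Q dvd y"
    proof
      assume "Q dvd y"
      hence "Q dvd y ^ p" using p2 by (intro dvd_power_le[of Q y 1 p, simplified]) auto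
      hence "Q dvd g ^ (1 + j * p)" using yg by (simp add: cong_dvd_iff)
      hence "Q dvd g" using Q(1) prime_dvd_power_nat by blast
      thus False using cop Q(1) by (metis coprime_absorb_left not_prime_unit)
    qed
    hence "[y ^ (Q - 1) = 1] (mod Q)" by (rule fermat_theorem[OF Q(1)])
    hence "[(y ^ p) ^ h = 1] (mod Q)" unfolding h power_mult .
    moreover have "[(y ^ p) ^ h = (g ^ (1 + j * p)) ^ h] (mod Q)" by (intro cong_pow yg)
    ultimately have "[g ^ ((1 + j * p) * h) = 1] (mod Q)" unfolding power_mult using cong_sym cong_trans by blast
    hence "p * h dvd (1 + j * p) * h" unfolding ord_divides ordg h .
    hence "h * p dvd h * (1 + j * p)" by (simp only: mult.commute)
    hence "p dvd 1 + j * p" using h0 nat_mult_dvd_cancel_disj[of h p "1 + j * p"] by simp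
    hence "p dvd 1" by (metis dvd_add_left_iff dvd_triv_right)
    thus False using p by simp
  qed
  have distinct: "\<not> [c i = c j] (mod int Q)" if "i < j" "j \<le> 2" for i j
  proof
    assume "[c i = c j] (mod int Q)"
    hence "[int (g ^ (1 + i * p)) = int (g ^ (1 + j * p))] (mod int Q)" unfolding c_def by simp
    hence "[g ^ (1 + i * p) = g ^ (1 + j * p)] (mod Q)" by (simp only: cong_int_iff)
    hence "[1 + i * p = 1 + j * p] (mod Q - 1)" by (simp only: order_divides_expdiff[OF cop] ordg)
    hence "1 + i * p = 1 + j * p" using small[of i] small[of j] that by (simp add: cong_def)
    thus False using that p2 by simp
  qed
  have "\<exists>j\<le>2. \<not> int Q dvd s + c j + d j"
  proof (rule ccontr)
    assume "\<not> ?thesis"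
    hence all: "int Q dvd s + c j + d j" if "j \<le> 2" for j using that by blast
    have quad: "int Q dvd c j * c j + s * c j + 1" if "j \<le> 2" for j
    proof -
      have "int Q dvd c j * (s + c j + d j) - (c j * d j - 1)"
        by (rule dvd_diff[OF dvd_mult[OF all[OF that]] cd[OF that, unfolded cong_iff_dvd_diff]])
      thus ?thesis by (simp add: algebra_simps)
    qed
    have sum: "int Q dvd c i + c j + s" if "i < j" "j \<le> 2" for i j
    proof -
      have "int Q dvd (c i * c i + s * c i + 1) - (c j * c j + s * c j + 1)"
        by (rule dvd_diff[OF quad quad]) (use that in auto)
      also have "(c i * c i + s * c i + 1) - (c j * c j + s * c j + 1) = (c i - c j) * (c i + c j + s)"
        by (simp add: algebra_simps)
      finally have "int Q dvd c i - c j \<or> int Q dvd c i + c j + s" using Q(1) by (simp add: prime_dvd_mult_iff)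
      thus ?thesis using distinct[OF that] by (simp add: cong_iff_dvd_diff)
    qed
    have "int Q dvd (c 0 + c 1 + s) - (c 0 + c 2 + s)" by (rule dvd_diff[OF sum sum]) auto
    hence "[c 1 = c 2] (mod int Q)" by (simp add: cong_iff_dvd_diff)
    thus False using distinct[of 1 2] by simp
  qed
  then obtain j where j: "j \<le> 2" "\<not> int Q dvd s + c j + d j" by blast
  show ?thesis
    by (rule that[OF Q(1) _ cd[OF j(1)] nonres j(2)]) (use Q(2) in simp)
qed

lemma distinct_primes_with_nonresidues:
  fixes I :: "(nat \<times> nat) set" and s :: int
  assumes "finite I" "\<And>x. x \<in> I \<Longrightarrow> prime (fst x)"
  shows "\<exists>Q c d. inj_on Q I \<and> (\<forall>x\<in>I. prime (Q x) \<and> Q x > N \<and> [c x * d x = 1] (mod int (Q x)) \<and>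
    (\<forall>z :: int. \<not> [z ^ fst x = c x] (mod int (Q x))) \<and> \<not> int (Q x) dvd s + c x + d x)"
  using assms
proof (induction I)
  case empty
  show ?case by simp
next
  case (insert x I)
  then obtain Q :: "nat \<times> nat \<Rightarrow> nat" and c d where IH: "inj_on Q I"
    "\<forall>x\<in>I. prime (Q x) \<and> Q x > N \<and> [c x * d x = 1] (mod int (Q x)) \<and>
    (\<forall>z :: int. \<not> [z ^ fst x = c x] (mod int (Q x))) \<and> \<not> int (Q x) dvd s + c x + d x" by auto
  have "prime (fst x)" using insert.prems by simp
  \<comment> \<open>A prime above the sum of the earlier ones is different from each of them, as the
    Chinese remainder theorem will require.\<close>
  then obtain Q0 :: nat and c0 d0 where Q0: "prime Q0" "Q0 > N + (\<Sum>x\<in>I. Q x)" "[c0 * d0 = 1] (mod int Q0)"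
    "\<And>z. \<not> [z ^ fst x = c0] (mod int Q0)" "\<not> int Q0 dvd s + c0 + d0"
    using prime_with_nonresidue[of "fst x" "N + (\<Sum>x\<in>I. Q x)" s] by blast
  have "Q y < Q0" if "y \<in> I" for y using Q0(2) member_le_sum[OF that, of Q] insert.hyps(1) by fastforce
  hence "Q0 \<notin> Q ` I" by auto
  hence "inj_on (Q(x := Q0)) (insert x I)" using IH(1) insert.hyps(2)
    by (auto simp: inj_on_def)
  moreover have "\<forall>y\<in>insert x I. prime ((Q(x := Q0)) y) \<and> (Q(x := Q0)) y > N \<and>
    [(c(x := c0)) y * (d(x := d0)) y = 1] (mod int ((Q(x := Q0)) y)) \<and>
    (\<forall>z :: int. \<not> [z ^ fst y = (c(x := c0)) y] (mod int ((Q(x := Q0)) y))) \<and>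
    \<not> int ((Q(x := Q0)) y) dvd s + (c(x := c0)) y + (d(x := d0)) y"
    using IH(2) Q0 insert.hyps(2) by (auto simp: fun_upd_def)
  ultimately show ?case by blast
qed

lemma poly_pderiv_linear_product:
  fixes a :: "nat \<Rightarrow> int"
  shows "poly (pderiv ((\<Prod>j<n. [:- a j, 1:]) - [:C:])) t = (\<Sum>i<n. \<Prod>j\<in>{..<n} - {i}. t - a j)"
  by (simp add: pderiv_diff pderiv_prod pderiv_pCons poly_sum poly_prod)

text \<open>The residue conditions for one pair \<open>(p, i)\<close>: modulo \<open>Q\<close> the numbers \<open>t - a j\<close> are
  \<open>c\<close> for \<open>j = i\<close>, \<open>1 / c\<close> for \<open>j = n - 1\<close> and \<open>1\<close> otherwise.\<close>

lemma linear_product_residues: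
  fixes a :: "nat \<Rightarrow> int" and Q t c d b :: int
  assumes n: "n \<ge> 3" and i: "i < n - 1" and cd: "[c * d = 1] (mod Q)"
    and t: "[int n * t = int n - 2 + c + d] (mod Q)" and sum0: "(\<Sum>j<n. a j) = 0"
    and a: "\<And>j. j < n - 1 \<Longrightarrow> [a j = t - (if j = i then c else 1)] (mod Q)"
    and b: "[b = 1] (mod Q)" and nd: "\<not> Q dvd int n - 2 + c + d"
  shows "Q dvd poly ((\<Prod>j<n. [:- a j, 1:]) - [:b:]) t"
    "\<not> Q dvd poly (pderiv ((\<Prod>j<n. [:- a j, 1:]) - [:b:])) t"
    "[t - a i = c] (mod Q)" "\<forall>j<n - 1. j \<noteq> i \<longrightarrow> [t - a j = 1] (mod Q)"
proof -
  define e where "e j = (if j = i then c else if j = n - 1 then d else 1)" for j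
  have ta: "[t - a j = (if j = i then c else 1)] (mod Q)" if "j < n - 1" for j
    using cong_diff[OF cong_refl[of t Q] a[OF that]] by simp
  thus "[t - a i = c] (mod Q)" "\<forall>j<n - 1. j \<noteq> i \<longrightarrow> [t - a j = 1] (mod Q)" using i by force+
  have nn: "{..<n} = insert (n - 1) {..<n - 1}" using n by auto
  have "(\<Sum>j<n. t - a j) = int n * t" using sum0 by (simp add: sum_subtractf)
  \<comment> \<open>The last entry is not prescribed: the vanishing sum and the choice of
    \<open>t\<close> leave exactly \<open>d\<close> for it.\<close>
  hence "t - a (n - 1) = int n * t - (\<Sum>j<n - 1. t - a j)" unfolding nn by simp
  also have "[\<dots> = (int n - 2 + c + d) - (\<Sum>j<n - 1. if j = i then c else 1)] (mod Q)"
    using ta by (intro cong_diff t cong_sum) auto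
  also have "(\<Sum>j<n - 1. if j = i then c else 1) = c + (int n - 2)"
  proof -
    have "(\<Sum>j<n - 1. if j = i then c else 1) = (\<Sum>j<n - 1. 1 + (if j = i then c - 1 else 0))"
      by (intro sum.cong) auto
    also have "\<dots> = int (n - 1) + (c - 1)" unfolding sum.distrib using i by simp
    finally show ?thesis using n by (simp add: of_nat_diff)
  qed
  finally have tl: "[t - a (n - 1) = d] (mod Q)" by simp
  have te: "[t - a j = e j] (mod Q)" if "j < n" for j
    using ta[of j] tl that i by (cases "j = n - 1") (auto simp: e_def)
  have pe: "(\<Prod>j<n. e j) = c * d"
  proof -
    have "(\<Prod>j<n. e j) = (\<Prod>j\<in>{i, n - 1}. e j)"
      using i by (intro prod.mono_neutral_right) (auto simp: e_def)
    thus ?thesis using i by (simp add: e_def)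
  qed
  have "[(\<Prod>j<n. t - a j) = (\<Prod>j<n. e j)] (mod Q)" using te by (intro cong_prod) auto
  hence "[(\<Prod>j<n. t - a j) = 1] (mod Q)" unfolding pe using cd by (rule cong_trans)
  hence "[(\<Prod>j<n. t - a j) - b = 1 - 1] (mod Q)" using b by (rule cong_diff)
  thus "Q dvd poly ((\<Prod>j<n. [:- a j, 1:]) - [:b:]) t" by (simp add: poly_prod cong_0_iff)
  \<comment> \<open>The residues \<open>e j\<close> have product 1, so omitting \<open>e k\<close>
    leaves its inverse. The sum of these inverses, \<open>n - 2 + c + d\<close>, is the derivative
    at \<open>t\<close>, which \<open>nd\<close> keeps from vanishing.\<close>
  have "[(\<Prod>j\<in>{..<n} - {k}. t - a j) = (if k = i then d else if k = n - 1 then c else 1)] (mod Q)" if k: "k < n" for k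
  proof -
    have "[(\<Prod>j\<in>{..<n} - {k}. t - a j) = (\<Prod>j\<in>{..<n} - {k}. e j)] (mod Q)" using te by (intro cong_prod) auto
    moreover have "(\<Prod>j\<in>{..<n} - {k}. e j) = (\<Prod>j\<in>{i, n - 1} - {k}. e j)"
      using i by (intro prod.mono_neutral_right) (auto simp: e_def)
    moreover have "[(\<Prod>j\<in>{i, n - 1} - {k}. e j) = (if k = i then d else if k = n - 1 then c else 1)] (mod Q)"
    proof -
      consider "k = i" | "k = n - 1" | "k \<noteq> i" "k \<noteq> n - 1" by blast
      thus ?thesis
      proof cases
        case 1
        hence "{i, n - 1} - {k} = {n - 1}" using i by auto
        thus ?thesis using 1 i by (simp add: e_def)
      next
        case 2
        hence "{i, n - 1} - {k} = {i}" using i by auto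
        thus ?thesis using 2 i by (simp add: e_def)
      next
        case 3
        hence "{i, n - 1} - {k} = {i, n - 1}" by auto
        thus ?thesis using 3 i cd by (simp add: e_def)
      qed
    qed
    ultimately show ?thesis by (metis (no_types, lifting) cong_trans)
  qed
  hence "[(\<Sum>k<n. \<Prod>j\<in>{..<n} - {k}. t - a j) = (\<Sum>k<n. if k = i then d else if k = n - 1 then c else 1)] (mod Q)"
    by (intro cong_sum) auto
  also have "(\<Sum>k<n. if k = i then d else if k = n - 1 then c else 1) = int n - 2 + c + d"
  proof -
    have "(\<Sum>k<n. if k = i then d else if k = n - 1 then c else 1) =
        (\<Sum>k<n. 1 + (if k = i then d - 1 else 0) + (if k = n - 1 then c - 1 else 0))"
      using i by (intro sum.cong) auto
    also have "\<dots> = int n + (d - 1) + (c - 1)" unfolding sum.distrib using i n by simp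
    finally show ?thesis by simp
  qed
  finally show "\<not> Q dvd poly (pderiv ((\<Prod>j<n. [:- a j, 1:]) - [:b:])) t"
    unfolding poly_pderiv_linear_product using nd by (simp add: cong_dvd_iff)
qed

text \<open>Modulo \<open>q\<close> the entries are 0, ..., n - 2 and \<open>-T\<close>, where
  \<open>T\<close> is the sum of these; since \<open>T + n < q\<close>, the last one differs from
  the others as well.\<close>

lemma distinct_residues_coprime:
  fixes a :: "nat \<Rightarrow> int" and q :: nat
  assumes n: "n \<ge> 3" and q: "prime q" "q > n\<^sup>2" and a: "\<And>j. j < n - 1 \<Longrightarrow> [a j = int j] (mod int q)"
    and sum0: "(\<Sum>j<n. a j) = 0" and ij: "i < n" "j < n" "i \<noteq> j"
  shows "Rings.coprime (a i - a j) (int q)"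
proof -
  have nn: "{..<n} = insert (n - 1) {..<n - 1}" using n by auto
  define T where "T = (\<Sum>j<n - 1. j)"
  have T1: "T \<ge> 1" unfolding T_def using n member_le_sum[of 1 "{..<n - 1}" "\<lambda>j. j"] by simp
  have Tn: "T + n < q"
  proof -
    have "T \<le> (\<Sum>j<n - 1. n)" unfolding T_def by (intro sum_mono) auto
    also have "\<dots> = n * n - n" by (simp add: diff_mult_distrib)
    finally have "T + n \<le> n * n" using n by (simp add: le_diff_conv2)
    thus ?thesis using q(2) by (simp add: power2_eq_square)
  qed
  have al: "[a (n - 1) = - int T] (mod int q)"
  proof -
    have "a (n - 1) = - (\<Sum>j<n - 1. a j)" using sum0 unfolding nn by simp
    also have "[\<dots> = - (\<Sum>j<n - 1. int j)] (mod int q)" unfolding cong_minus_minus_iff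
      using a by (intro cong_sum) auto
    finally show ?thesis unfolding T_def by simp
  qed
  have main: "\<not> int q dvd a i - a j" if "i < j" "j < n" for i j
  proof (cases "j = n - 1")
    case True
    have "[a i - a j = int i - (- int T)] (mod int q)"
      unfolding True using that True by (intro cong_diff a al) auto
    hence c: "[a i - a j = int (i + T)] (mod int q)" by simp
    have "\<not> q dvd i + T" using T1 Tn that by (intro nat_dvd_not_less) auto
    thus ?thesis using cong_dvd_iff[OF c] by (simp only: int_dvd_int_iff) simp
  next
    case False
    have c: "[a j - a i = int j - int i] (mod int q)" using that False by (intro cong_diff a) auto
    have "\<not> q dvd j - i" using Tn that by (intro nat_dvd_not_less) auto
    hence "\<not> int q dvd int (j - i)" by (simp only: int_dvd_int_iff) simp
    hence "\<not> int q dvd a j - a i" using cong_dvd_iff[OF c] that by (simp add: of_nat_diff)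
    thus ?thesis by (metis dvd_minus_iff minus_diff_eq)
  qed
  have "\<not> int q dvd a i - a j" using main[of i j] main[of j i] ij by (metis dvd_minus_iff minus_diff_eq nat_neq_iff)
  moreover have "prime (int q)" using q(1) by simp
  ultimately show ?thesis using prime_imp_coprime[of "int q"] coprime_commute by blast
qed

lemma product_family_residue_class:
  fixes n l :: nat
  assumes n: "n \<ge> 3" and l: "l \<ge> 1"
  obtains q \<kappa> M :: nat and a0 :: "nat \<Rightarrow> nat" where "prime q" "\<kappa> > 0" "M > 0" "q dvd M"
    "\<forall>a :: nat \<Rightarrow> int. (\<forall>j<n - 1. [a j = int (a0 j)] (mod int M)) \<longrightarrow> (\<Sum>j<n. a j) = 0 \<longrightarrow>
      (\<forall>i<n. \<forall>j<n. i \<noteq> j \<longrightarrow> Rings.coprime (a i - a j) (int q))"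
    "\<forall>a :: nat \<Rightarrow> int. (\<forall>j<n - 1. [a j = int (a0 j)] (mod int M)) \<longrightarrow> (\<Sum>j<n. a j) = 0 \<longrightarrow>
      (\<forall>m p i. prime p \<longrightarrow> p dvd l \<longrightarrow> i < n - 1 \<longrightarrow> (\<exists>Q t c d. prime Q \<and>
        Q dvd poly ((\<Prod>j<n. [:- a j, 1:]) - [:(int q ^ (\<kappa> * m)) ^ l:]) t \<and>
        \<not> Q dvd poly (pderiv ((\<Prod>j<n. [:- a j, 1:]) - [:(int q ^ (\<kappa> * m)) ^ l:])) t \<and>
        [t - a i = c] (mod Q) \<and> (\<forall>j<n - 1. j \<noteq> i \<longrightarrow> [t - a j = 1] (mod Q)) \<and>
        [c * d = 1] (mod Q) \<and> (\<forall>z. \<not> [z ^ p = c] (mod Q))))"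
proof -
  obtain q where q: "prime q" "q > n\<^sup>2" using bigger_prime by blast
  define I where "I = prime_factors l \<times> {..<n - 1}"
  have fI: "finite I" unfolding I_def by simp
  have "prime (fst x)" if "x \<in> I" for x using that unfolding I_def by (auto simp: in_prime_factors_iff)
  then obtain Q c d where inj: "inj_on Q I" and Q: "\<And>x. x \<in> I \<Longrightarrow> prime (Q x)" "\<And>x. x \<in> I \<Longrightarrow> Q x > q + n"
    "\<And>x. x \<in> I \<Longrightarrow> [c x * d x = 1] (mod int (Q x))"
    "\<And>x z. x \<in> I \<Longrightarrow> \<not> [z ^ fst x = c x] (mod int (Q x))"
    "\<And>x. x \<in> I \<Longrightarrow> \<not> int (Q x) dvd int n - 2 + c x + d x"
    using distinct_primes_with_nonresidues[OF fI, of "q + n" "int n - 2"] by metis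
  \<comment> \<open>By Fermat's theorem every power of \<open>q\<close> with exponent divisible by
    \<open>\<kappa>\<close> is 1 modulo all auxiliary primes, so the conditions hold for all
    \<open>m\<close> at once.\<close>
  define \<kappa> where "\<kappa> = (\<Prod>x\<in>I. Q x - 1)"
  have k0: "\<kappa> > 0" unfolding \<kappa>_def using Q(1) prime_gt_1_nat by (intro prod_pos) auto
  have "\<exists>t. [int n * t = int n - 2 + c x + d x] (mod int (Q x))" if x: "x \<in> I" for x
  proof -
    have "\<not> Q x dvd n" using Q(2)[OF x] n by (intro nat_dvd_not_less) auto
    hence "Rings.coprime (int n) (int (Q x))"
      using Q(1)[OF x] by (metis coprime_commute coprime_int_iff prime_imp_coprime)
    then obtain y where "[int n * y = 1] (mod int (Q x))" using cong_solve_coprime_int by blast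
    from cong_mult[OF this cong_refl[of "int n - 2 + c x + d x"]]
    show ?thesis by (intro exI[of _ "y * (int n - 2 + c x + d x)"]) (simp add: mult.assoc)
  qed
  then obtain t where t: "\<And>x. x \<in> I \<Longrightarrow> [int n * t x = int n - 2 + c x + d x] (mod int (Q x))" by metis
  \<comment> \<open>The moduli for the Chinese remainder theorem: \<open>None\<close> stands for
    \<open>q\<close>, \<open>Some x\<close> for the auxiliary prime of the pair
    \<open>x\<close>.\<close>
  define mo where "mo = case_option q Q"
  define J where "J = insert None (Some ` I)"
  have fJ: "finite J" unfolding J_def using fI by simp
  have pm: "prime (mo x)" if "x \<in> J" for x using that q(1) Q(1) unfolding J_def mo_def by auto
  have injm: "mo x \<noteq> mo y" if "x \<in> J" "y \<in> J" "x \<noteq> y" for x y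
    using that inj Q(2) unfolding J_def mo_def inj_on_def by (fastforce split: option.splits)
  have copm: "\<forall>x\<in>J. \<forall>y\<in>J. x \<noteq> y \<longrightarrow> Rings.coprime (mo x) (mo y)"
    using pm injm primes_coprime by blast
  define tg where "tg j x = (case x of None \<Rightarrow> int j | Some y \<Rightarrow> t y - (if j = snd y then c y else 1))" for j x
  have "\<exists>a0. \<forall>x\<in>J. [int a0 = tg j x] (mod int (mo x))" for j
  proof -
    obtain a0 where a0: "\<forall>x\<in>J. [a0 = nat (tg j x mod int (mo x))] (mod mo x)"
      using chinese_remainder_nat[OF fJ copm, of "\<lambda>x. nat (tg j x mod int (mo x))"] by blast
    have "[int a0 = tg j x] (mod int (mo x))" if x: "x \<in> J" for x
    proof -
      have "int (nat (tg j x mod int (mo x))) = tg j x mod int (mo x)" using prime_gt_0_nat[OF pm[OF x]] by simp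
      moreover have "[int a0 = int (nat (tg j x mod int (mo x)))] (mod int (mo x))" 
        using bspec[OF a0 x] by (simp only: cong_int_iff)
      ultimately show ?thesis by simp
    qed
    thus ?thesis by blast
  qed
  then obtain a0 where a0: "\<And>j x. x \<in> J \<Longrightarrow> [int (a0 j) = tg j x] (mod int (mo x))" by metis
  define M where "M = (\<Prod>x\<in>J. mo x)"
  have dM: "mo x dvd M" if "x \<in> J" for x unfolding M_def using that fJ by (intro dvd_prodI)
  have M0: "M > 0" unfolding M_def using pm prime_gt_0_nat by (intro prod_pos) auto
  have red: "[a j = tg j x] (mod int (mo x))"
    if "\<And>j. j < n - 1 \<Longrightarrow> [a j = int (a0 j)] (mod int M)" "j < n - 1" "x \<in> J" for a j x
    using cong_trans[OF cong_dvd_modulus[OF that(1)[OF that(2)], of "int (mo x)"] a0[OF that(3)]] dM[OF that(3)] by simp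
  show ?thesis
  proof (rule that[OF q(1) k0 M0])
    show "q dvd M" using dM[of None] unfolding J_def mo_def by simp
    have "Rings.coprime (a i - a j) (int q)"
      if "\<forall>j<n - 1. [a j = int (a0 j)] (mod int M)" "(\<Sum>j<n. a j) = 0" "i < n" "j < n" "i \<noteq> j" for a :: "nat \<Rightarrow> int" and i j
    proof (rule distinct_residues_coprime[OF n q _ that(2-5)])
      fix j assume "j < n - 1"
      thus "[a j = int j] (mod int q)" using red[of a j None] that(1) unfolding J_def mo_def tg_def by simp
    qed
    thus "\<forall>a :: nat \<Rightarrow> int. (\<forall>j<n - 1. [a j = int (a0 j)] (mod int M)) \<longrightarrow> (\<Sum>j<n. a j) = 0 \<longrightarrow>
      (\<forall>i<n. \<forall>j<n. i \<noteq> j \<longrightarrow> Rings.coprime (a i - a j) (int q))" by blast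
  next
    show "\<forall>a :: nat \<Rightarrow> int. (\<forall>j<n - 1. [a j = int (a0 j)] (mod int M)) \<longrightarrow> (\<Sum>j<n. a j) = 0 \<longrightarrow>
      (\<forall>m p i. prime p \<longrightarrow> p dvd l \<longrightarrow> i < n - 1 \<longrightarrow> (\<exists>Q t c d. prime Q \<and>
        Q dvd poly ((\<Prod>j<n. [:- a j, 1:]) - [:(int q ^ (\<kappa> * m)) ^ l:]) t \<and>
        \<not> Q dvd poly (pderiv ((\<Prod>j<n. [:- a j, 1:]) - [:(int q ^ (\<kappa> * m)) ^ l:])) t \<and>
        [t - a i = c] (mod Q) \<and> (\<forall>j<n - 1. j \<noteq> i \<longrightarrow> [t - a j = 1] (mod Q)) \<and>
        [c * d = 1] (mod Q) \<and> (\<forall>z. \<not> [z ^ p = c] (mod Q))))"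
    proof (intro allI impI)
      fix a :: "nat \<Rightarrow> int" and m p i
      assume a0': "\<forall>j<n - 1. [a j = int (a0 j)] (mod int M)" "(\<Sum>j<n. a j) = 0" and p: "prime p" "p dvd l" and i: "i < n - 1"
      have a: "\<And>j. j < n - 1 \<Longrightarrow> [a j = int (a0 j)] (mod int M)" "(\<Sum>j<n. a j) = 0" using a0' by auto
      define x where "x = (p, i)"
      have x: "x \<in> I" unfolding x_def I_def using p i l by (simp add: in_prime_factors_iff)
      have a': "[a j = t x - (if j = i then c x else 1)] (mod int (Q x))" if "j < n - 1" for j
        using red[of a j "Some x"] a(1) that x unfolding J_def mo_def tg_def
        by (cases "j = i") (simp_all add: x_def)
      have "[int (q ^ (\<kappa> * m)) = 1] (mod int (Q x))"
      proof -
        have "\<not> Q x dvd q" using Q(2)[OF x] q(1) prime_gt_0_nat by (intro nat_dvd_not_less) auto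
        hence f: "[q ^ (Q x - 1) = 1] (mod Q x)" by (rule fermat_theorem[OF Q(1)[OF x]])
        have "Q x - 1 dvd \<kappa>" unfolding \<kappa>_def using x fI by (intro dvd_prodI)
        then obtain e where e: "\<kappa> = (Q x - 1) * e" by auto
        have "[(q ^ (Q x - 1)) ^ (e * m) = 1 ^ (e * m)] (mod Q x)" by (intro cong_pow f)
        hence "[q ^ (\<kappa> * m) = 1] (mod Q x)" unfolding e by (simp add: power_mult[symmetric] mult.assoc)
        thus ?thesis by (metis cong_int_iff of_nat_1)
      qed
      hence b: "[(int q ^ (\<kappa> * m)) ^ l = 1] (mod int (Q x))" using cong_pow[of "int (q ^ (\<kappa> * m))" 1 "int (Q x)" l] by simp
      note R = linear_product_residues[OF n i Q(3)[OF x] t[OF x] a(2) a' b Q(5)[OF x]]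
      show "\<exists>Q t c d. prime Q \<and>
          Q dvd poly ((\<Prod>j<n. [:- a j, 1:]) - [:(int q ^ (\<kappa> * m)) ^ l:]) t \<and>
          \<not> Q dvd poly (pderiv ((\<Prod>j<n. [:- a j, 1:]) - [:(int q ^ (\<kappa> * m)) ^ l:])) t \<and>
          [t - a i = c] (mod Q) \<and> (\<forall>j<n - 1. j \<noteq> i \<longrightarrow> [t - a j = 1] (mod Q)) \<and>
          [c * d = 1] (mod Q) \<and> (\<forall>z. \<not> [z ^ p = c] (mod Q))"
        using R Q(1)[OF x] Q(3)[OF x] Q(4)[OF x]
        by (intro exI[of _ "int (Q x)"] exI[of _ "t x"] exI[of _ "c x"] exI[of _ "d x"]) (simp add: x_def)
    qed
  qed
qed

section \<open>Families of fields\<close>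

lemma roots_of_unity_bound: "n > 0 \<Longrightarrow> finite {z :: complex. z ^ n = 1} \<and> card {z :: complex. z ^ n = 1} \<le> n"
proof -
  assume n: "n > 0"
  let ?p = "monom 1 n - 1 :: complex poly"
  have d: "degree ?p \<le> n" by (rule degree_diff_le) (auto simp: degree_monom_le)
  have "coeff ?p n \<noteq> coeff 0 n" using n by (simp add: coeff_1)
  hence "?p \<noteq> 0" by metis
  hence "finite {z. poly ?p z = 0}" "card {z. poly ?p z = 0} \<le> n"
    using poly_roots_finite card_poly_roots_bound d order_trans by blast+
  moreover have "{z. poly ?p z = 0} = {z. z ^ n = 1}" by (simp add: poly_monom)
  ultimately show ?thesis by simp
qed

definition class_order_family :: "nat \<Rightarrow> nat \<Rightarrow> real \<Rightarrow> complex set set \<Rightarrow> bool" where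
  "class_order_family n l X S \<longleftrightarrow> finite S \<and>
     (\<forall>K\<in>S. number_field n K \<and> cmod (number_field_disc n K) \<le> X \<and>
        l dvd class_number K \<and> has_class_of_order K l) \<and>
     (\<forall>K\<in>S. \<forall>L\<in>S. K \<noteq> L \<longrightarrow> \<not> fields_isomorphic K L)"

lemma class_order_family_mono: "class_order_family n l X S \<Longrightarrow> X \<le> Y \<Longrightarrow> class_order_family n l Y S"
  unfolding class_order_family_def by (auto intro: order_trans)

text \<open>The centres are multiples of the \<open>n\<close>-th roots of unity, so there are at
  most \<open>n^n\<close> labellings of the embeddings; this is the factor lost in the
  count.\<close>

lemma class_order_family_exists:
  fixes F :: "'a \<Rightarrow> int poly" and R :: "'a \<Rightarrow> nat \<Rightarrow> complex" and C :: complex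
  assumes fin: "finite A" and inj: "inj_on F A" and nf: "\<And>a. a \<in> A \<Longrightarrow> number_field_poly (F a) n (R a)"
    and near: "\<And>a z. a \<in> A \<Longrightarrow> ip (F a) z = 0 \<Longrightarrow> \<exists>\<omega>\<in>{\<omega>. \<omega> ^ n = 1}. cmod (z - C * \<omega>) < 1 / 2"
    and cls: "\<And>a. a \<in> A \<Longrightarrow> has_class_of_order (number_field_poly.K (R a)) l" and l: "l \<ge> 1"
    and bnd: "r \<ge> 0" "\<And>a z. a \<in> A \<Longrightarrow> ip (F a) z = 0 \<Longrightarrow> cmod z \<le> r" and n: "n > 0"
  obtains S where "class_order_family n l ((fact n)\<^sup>2 * r ^ (n * (n - 1))) S" "card A \<le> card S * n ^ n"
proof -
  note ru = roots_of_unity_bound[OF n]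
  obtain S where S: "S \<subseteq> (\<lambda>a. number_field_poly.K (R a)) ` A"
    "\<forall>K\<in>S. \<forall>L\<in>S. K \<noteq> L \<longrightarrow> \<not> fields_isomorphic K L"
    "card A \<le> card S * card {z :: complex. z ^ n = 1} ^ n"
    by (rule many_nonisomorphic_fields[OF fin inj nf conjunct1[OF ru] near])
  have "card A \<le> card S * n ^ n"
    using S(3) ru by (meson mult_le_mono2 order_trans power_mono zero_le)
  moreover have "number_field n K \<and> cmod (number_field_disc n K) \<le> (fact n)\<^sup>2 * r ^ (n * (n - 1)) \<and>
      l dvd class_number K \<and> has_class_of_order K l" if KS: "K \<in> S" for K
  proof -
    obtain a where a: "a \<in> A" "K = number_field_poly.K (R a)" using S(1) KS by blast
    interpret N: number_field_poly "F a" n "R a" using nf[OF a(1)] .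
    have "cmod (R a i) \<le> r" if "i < n" for i using bnd(2)[OF a(1)] N.ip_f_root[OF that] by blast
    hence "cmod (number_field_disc n K) \<le> (fact n * r ^ (n * (n - 1) div 2))\<^sup>2"
      using N.disc_bound[OF bnd(1)] a(2) by simp
    also have "\<dots> = (fact n)\<^sup>2 * r ^ (n * (n - 1))"
    proof -
      have "even (n * (n - 1))" by (cases n) auto
      hence "n * (n - 1) div 2 * 2 = n * (n - 1)" by (rule dvd_div_mult_self)
      hence "(r ^ (n * (n - 1) div 2))\<^sup>2 = r ^ (n * (n - 1))" by (simp only: power_mult[symmetric])
      thus ?thesis by (simp only: power_mult_distrib)
    qed
    finally show ?thesis
      using N.number_field N.order_dvd_class_number[OF l] cls[OF a(1)] a(2) by simp
  qed
  moreover have "finite S" using S(1) fin by (meson finite_imageI finite_subset)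
  ultimately show ?thesis using that[of S] S(2) unfolding class_order_family_def by blast
qed

lemma class_families:
  fixes n l :: nat
  assumes n: "n \<ge> 3" and l: "l \<ge> 2"
  shows "\<exists>g C c :: real. \<exists>m0 :: nat. g > 1 \<and> C > 0 \<and> c > 0 \<and> (\<forall>m\<ge>m0. \<exists>S.
    class_order_family n l (C * g ^ (m * (2 * (n - 1)\<^sup>2 * l))) S \<and> real (card S) \<ge> c * g ^ (m * (n - 1)))"
proof -
  have l1: "l \<ge> 1" using l by simp
  obtain q \<kappa> M :: nat and a0 :: "nat \<Rightarrow> nat" where par: "prime q" "\<kappa> > 0" "M > 0" "q dvd M"
    and cop: "\<forall>a :: nat \<Rightarrow> int. (\<forall>j<n - 1. [a j = int (a0 j)] (mod int M)) \<longrightarrow> (\<Sum>j<n. a j) = 0 \<longrightarrow>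
      (\<forall>i<n. \<forall>j<n. i \<noteq> j \<longrightarrow> Rings.coprime (a i - a j) (int q))"
    and res: "\<forall>a :: nat \<Rightarrow> int. (\<forall>j<n - 1. [a j = int (a0 j)] (mod int M)) \<longrightarrow> (\<Sum>j<n. a j) = 0 \<longrightarrow>
      (\<forall>m p i. prime p \<longrightarrow> p dvd l \<longrightarrow> i < n - 1 \<longrightarrow> (\<exists>Q t c d. prime Q \<and>
        Q dvd poly ((\<Prod>j<n. [:- a j, 1:]) - [:(int q ^ (\<kappa> * m)) ^ l:]) t \<and>
        \<not> Q dvd poly (pderiv ((\<Prod>j<n. [:- a j, 1:]) - [:(int q ^ (\<kappa> * m)) ^ l:])) t \<and>
        [t - a i = c] (mod Q) \<and> (\<forall>j<n - 1. j \<noteq> i \<longrightarrow> [t - a j = 1] (mod Q)) \<and>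
        [c * d = 1] (mod Q) \<and> (\<forall>z. \<not> [z ^ p = c] (mod Q))))"
    by (rule product_family_residue_class[OF n l1])
  define g where "g = q ^ \<kappa>"
  have g2: "g \<ge> 2" unfolding g_def using prime_ge_2_nat[OF par(1)] par(2)
    one_less_power[of q \<kappa>] by simp
  define A0 where "A0 = (\<Sum>j<n. a0 j)"
  \<comment> \<open>The factor \<open>n\<close> accounts for the last entry, minus the sum of the
    \<open>n - 1\<close> others.\<close>
  define C1 where "C1 = n * (A0 + M)"
  have C10: "C1 > 0" unfolding C1_def using n par(3) by simp
  \<comment> \<open>The factor \<open>8 * 2^n\<close> is the square root of \<open>64 * 4^n\<close>,
    so that \<open>A \<le> C1 * w / C2\<close> together with \<open>w^2 \<le> B\<close> gives
    \<open>big\<close>.\<close>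
  define C2 where "C2 = 8 * 2 ^ n * C1"
  have C20: "C2 > 0" unfolding C2_def using C10 by simp
  define CC where "CC = (fact n)\<^sup>2 * (2 :: real) ^ (n * (n - 1))"
  \<comment> \<open>One factor is lost in rounding \<open>w / C2\<close> down to \<open>Y\<close>,
    in each of \<open>n - 1\<close> coordinates; \<open>n^n\<close> is the number of
    labellings.\<close>
  define cc where "cc = 1 / ((2 * real C2) ^ (n - 1) * real n ^ n)"
  have "\<exists>S. class_order_family n l (CC * real g ^ (m * (2 * (n - 1)\<^sup>2 * l))) S \<and>
      real (card S) \<ge> cc * real g ^ (m * (n - 1))" if m: "m \<ge> C2" for m
  proof -
    define w where "w = g ^ m"
    have "m < 2 ^ m" by simp
    also have "(2 :: nat) ^ m \<le> w" unfolding w_def using g2 by (intro power_mono) auto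
    finally have w: "w \<ge> C2" using m by linarith
    define Y where "Y = w div C2"
    have Y1: "Y \<ge> 1" unfolding Y_def using w C20 by (simp add: div_greater_zero_iff Suc_le_eq)
    have YC: "C2 * Y \<le> w" unfolding Y_def by simp
    have Yw: "w \<le> 2 * C2 * Y"
    proof -
      have "w < C2 * Y + C2" unfolding Y_def using C20 dividend_less_times_div[of C2 w] by simp
      also have "\<dots> \<le> C2 * Y + C2 * Y" using Y1 by simp
      finally show ?thesis by simp
    qed
    \<comment> \<open>A multiple of \<open>\<kappa>\<close>, as the residue conditions demand, and
      chosen so that \<open>q^k = w^(2(n - 1))\<close>.\<close>
    define k where "k = \<kappa> * (m * (2 * (n - 1)))"
    have wk: "w ^ (2 * (n - 1)) = q ^ k" unfolding w_def g_def k_def by (simp add: power_mult[symmetric] mult.assoc)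
    define B where "B = root n (real q ^ (k * l))"
    have B0: "B > 0" unfolding B_def using n prime_gt_0_nat[OF par(1)] by simp
    have Bn: "B ^ n = real q ^ (k * l)" unfolding B_def using n by simp
    have Bnw: "B ^ n = real w ^ (2 * (n - 1) * l)"
    proof -
      have "real q ^ (k * l) = real (q ^ k) ^ l" by (simp add: power_mult)
      also have "\<dots> = real (w ^ (2 * (n - 1))) ^ l" unfolding wk ..
      also have "\<dots> = real w ^ (2 * (n - 1) * l)" by (simp add: power_mult)
      finally show ?thesis unfolding Bn .
    qed
    have w1: "real w \<ge> 1" using w C20 by simp
    have Bw: "B \<ge> (real w)\<^sup>2"
    proof (rule ccontr)
      assume "\<not> ?thesis"
      hence "B ^ n < ((real w)\<^sup>2) ^ n" using B0 n by (intro power_strict_mono) auto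
      also have "\<dots> = real w ^ (2 * n)" by (simp add: power_mult)
      also have "\<dots> \<le> real w ^ (2 * (n - 1) * l)"
      proof (rule power_increasing[OF _ w1])
        \<comment> \<open>Here \<open>l \<ge> 2\<close> is essential: for \<open>l = 1\<close> the
          exponent \<open>2(n - 1)\<close> would fall short of \<open>2n\<close>.\<close>
        have "n \<le> (n - 1) * 2" using n by simp
        also have "\<dots> \<le> (n - 1) * l" using l by (intro mult_le_mono2)
        finally show "2 * n \<le> 2 * (n - 1) * l" by simp
      qed
      finally show False using Bnw by simp
    qed
    define A where "A = real (C1 * Y)"
    have A1: "A \<ge> 1" unfolding A_def using C10 Y1 by (metis One_nat_def Suc_leI mult_le_mono nat_mult_1_right of_nat_1 of_nat_mono)
    have big: "64 * 4 ^ n * A\<^sup>2 \<le> B"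
    proof -
      have "8 * 2 ^ n * A = real (C2 * Y)" unfolding A_def C2_def by simp
      also have "\<dots> \<le> real w" using YC by (simp only: of_nat_le_iff)
      finally have "(8 * 2 ^ n * A)\<^sup>2 \<le> (real w)\<^sup>2" using A1 by (intro power_mono) auto
      moreover have "(8 * 2 ^ n * A)\<^sup>2 = 64 * 4 ^ n * A\<^sup>2"
      proof -
        have "(4 :: real) ^ n = (2 * 2) ^ n" by simp
        also have "\<dots> = (2 ^ n)\<^sup>2" by (simp only: power_mult_distrib power2_eq_square)
        finally show ?thesis by (simp only: power_mult_distrib) simp
      qed
      ultimately show ?thesis using Bw by linarith
    qed
    define af where "af x j = (if j < n - 1 then int (a0 j + M * x j) else - (\<Sum>i<n - 1. int (a0 i + M * x i)))"
      for x :: "nat \<Rightarrow> nat" and j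
    define X where "X = (\<Pi>\<^sub>E j\<in>{..<n - 1}. {..<Y})"
    have finX: "finite X" unfolding X_def by (intro finite_PiE) auto
    have cX: "card X = Y ^ (n - 1)" unfolding X_def by (simp add: card_PiE)
    have nn: "{..<n} = insert (n - 1) {..<n - 1}" using n by auto
    have sum0: "(\<Sum>j<n. af x j) = 0" for x unfolding nn by (simp add: af_def)
    have cong: "[af x j = int (a0 j)] (mod int M)" if "j < n - 1" for x j
      using that by (simp add: af_def cong_iff_dvd_diff)
    have small: "\<bar>real_of_int (af x j)\<bar> \<le> A" if x: "x \<in> X" and j: "j < n" for x j
    proof -
      have b: "a0 i + M * x i \<le> (A0 + M) * Y" if "i < n - 1" for i
      proof -
        have "a0 i \<le> A0" unfolding A0_def using that by (intro member_le_sum) auto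
        moreover have "A0 * 1 \<le> A0 * Y" using Y1 by (intro mult_le_mono2)
        ultimately have a: "a0 i \<le> A0 * Y" by linarith
        have "x i \<le> Y" using x that unfolding X_def by (auto simp: PiE_iff less_imp_le)
        hence "M * x i \<le> M * Y" by (rule mult_le_mono2)
        with a show ?thesis unfolding distrib_right by (rule add_mono)
      qed
      have "\<bar>af x j\<bar> \<le> int (C1 * Y)"
      proof (cases "j < n - 1")
        case True
        have "a0 j + M * x j \<le> (A0 + M) * Y" by (rule b[OF True])
        also have "\<dots> \<le> C1 * Y" unfolding C1_def using n by (simp add: mult.assoc)
        finally have "int (a0 j + M * x j) \<le> int (C1 * Y)" by (simp only: of_nat_le_iff)
        moreover have "af x j = int (a0 j + M * x j)" using True by (simp only: af_def if_True)
        ultimately show ?thesis by (simp only: abs_of_nat)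
      next
        case False
        have "(\<Sum>i<n - 1. a0 i + M * x i) \<le> (\<Sum>i<n - 1. (A0 + M) * Y)" by (intro sum_mono b) auto
        also have "\<dots> = (n - 1) * ((A0 + M) * Y)" by simp
        also have "\<dots> \<le> C1 * Y" unfolding C1_def mult.assoc by (intro mult_le_mono1) simp
        finally have "int (\<Sum>i<n - 1. a0 i + M * x i) \<le> int (C1 * Y)" by (simp only: of_nat_le_iff)
        thus ?thesis using False unfolding af_def by (simp add: sum_nonneg)
      qed
      hence "real_of_int \<bar>af x j\<bar> \<le> real_of_int (int (C1 * Y))" by (simp only: of_int_le_iff)
      thus ?thesis unfolding A_def by simp
    qed
    have copx: "Rings.coprime (af x i - af x j) (int q)" if "i < n" "j < n" "i \<noteq> j" for x i j
      using cop[rule_format, of "af x" i j] cong sum0 that by blast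
    have q1: "\<not> int q dvd 1" using prime_gt_1_nat[OF par(1)] by simp
    have qdiff: "\<not> int q dvd af x i - af x j" if "i < n" "j < n" "i \<noteq> j" for x i j
      using copx[OF that] q1 by (metis coprime_absorb_right)
    have injx: "inj_on (af x) {..<n}" for x
      using qdiff by (intro inj_onI) (metis diff_self dvd_0_right lessThan_iff)
    have pf: "product_family n l k q (af x) A B" if "x \<in> X" for x
      by unfold_locales (use n par small[OF that] A1 B0 Bn big injx sum0 in auto)
    define F where "F x = product_family.f n l k q (af x)" for x
    have Feq: "F x = (\<Prod>j<n. [:- af x j, 1:]) - [:(int q ^ k) ^ l:]" if "x \<in> X" for x
      unfolding F_def using product_family.f_def[OF pf[OF that]] .
    have injF: "inj_on F X"
    proof (rule inj_onI)
      fix x y assume xy: "x \<in> X" "y \<in> X" "F x = F y"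
      hence eq: "(\<Prod>j<n. [:- af x j, 1:]) = (\<Prod>j<n. [:- af y j, 1:])" using Feq by simp
      have "x j = y j" if j: "j < n - 1" for j
      proof -
        have "poly (\<Prod>j<n. [:- af x j, 1:]) (af x j) = 0" using j unfolding poly_prod by (intro prod_zero) auto
        hence "\<exists>i<n. af x j = af y i" unfolding eq poly_prod by auto
        then obtain i where i: "i < n" "af x j = af y i" by blast
        \<comment> \<open>Equal polynomials have the same roots, possibly at other indices. As
          \<open>q\<close> divides \<open>M\<close> and entries at different indices are incongruent
          modulo \<open>q\<close>, the indices must agree.\<close>
        have "[af x j = af y j] (mod int M)" using cong[OF j, of x] cong[OF j, of y] by (metis cong_sym cong_trans)
        hence "int q dvd af y i - af y j" using i(2) par(4) by (metis cong_iff_dvd_diff dvd_trans of_nat_dvd_iff)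
        moreover have "j < n" using j by simp
        ultimately have "i = j" using qdiff[of i j y] i(1) by blast
        thus ?thesis using i(2) j par(3) unfolding af_def by simp
      qed
      thus "x = y" using xy unfolding X_def by (intro PiE_ext[of _ "{..<n - 1}"]) auto
    qed
    have "\<exists>R. number_field_poly (F x) n R \<and> has_class_of_order (number_field_poly.K R) l" if x: "x \<in> X" for x
    proof -
      interpret P: product_family n l k q "af x" A B by (rule pf[OF x])
      obtain t :: real where t: "ip P.f (of_real t) = 0" "\<And>j. j < n \<Longrightarrow> real_of_int (af x j) < t"
        using P.real_root by blast
      obtain R where R: "number_field_poly P.f n R" "R 0 = of_real t"
        using number_field_poly_exists[of n P.f "of_real t"] P.degree_f P.monic_f P.irreducible_f t(1) n by auto
      interpret N: number_field_poly P.f n R by (rule R(1))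
      obtain c1 c2 where c: "c1 < n" "c2 < n" "c1 \<noteq> c2" "R c2 = cnj (R c1)"
        using P.complex_conjugate_roots[OF R(1)] by blast
      have "has_class_of_order N.K l"
      proof (rule N.product_family_class[OF n _ c])
        show "1 \<le> l" using l by simp
        show "N.\<theta> \<in> \<real>" "\<And>j. j < n \<Longrightarrow> real_of_int (af x j) < Re N.\<theta>"
          unfolding N.\<theta>_def R(2) using t(2) by auto
        show "P.f = (\<Prod>j<n. [:- af x j, 1:]) - [:(int q ^ k) ^ l:]" by (rule P.f_def)
        show "Rings.coprime (\<Prod>j\<in>{..<n} - {i}. af x i - af x j) (int q ^ k)" if "i < n - 1" for i
          using that copx by (intro coprime_power_right_iff[THEN iffD2] disjI1 prod_coprime_left) auto
        show "\<exists>Q t c d. prime Q \<and> Q dvd poly P.f t \<and> \<not> Q dvd poly (pderiv P.f) t \<and>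
            [t - af x i = c] (mod Q) \<and> (\<forall>j<n - 1. j \<noteq> i \<longrightarrow> [t - af x j = 1] (mod Q)) \<and>
            [c * d = 1] (mod Q) \<and> (\<forall>z. \<not> [z ^ p = c] (mod Q))" if "prime p" "p dvd l" "i < n - 1" for p i
          unfolding P.f_def unfolding k_def
            using res[rule_format, of "af x" p i "m * (2 * (n - 1))"] cong sum0 that by blast
      qed
      thus ?thesis using R(1) unfolding F_def by blast
    qed
    then obtain R where R: "\<And>x. x \<in> X \<Longrightarrow> number_field_poly (F x) n (R x)"
      "\<And>x. x \<in> X \<Longrightarrow> has_class_of_order (number_field_poly.K (R x)) l" by metis
    obtain S where S: "class_order_family n l ((fact n)\<^sup>2 * (2 * B) ^ (n * (n - 1))) S" "card X \<le> card S * n ^ n"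
    proof (rule class_order_family_exists[OF finX injF R(1) _ R(2)])
      show "\<exists>\<omega>\<in>{\<omega>. \<omega> ^ n = 1}. cmod (z - complex_of_real B * \<omega>) < 1 / 2" if "x \<in> X" "ip (F x) z = 0" for x z
        using product_family.root_near_center[OF pf[OF that(1)]] that(2) unfolding F_def by blast
      show "cmod z \<le> 2 * B" if "x \<in> X" "ip (F x) z = 0" for x z
        using product_family.root_bounds(2)[OF pf[OF that(1)]] product_family.B_large(2)[OF pf[OF that(1)]]
          that(2) A1 unfolding F_def by fastforce
    qed (use l n B0 in auto)
    have "(fact n)\<^sup>2 * (2 * B) ^ (n * (n - 1)) = CC * real g ^ (m * (2 * (n - 1)\<^sup>2 * l))"
    proof -
      have "B ^ (n * (n - 1)) = real w ^ (2 * (n - 1) * l * (n - 1))" unfolding power_mult[of B] Bnw by (simp add: power_mult)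
      also have "\<dots> = real g ^ (m * (2 * (n - 1)\<^sup>2 * l))"
        unfolding w_def by (simp add: power_mult[symmetric] power2_eq_square mult_ac)
      finally show ?thesis unfolding CC_def by (simp add: power_mult_distrib)
    qed
    moreover have "cc * real g ^ (m * (n - 1)) \<le> real (card S)"
    proof -
      have "real g ^ (m * (n - 1)) = real w ^ (n - 1)" unfolding w_def by (simp add: power_mult)
      also have "\<dots> \<le> real (2 * C2 * Y) ^ (n - 1)" using Yw by (intro power_mono) (simp_all only: of_nat_le_iff of_nat_0_le_iff)
      also have "\<dots> = (2 * real C2) ^ (n - 1) * real (card X)" unfolding cX by (simp add: power_mult_distrib)
      also have "\<dots> \<le> (2 * real C2) ^ (n - 1) * (real (card S) * real n ^ n)"
        using S(2) by (intro mult_left_mono) (metis of_nat_le_iff of_nat_mult of_nat_power, simp)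
      finally show ?thesis unfolding cc_def using C20 n by (simp add: divide_le_eq mult_ac)
    qed
    ultimately show ?thesis using S(1) by metis
  qed
  moreover have "real g > 1" using g2 by simp
  moreover have "CC > 0" unfolding CC_def by simp
  moreover have "cc > 0" unfolding cc_def using C20 n by simp
  ultimately show ?thesis by blast
qed

text \<open>For \<open>l = 1\<close> the fields \<open>\<rat>(c\<^sup>1\<^sup>/\<^sup>n)\<close> with \<open>c \<equiv> 2 (mod 4)\<close> suffice: the constant
  coefficient of a monic factor of degree \<open>d\<close> has absolute value \<open>c\<^sup>d\<^sup>/\<^sup>n\<close>.\<close>

lemma irreducible_binomial:
  fixes c :: nat
  assumes n: "n > 0" and c: "c mod 4 = 2"
  shows "irreducible (map_poly rat_of_int (monom 1 n - [:int c:]))"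
proof (rule irreducible_by_monic_factors[of _ n])
  let ?f = "monom 1 n - [:int c:]"
  have "degree [:int c:] < degree (monom (1::int) n)" using n by (simp add: degree_monom_eq)
  thus df: "degree ?f = n" using degree_add_eq_left[of "- [:int c:]" "monom 1 n"]
    by (simp only: diff_conv_add_uminus degree_minus degree_monom_eq[of "1::int" n, simplified])
  have lf: "lead_coeff ?f = 1" unfolding df using n by (simp add: coeff_pCons split: nat.splits)
  fix g h assume gh: "map_poly rat_of_int ?f = g * h" "lead_coeff g = 1" "degree g < n"
  obtain y where y: "\<And>x. rp g x = (\<Prod>m<degree g. x - y m)" "\<And>m. m < degree g \<Longrightarrow> ip ?f (y m) = 0"
    "\<And>m :: int. \<exists>v :: int. poly g (of_int m) = of_int v"
    using monic_factor_values[OF gh(1,2) lf] by metis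
  obtain v :: int where v: "poly g 0 = of_int v" using y(3)[of 0] by auto
  have "cmod (y m) ^ n = real c" if "m < degree g" for m
  proof -
    have "y m ^ n = of_nat c" using y(2)[OF that] by (simp add: hom_distribs poly_monom)
    thus ?thesis by (metis norm_of_nat norm_power)
  qed
  hence "(\<Prod>m<degree g. cmod (y m) ^ n) = real c ^ degree g" by simp
  moreover have "rp g 0 = of_int v" unfolding rp_def using v of_rat_hom.poly_map_poly[of g 0] by simp
  hence "cmod (of_int v) = cmod (\<Prod>m<degree g. 0 - y m)" unfolding y(1) by (rule arg_cong[of _ _ cmod, OF sym])
  hence "\<bar>real_of_int v\<bar> = (\<Prod>m<degree g. cmod (y m))" by (simp add: prod_norm[symmetric])
  ultimately have "\<bar>real_of_int v\<bar> ^ n = real c ^ degree g" by (simp add: prod_power_distrib)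
  hence "real (nat \<bar>v\<bar> ^ n) = real (c ^ degree g)" by simp
  hence vc: "nat \<bar>v\<bar> ^ n = c ^ degree g" by (simp only: of_nat_eq_iff)
  have c0: "c > 0" using c by (cases c) auto
  have v0: "nat \<bar>v\<bar> \<noteq> 0" using vc c0 n by (metis power_eq_0_iff power_not_zero less_not_refl zero_power)
  \<comment> \<open>The 2-adic valuations of both sides of \<open>vc\<close> show that
    \<open>n\<close> divides the degree of \<open>g\<close>.\<close>
  have "multiplicity 2 c = 1"
  proof (rule multiplicity_eqI)
    have "2 dvd c" using c by presburger
    thus "(2::nat) ^ 1 dvd c" by simp
    show "\<not> (2::nat) ^ Suc 1 dvd c" using c by (simp add: dvd_eq_mod_eq_0)
  qed
  hence "n * multiplicity 2 (nat \<bar>v\<bar>) = degree g"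
    using arg_cong[OF vc, of "multiplicity 2"] v0 c0 by (simp add: prime_elem_multiplicity_power_distrib)
  hence "n dvd degree g" by (metis dvd_triv_left)
  thus "degree g = 0" using gh(3) by (metis nat_dvd_not_less neq0_conv)
qed (use n in auto)

text \<open>The radicands lie in an interval of length about \<open>u / 2\<close> above
  \<open>4 u^2\<close>, too short for their \<open>n\<close>-th roots to move by 1/2. The
  discriminants are O(\<open>u^(2(n - 1))\<close>) and there are about \<open>u / 8\<close>
  radicands, which gives the exponent \<open>1 / (2(n - 1))\<close>.\<close>

lemma binomial_families:
  fixes n :: nat
  assumes n: "n \<ge> 3"
  shows "\<exists>g C c :: real. \<exists>m0 :: nat. g > 1 \<and> C > 0 \<and> c > 0 \<and> (\<forall>m\<ge>m0. \<exists>S.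
    class_order_family n 1 (C * g ^ (m * (2 * (n - 1)\<^sup>2 * 1))) S \<and> real (card S) \<ge> c * g ^ (m * (n - 1)))"
proof -
  define CC where "CC = (fact n)\<^sup>2 * (10 :: real) ^ (n - 1)"
  define cc where "cc = 1 / (16 * real n ^ n)"
  have "\<exists>S. class_order_family n 1 (CC * 2 ^ (m * (2 * (n - 1)\<^sup>2 * 1))) S \<and>
      real (card S) \<ge> cc * 2 ^ (m * (n - 1))" if m: "m \<ge> 4" for m
  proof -
    define u where "u = (2 :: nat) ^ (m * (n - 1))"
    have u16: "u \<ge> 16"
    proof -
      have "m * 1 \<le> m * (n - 1)" using n by (intro mult_le_mono2) simp
      hence "4 \<le> m * (n - 1)" using m by linarith
      hence "(2::nat) ^ 4 \<le> u" unfolding u_def by (intro power_increasing) auto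
      thus ?thesis by simp
    qed
    define X where "X = {..<u div 8}"
    define ct where "ct j = 4 * (u\<^sup>2 + j) + 2" for j
    have ct4: "ct j mod 4 = 2" for j unfolding ct_def by presburger
    have ctb: "ct j \<le> 10 * u\<^sup>2" if "j \<in> X" for j
    proof -
      have "j \<le> u" using that unfolding X_def by (auto intro: le_trans[OF less_imp_le])
      moreover have "u ^ 1 \<le> u\<^sup>2" "u ^ 0 \<le> u\<^sup>2" using u16 by (intro power_increasing; simp)+
      ultimately show ?thesis unfolding ct_def by simp
    qed
    define F where "F j = monom 1 n - [:int (ct j):]" for j
    have ipF: "ip (F j) z = z ^ n - of_nat (ct j)" for j z
      unfolding F_def by (simp add: hom_distribs poly_monom)
    have injF: "inj_on F X" by (auto simp: inj_on_def F_def ct_def)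
    define x0 where "x0 = root n (4 * (real u)\<^sup>2)"
    have x0n: "x0 ^ n = 4 * (real u)\<^sup>2" unfolding x0_def using n by simp
    have x00: "x0 > 0" unfolding x0_def using n u16 by simp
    have x01: "x0 \<ge> 1"
    proof (rule ccontr)
      assume "\<not> ?thesis"
      hence "x0 ^ n < 1" using x00 n power_strict_mono[of x0 1 n] by simp
      moreover have "(real u)\<^sup>2 \<ge> 1" using u16 by (intro one_le_power) simp
      ultimately show False using x0n by simp
    qed
    \<comment> \<open>Since \<open>2(n - 1) \<ge> n\<close>, the power is at least the square root
      of \<open>x0^n = 4 u^2\<close>. Radicands exceed \<open>x0^n\<close> by less than
      \<open>u\<close>, so their roots exceed \<open>x0\<close> by less than
      \<open>u / (2 u)\<close>.\<close>
    have x0b: "x0 ^ (n - 1) \<ge> 2 * real u"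
    proof -
      have "(2 * real u)\<^sup>2 = x0 ^ n" unfolding x0n by (simp add: power_mult_distrib)
      also have "\<dots> \<le> x0 ^ (2 * (n - 1))" using n by (intro power_increasing x01) simp
      also have "\<dots> = (x0 ^ (n - 1))\<^sup>2" by (rule power_even_eq)
      finally show ?thesis by (rule power2_le_imp_le) (use x00 in simp)
    qed
    define xr where "xr j = root n (real (ct j))" for j
    have xrn: "xr j ^ n = real (ct j)" for j unfolding xr_def using n by simp
    have xr0: "xr j \<ge> x0" for j unfolding xr_def x0_def using n by (simp add: ct_def)
    have close: "xr j - x0 < 1 / 2" if j: "j \<in> X" for j
    proof -
      have "xr j * x0 ^ (n - 1) \<le> xr j * xr j ^ (n - 1)"
        using xr0[of j] x00 by (intro mult_left_mono power_mono) auto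
      also have "\<dots> = xr j ^ n" using n by (metis power_eq_if not_numeral_le_zero)
      finally have "(xr j - x0) * x0 ^ (n - 1) \<le> xr j ^ n - x0 ^ n"
        using n power_eq_if[of x0 n] by (simp add: left_diff_distrib split: if_splits)
      also have "\<dots> = 4 * real j + 2" unfolding xrn x0n ct_def by simp
      also have "\<dots> < real u"
      proof -
        have "8 * j < u" using j unfolding X_def by auto
        hence "4 * j + 2 < u" using u16 by linarith
        thus ?thesis by linarith
      qed
      finally have a: "(xr j - x0) * x0 ^ (n - 1) < real u" .
      have "(xr j - x0) * (2 * real u) \<le> (xr j - x0) * x0 ^ (n - 1)" using xr0[of j] by (intro mult_left_mono x0b) simp
      hence "(xr j - x0) * (2 * real u) < (1 / 2) * (2 * real u)" using a by linarith
      thus ?thesis by (rule mult_right_less_imp_less) simp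
    qed
    have cn: "cmod z = xr j" if "ip (F j) z = 0" for z j
    proof -
      have "z ^ n = of_nat (ct j)" using that unfolding ipF by simp
      hence "cmod z ^ n = real (ct j)" by (metis norm_of_nat norm_power)
      thus ?thesis unfolding xr_def using n by (metis norm_ge_zero real_root_power_cancel zero_less_numeral less_le_trans)
    qed
    have near: "\<exists>\<omega>\<in>{\<omega>. \<omega> ^ n = 1}. cmod (z - complex_of_real x0 * \<omega>) < 1 / 2" if "j \<in> X" "ip (F j) z = 0" for z j
    proof -
      have xp: "xr j > 0" using xr0[of j] x00 by linarith
      have zn: "z ^ n = of_nat (ct j)" using that(2) unfolding ipF by simp
      define \<omega> where "\<omega> = z / of_real (xr j)"
      have "\<omega> ^ n = of_nat (ct j) / of_real (xr j ^ n)" unfolding \<omega>_def power_divide zn by simp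
      also have "\<dots> = 1"
      proof -
        have "ct j \<noteq> 0" unfolding ct_def by simp
        thus ?thesis unfolding xrn by simp
      qed
      finally have w: "\<omega> ^ n = 1" .
      have "z - of_real x0 * \<omega> = of_real (xr j - x0) * \<omega>" unfolding \<omega>_def using xp by (simp add: field_simps)
      moreover have "cmod \<omega> = 1" using power_eq_1_iff[OF w] n by simp
      ultimately have "cmod (z - of_real x0 * \<omega>) = \<bar>xr j - x0\<bar>" by (metis mult_1_right norm_mult norm_of_real)
      thus ?thesis using w close[OF that(1)] xr0[of j] by auto
    qed
    have "\<exists>R. number_field_poly (F j) n R" for j
    proof -
      have irr: "irreducible (map_poly rat_of_int (F j))" unfolding F_def using n ct4 by (intro irreducible_binomial) auto
      have "degree [:int (ct j):] < degree (monom (1::int) n)" using n by (simp add: degree_monom_eq)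
      hence d: "degree (F j) = n" unfolding F_def using degree_add_eq_left[of "- [:int (ct j):]" "monom 1 n"]
        by (simp only: diff_conv_add_uminus degree_minus degree_monom_eq[of "1::int" n, simplified])
      have lf: "lead_coeff (F j) = 1" unfolding d unfolding F_def using n by (simp add: coeff_pCons split: nat.splits)
      have "ip (F j) (of_real (xr j)) = of_real (xr j ^ n - real (ct j))" unfolding ipF by simp
      hence "ip (F j) (of_real (xr j)) = 0" unfolding xrn by simp
      thus ?thesis using number_field_poly_exists[OF _ d lf irr] n by (metis gr0I not_numeral_le_zero)
    qed
    then obtain R where R: "\<And>j. number_field_poly (F j) n (R j)" by metis
    define r where "r = root n (10 * (real u)\<^sup>2)"
    have r0: "r \<ge> 0" unfolding r_def using n by simp
    have rn: "r ^ n = 10 * (real u)\<^sup>2" unfolding r_def using n by simp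
    obtain S where S: "class_order_family n 1 ((fact n)\<^sup>2 * r ^ (n * (n - 1))) S" "card X \<le> card S * n ^ n"
    proof (rule class_order_family_exists[of X F n R "of_real x0" 1 r])
      show "has_class_of_order (number_field_poly.K (R j)) 1" for j
        by (rule number_field_poly.has_class_of_order_1[OF R])
      show "cmod z \<le> r" if "j \<in> X" "ip (F j) z = 0" for j z
      proof -
        have "real (ct j) \<le> real (10 * u\<^sup>2)" using ctb[OF that(1)] by (simp only: of_nat_le_iff)
        thus ?thesis unfolding cn[OF that(2)] xr_def r_def using n by simp
      qed
    qed (use R injF near n r0 in \<open>auto simp: X_def\<close>)
    have "(fact n)\<^sup>2 * r ^ (n * (n - 1)) = CC * 2 ^ (m * (2 * (n - 1)\<^sup>2 * 1))"
    proof -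
      have "real u = 2 ^ (m * (n - 1))" unfolding u_def by simp
      hence "((real u)\<^sup>2) ^ (n - 1) = 2 ^ (m * (n - 1) * 2 * (n - 1))" by (simp only: power_mult[symmetric])
      also have "m * (n - 1) * 2 * (n - 1) = m * (2 * (n - 1)\<^sup>2 * 1)" by (simp add: power2_eq_square)
      finally have "((real u)\<^sup>2) ^ (n - 1) = 2 ^ (m * (2 * (n - 1)\<^sup>2 * 1))" .
      moreover have "r ^ (n * (n - 1)) = 10 ^ (n - 1) * ((real u)\<^sup>2) ^ (n - 1)"
        unfolding power_mult[of r] rn by (rule power_mult_distrib)
      ultimately show ?thesis unfolding CC_def by simp
    qed
    moreover have "cc * 2 ^ (m * (n - 1)) \<le> real (card S)"
    proof -
      have "u \<le> 16 * card X" unfolding X_def using u16 by simp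
      also have "\<dots> \<le> 16 * (card S * n ^ n)" using S(2) by simp
      finally have "real u \<le> real (16 * (card S * n ^ n))" by (simp only: of_nat_le_iff)
      thus ?thesis unfolding cc_def u_def using n by (simp add: divide_le_eq mult_ac)
    qed
    ultimately show ?thesis using S(1) by metis
  qed
  moreover have "CC > 0" "cc > 0" unfolding CC_def cc_def using n by simp_all
  ultimately show ?thesis by (intro exI[of _ 2] exI[of _ CC] exI[of _ cc] exI[of _ 4]) simp
qed

text \<open>For given \<open>X\<close> use the largest \<open>m\<close> whose scale
  \<open>C * g^(m * E)\<close> does not exceed it. The next scale exceeds \<open>X\<close>, so the
  count falls short of the right order by at most the factor \<open>C powr \<mu> * g^d\<close> built
  into \<open>c'\<close>.\<close>

lemma geometric_scales:
  fixes g C c :: real and P :: "real \<Rightarrow> nat \<Rightarrow> bool"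
  assumes g: "g > 1" and C: "C > 0" and c: "c > 0" and E: "E > 0" "real d / real E = \<mu>"
    and fam: "\<And>m. m \<ge> m0 \<Longrightarrow> \<exists>N. P (C * g ^ (m * E)) N \<and> real N \<ge> c * g ^ (m * d)"
    and mono: "\<And>X Y N. P X N \<Longrightarrow> X \<le> Y \<Longrightarrow> P Y N"
  shows "\<exists>X0 > 0. \<exists>c > 0. \<forall>X > X0. \<exists>N. P X N \<and> real N \<ge> c * X powr \<mu>"
proof -
  define c' where "c' = c / (C powr \<mu> * g ^ d)"
  have "\<exists>N. P X N \<and> real N \<ge> c' * X powr \<mu>" if X: "X > C * g ^ (m0 * E)" for X
  proof -
    have gE: "g ^ E > 1" using g E(1) by (simp add: one_less_power)
    define T where "T = {m. C * g ^ (m * E) \<le> X}"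
    have "\<exists>b. \<forall>m\<in>T. m \<le> b"
    proof -
      obtain b where b: "X / C < (g ^ E) ^ b" using real_arch_pow[OF gE] by blast
      have "m \<le> b" if "m \<in> T" for m
      proof (rule ccontr)
        assume "\<not> m \<le> b"
        hence "(g ^ E) ^ b \<le> (g ^ E) ^ m" using gE by (intro power_increasing) auto
        also have "\<dots> = g ^ (m * E)" by (simp add: power_mult mult.commute)
        also have "\<dots> \<le> X / C" using that C unfolding T_def by (simp add: le_divide_eq mult.commute)
        finally show False using b by simp
      qed
      thus ?thesis by blast
    qed
    hence fT: "finite T" using finite_nat_set_iff_bounded_le by blast
    have "m0 \<in> T" using X unfolding T_def by simp
    define m where "m = Max T"
    have mT: "m \<in> T" and mm: "m \<ge> m0" unfolding m_def using fT \<open>m0 \<in> T\<close> by (auto intro: Max_in)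
    have "Suc m \<notin> T" using Max_ge[OF fT, of "Suc m"] unfolding m_def by auto
    hence Xs: "X < C * g ^ (Suc m * E)" unfolding T_def by simp
    obtain N where N: "P (C * g ^ (m * E)) N" "real N \<ge> c * g ^ (m * d)" using fam[OF mm] by blast
    have X0: "X > 0" using X C g by (smt (verit) mult_pos_pos zero_less_power)
    have mu: "\<mu> \<ge> 0" using E(2) by auto
    have "X powr \<mu> \<le> (C * g ^ (Suc m * E)) powr \<mu>" using Xs X0 mu by (intro powr_mono2) auto
    also have "\<dots> = C powr \<mu> * g ^ (Suc m * d)"
    proof -
      have "(g ^ (Suc m * E)) powr \<mu> = g powr (real (Suc m * E) * \<mu>)"
        using g by (simp add: powr_powr flip: powr_realpow)
      also have "real (Suc m * E) * \<mu> = real (Suc m) * (real E * \<mu>)" by (simp only: of_nat_mult mult.assoc)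
      also have "real E * \<mu> = real d" using E by auto
      also have "real (Suc m) * real d = real (Suc m * d)" by (simp only: of_nat_mult)
      also have "g powr real (Suc m * d) = g ^ (Suc m * d)" using g by (intro powr_realpow) simp
      finally show ?thesis using C g by (simp add: powr_mult)
    qed
    finally have "c' * X powr \<mu> \<le> c' * (C powr \<mu> * g ^ (Suc m * d))"
      using c C g unfolding c'_def by (intro mult_left_mono) auto
    also have "\<dots> = c * g ^ (m * d)" unfolding c'_def using C g by (simp add: power_add)
    finally have "c' * X powr \<mu> \<le> real N" using N(2) by linarith
    moreover have "P X N" using mono[OF N(1)] mT unfolding T_def by simp
    ultimately show ?thesis by blast
  qed
  moreover have "C * g ^ (m0 * E) > 0" "c' > 0" using C c g unfolding c'_def by auto
  ultimately show ?thesis by blast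
qed

theorem theorem1p1:
  fixes n l :: nat
  assumes "n \<ge> 3" and "l \<ge> 1"
  shows "\<exists>X0 > 0. \<exists>c > 0. \<forall>X :: real. X > X0 \<longrightarrow>
    (\<exists>S :: complex set set. finite S \<and>
       real (card S) \<ge> c * X powr (1 / (2 * (real n - 1) * real l)) \<and>
       (\<forall>K\<in>S. number_field n K \<and> cmod (number_field_disc n K) \<le> X \<and>
                l dvd class_number K \<and> has_class_of_order K l) \<and>
       (\<forall>K\<in>S. \<forall>L\<in>S. K \<noteq> L \<longrightarrow> \<not> fields_isomorphic K L))"
proof -
  obtain g C c :: real and m0 :: nat where fam: "g > 1" "C > 0" "c > 0"
    "\<And>m. m \<ge> m0 \<Longrightarrow> \<exists>S. class_order_family n l (C * g ^ (m * (2 * (n - 1)\<^sup>2 * l))) S \<and> real (card S) \<ge> c * g ^ (m * (n - 1))"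
  proof (cases "l = 1")
    case True
    thus ?thesis using binomial_families[OF assms(1)] that by blast
  next
    case False
    hence "l \<ge> 2" using assms(2) by simp
    thus ?thesis using class_families[OF assms(1)] that by blast
  qed
  define E where "E = 2 * (n - 1)\<^sup>2 * l"
  have E0: "E > 0" unfolding E_def using assms by simp
  have mu: "real (n - 1) / real E = 1 / (2 * (real n - 1) * real l)"
    unfolding E_def using assms by (simp add: of_nat_diff power2_eq_square)
  have "\<exists>X0 > 0. \<exists>c > 0. \<forall>X > X0. \<exists>N. (\<exists>S. class_order_family n l X S \<and> card S = N) \<and>
      real N \<ge> c * X powr (1 / (2 * (real n - 1) * real l))"
  proof (rule geometric_scales[OF fam(1-3) E0 mu, of m0])
    show "\<exists>N. (\<exists>S. class_order_family n l (C * g ^ (m * E)) S \<and> card S = N) \<and> c * g ^ (m * (n - 1)) \<le> real N"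
      if "m0 \<le> m" for m using fam(4)[OF that] unfolding E_def by blast
    show "\<exists>S. class_order_family n l Y S \<and> card S = N"
      if "\<exists>S. class_order_family n l X S \<and> card S = N" "X \<le> Y" for X Y N
      using that class_order_family_mono by blast
  qed
  thus ?thesis unfolding class_order_family_def by (metis (no_types, lifting))
qed

end
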